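(* Let $\mathcal{E}=(E_0\xleftarrow{\partial}E_1,\rho,\circ,\Omega,S)$ be a CLWX 2-algebroid over a smooth manifold $M$ and let $L$ be the weak Lie 3-algebra on the complex $\Gamma E_0\xleftarrow{\partial}\Gamma E_1\xleftarrow{\mathcal{D}}C^\infty(M)$ with structure maps $\lambda_2=(-\circ-)+S\circ_2\mathcal{D}$, $\lambda_{2;1}=S$, $\lambda_3=\Omega$, $\lambda_{2;1,1}=\lambda_{3;1}=\lambda_{3;2}=\lambda_4=0$. Then the skew-symmetrization $\bar L$ of $L$ is a Lie 3-algebra, and its structure maps are explicitly given by $$\bar\lambda_2=\tfrac12\big((-\circ-)-(-\circ-)^{(12)}-S\circ_1\mathcal{D}+S\circ_2\mathcal{D}\big),$$ $$\bar\lambda_3=\Omega-\tfrac1{12}\sum_{\sigma\in\mathbb{S}_3}(-1)^{|\sigma|}\big(S\circ_1(-\circ-)\big)^\sigma,$$ $$\bar\lambda_4=S\circ_1\Omega.$$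
   Context: CLWX 2-algebroid. Let $E=(E_0\xleftarrow{\partial}E_1)$ be a 2-term dg vector bundle over $M$ (degrees $0,1$), equipped with a morphism $\rho\colon E\to TM$ of dg vector bundles ($TM$ in degree 0), a graded bilinear map $\circ\colon\Gamma E\otimes\Gamma E\to\Gamma E$ which is skew-symmetric on $\Gamma E_0\otimes\Gamma E_0$, a graded 3-form $\Omega\colon\Gamma E\otimes\Gamma E\otimes\Gamma E\to\Gamma E[1]$ (skew-symmetric; raising degree by 1), and a non-degenerate symmetric bilinear form $S\colon\Gamma E\otimes\Gamma E\to C^\infty(M)$. Define $\mathcal{D}\colon C^\infty(M)\to\Gamma E_1$ by $S(e,\mathcal{D}f)=\rho(e)(f)$ for all $e\in\Gamma E$. This is a CLWX 2-algebroid if: (i) $E_0,E_1$ are isotropic: $S(E_i,E_i)=0$ for $i=0,1$; (ii) $(\Gamma E_0\xleftarrow{\partial}\Gamma E_1,\circ,\Omega)$ is a Leibniz 2-algebra, i.e. a Leibniz 3-algebra (below) with $L_2=0$, $\lambda_2=\circ$, $\lambda_3=\Omega$, $\lambda_4=0$; (iii) $e\circ e=\frac12\mathcal{D}S(e,e)$ for all $e\in\Gamma E$; (iv) $S(\partial e_1,e_2)=S(e_1,\partial e_2)$ for all $e_i\in\Gamma E$; (v) $\rho(e_1)S(e_2,e_3)=S(e_1\circ e_2,e_3)+S(e_2,e_1\circ e_3)$ for all $e_i\in\Gamma E$; (vi) $S(\Omega(e_1,e_2,e_3),e_4)=-S(e_3,\Omega(e_1,e_2,e_4))$ for all $e_i\in\Gamma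 E$. In the structure maps on $L$ ($L_0=\Gamma E_0$, $L_1=\Gamma E_1$, $L_2=C^\infty(M)$), $\circ$, $S$, $\Omega$ are extended by zero to tuples containing elements of $L_2$, and $\mathcal{D}$ by zero to $\Gamma E$; $(S\circ_2\mathcal{D})(e,f)=S(e,\mathcal{D}f)$ and $(S\circ_1\mathcal{D})(f,e)=S(\mathcal{D}f,e)$ for $e\in\Gamma E_0$, $f\in C^\infty(M)$. Conventions. Complexes are over $\Bbbk=\mathbb{R}$ with differential of degree $-1$; the Koszul sign rule is used. A 3-term complex is $(L,d)=L_0\xleftarrow{d}L_1\xleftarrow{d}L_2$, concentrated in degrees $0,1,2$. A map $L^{\otimes n}\to L[k]$ means a linear map raising degree by $k$. For a multilinear map $\mu$: $\mu^\sigma(v_1,\dots,v_n)=\varepsilon\,\mu(v_{\sigma^{-1}(1)},\dots,v_{\sigma^{-1}(n)})$ with $\varepsilon$ the Koszul sign ($(123)$ means $1\mapsto2\mapsto3\mapsto1$); $\partial(\mu)=d\circ\mu-(-1)^{|\mu|}\mu\circ d_{L^{\otimes n}}$; $(\mu\circ_i\nu)(v_1,\dots,v_{n+k-1})=(-1)^{|\nu|(|v_1|+\dots+|v_{i-1}|)}\mu(v_1,\dots,v_{i-1},\nu(v_i,\dots,v_{i+k-1}),v_{i+k},\dots)$ for $\nu$ of arity $k$. Leibniz 3-algebra. A 3-term complex $(L,d)$ with maps $\lambda_2\colon L^{\otimes2}\to L$, $\lambda_3\colon L^{\otimes3}\to L[1]$, $\lambda_4\colon L^{\otimes4}\to L[2]$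 such that $\partial(\lambda_2)=0$; $\partial(\lambda_3)=\lambda_2\circ_2\lambda_2-\lambda_2\circ_1\lambda_2-(\lambda_2\circ_2\lambda_2)^{(12)}$; $\partial(\lambda_4)=\lambda_2\circ_1\lambda_3+\lambda_2\circ_2\lambda_3-(\lambda_2\circ_2\lambda_3)^{(12)}+(\lambda_2\circ_2\lambda_3)^{(123)}-\lambda_3\circ_1\lambda_2+\lambda_3\circ_2\lambda_2-(\lambda_3\circ_2\lambda_2)^{(12)}-\lambda_3\circ_3\lambda_2+(\lambda_3\circ_3\lambda_2)^{(23)}-(\lambda_3\circ_3\lambda_2)^{(132)}$; $0=\lambda_2\circ_1\lambda_4-\lambda_2\circ_2\lambda_4+(\lambda_2\circ_2\lambda_4)^{(12)}-(\lambda_2\circ_2\lambda_4)^{(123)}+(\lambda_2\circ_2\lambda_4)^{(1234)}+\lambda_3\circ_1\lambda_3+\lambda_3\circ_2\lambda_3-(\lambda_3\circ_2\lambda_3)^{(12)}+(\lambda_3\circ_2\lambda_3)^{(123)}+\lambda_3\circ_3\lambda_3-(\lambda_3\circ_3\lambda_3)^{(23)}+(\lambda_3\circ_3\lambda_3)^{(132)}+(\lambda_3\circ_3\lambda_3)^{(234)}-(\lambda_3\circ_3\lambda_3)^{(1342)}+(\lambda_3\circ_3\lambda_3)^{(13)(24)}+\lambda_4\circ_1\lambda_2-\lambda_4\circ_2\lambda_2+(\lambda_4\circ_2\lambda_2)^{(12)}+\lambda_4\circ_3\lambda_2-(\lambda_4\circ_3\lambda_2)^{(23)}+(\lambda_4\circ_3\lambda_2)^{(132)}-\lambda_4\circ_4\lambda_2+(\lambda_4\circ_4\lambda_2)^{(34)}-(\lambda_4\circ_4\lambda_2)^{(243)}+(\lambda_4\circ_4\lambda_2)^{(1432)}$.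 Weak Lie 3-algebra $(L,d,\lambda)$. A Leibniz 3-algebra together with maps $\lambda_{2;1}\colon L^{\otimes2}\to L[1]$, $\lambda_{2;1,1}\colon L^{\otimes2}\to L[2]$, $\lambda_{3;1},\lambda_{3;2}\colon L^{\otimes3}\to L[2]$ such that $\partial(\lambda_{2;1})=\lambda_2+\lambda_2^{(12)}$; $\partial(\lambda_{2;1,1})=\lambda_{2;1}-\lambda_{2;1}^{(12)}$; $\partial(\lambda_{3;1})=\lambda_3+\lambda_3^{(12)}+\lambda_2\circ_1\lambda_{2;1}$; $\partial(\lambda_{3;2})=\lambda_3+\lambda_3^{(23)}-\lambda_2\circ_2\lambda_{2;1}+\lambda_{2;1}\circ_1\lambda_2+(\lambda_{2;1}\circ_2\lambda_2)^{(12)}$; $\lambda_{2;1,1}+\lambda_{2;1,1}^{(12)}=0$; $\lambda_{3;1}-\lambda_{3;1}^{(12)}=\lambda_2\circ_1\lambda_{2;1,1}$; $\lambda_{3;1}-\lambda_{3;2}^{(12)}+\lambda_{3;1}^{(132)}-\lambda_{3;2}+\lambda_{3;1}^{(23)}-\lambda_{3;2}^{(123)}=\lambda_{2;1}\circ_2\lambda_{2;1}+\lambda_{2;1}\circ_1\lambda_{2;1}+(\lambda_{2;1}\circ_2\lambda_{2;1})^{(12)}+(\lambda_{2;1,1}\circ_2\lambda_2)^{(132)}$; $\lambda_{3;2}-\lambda_{3;2}^{(23)}=-\lambda_2\circ_2\lambda_{2;1,1}+\lambda_{2;1,1}\circ_1\lambda_2+(\lambda_{2;1,1}\circ_2\lambda_2)^{(12)}$;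 $\lambda_4+\lambda_4^{(12)}=\lambda_2\circ_1\lambda_{3;1}-\lambda_{3;1}\circ_3\lambda_2+(\lambda_2\circ_2\lambda_{3;1})^{(123)}+\lambda_3\circ_1\lambda_{2;1}$; $\lambda_4+\lambda_4^{(23)}=\lambda_2\circ_1\lambda_{3;2}-\lambda_3\circ_2\lambda_{2;1}+\lambda_2\circ_2\lambda_{3;1}-\lambda_{3;1}\circ_1\lambda_2-(\lambda_{3;1}\circ_2\lambda_2)^{(12)}-(\lambda_{3;1}\circ_3\lambda_2)^{(132)}$; $\lambda_4+\lambda_4^{(34)}=\lambda_{2;1}\circ_1\lambda_3-\lambda_{3;2}\circ_1\lambda_2+\lambda_{3;2}\circ_2\lambda_2-(\lambda_{3;2}\circ_2\lambda_2)^{(12)}+\lambda_3\circ_3\lambda_{2;1}+(\lambda_{3;2}\circ_3\lambda_2)^{(23)}-(\lambda_{3;2}\circ_3\lambda_2)^{(132)}+\lambda_2\circ_2\lambda_{3;2}-(\lambda_2\circ_2\lambda_{3;2})^{(12)}+(\lambda_{2;1}\circ_2\lambda_3)^{(123)}$. A (semi-strict) Lie 3-algebra (3-term $L_\infty$-algebra) is a Leibniz 3-algebra whose structure maps are skew-symmetric: $\bar\lambda_n^\sigma=(-1)^{|\sigma|}\bar\lambda_n$. Skew-symmetrization of a weak Lie 3-algebra $(L,d,\lambda)$: the complex $(L,d)$ with the maps $\bar\lambda_2=\frac12\sum_{\sigma\in\mathbb{S}_2}(-1)^{|\sigma|}\lambda_2^\sigma$; $\bar\lambda_3=\frac16\sum_{\sigma\in\mathbb{S}_3}(-1)^{|\sigma|}\lambda_3^\sigma-\frac1{24}\sum_{\sigma\in\mathbb{S}_3}(-1)^{|\sigma|}(\lambda_{2;1}\circ_1\lambda_2+\lambda_{2;1}\circ_2\lambda_2)^\sigma$;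 $\bar\lambda_4=\frac1{24}\sum_{\sigma\in\mathbb{S}_4}(-1)^{|\sigma|}\lambda_4^\sigma+\frac1{48}\sum_{\sigma\in\mathbb{S}_4}(-1)^{|\sigma|}(\lambda_{2;1}\circ_1\lambda_3-\lambda_{3;1}\circ_1\lambda_2+\lambda_{3;2}\circ_2\lambda_2-\lambda_{2;1}\circ_2\lambda_3-\lambda_{3;1}\circ_2\lambda_2+\lambda_{3;2}\circ_3\lambda_2)^\sigma$. *)

theory Defs
  imports
    "HOL-Analysis.Analysis"
    "HOL-Library.Function_Algebras"
    "HOL-Combinatorics.Permutations"
    "HOL-Combinatorics.Cycles"
begin

section \<open>Linear algebra\<close>

text \<open>Sections of bundles and multilinear maps are functions, so the pointwise real vector
  space structure on functions is needed.\<close>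

instantiation "fun" :: (type, scaleR) scaleR
begin
definition scaleR_fun_def: "c *\<^sub>R f = (\<lambda>x. c *\<^sub>R f x)"
instance ..
end

lemma scaleR_fun_apply [simp]: "(c *\<^sub>R f) x = c *\<^sub>R f x"
  by (simp add: scaleR_fun_def)

instance "fun" :: (type, real_vector) real_vector
  by standard (auto simp: fun_eq_iff scaleR_add_right scaleR_add_left)

definition linear_on :: "'a::real_vector set \<Rightarrow> ('a \<Rightarrow> 'b::real_vector) \<Rightarrow> bool" where
  "linear_on V f \<longleftrightarrow>
     (\<forall>x\<in>V. \<forall>y\<in>V. f (x + y) = f x + f y) \<and> (\<forall>c. \<forall>x\<in>V. f (c *\<^sub>R x) = c *\<^sub>R f x)"

definition direct_sum :: "'a::real_vector set \<Rightarrow> 'a set \<Rightarrow> 'a set" where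
  "direct_sum V W = {v + w | v w. v \<in> V \<and> w \<in> W}"


section \<open>Smooth manifolds and vector bundles\<close>

text \<open>The model space of dimension \<open>n\<close> is realised inside \<^typ>\<open>nat \<Rightarrow> real\<close> (product topology);
  in contrast to the types of class \<^class>\<open>euclidean_space\<close> this includes \<open>n = 0\<close>.\<close>

definition model_space :: "nat \<Rightarrow> (nat \<Rightarrow> real) set" where
  "model_space n = {x. \<forall>i\<ge>n. x i = 0}"

definition partial_derivative :: "nat \<Rightarrow> ((nat \<Rightarrow> real) \<Rightarrow> real) \<Rightarrow> (nat \<Rightarrow> real) \<Rightarrow> real" where
  "partial_derivative i f x = deriv (\<lambda>t. f (x(i := t))) (x i)"

text \<open>\<open>C_k n k U f\<close>: on the open subset \<open>U\<close> of the \<open>n\<close>-dimensional model space all partial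
  derivatives of \<open>f\<close> of order at most \<open>k\<close> exist and are continuous.\<close>

primrec C_k :: "nat \<Rightarrow> nat \<Rightarrow> (nat \<Rightarrow> real) set \<Rightarrow> ((nat \<Rightarrow> real) \<Rightarrow> real) \<Rightarrow> bool" where
  "C_k n 0 U f \<longleftrightarrow> continuous_on U f"
| "C_k n (Suc k) U f \<longleftrightarrow> continuous_on U f \<and>
     (\<forall>i<n. (\<forall>x\<in>U. (\<lambda>t. f (x(i := t))) differentiable (at (x i)))
            \<and> C_k n k U (partial_derivative i f))"

definition smooth_model :: "nat \<Rightarrow> (nat \<Rightarrow> real) set \<Rightarrow> ((nat \<Rightarrow> real) \<Rightarrow> real) \<Rightarrow> bool" where
  "smooth_model n U f \<longleftrightarrow> (\<forall>k. C_k n k U f)"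

text \<open>The underlying set of a manifold is the whole type \<open>'m\<close>; a chart is a domain together with a
  coordinate map.\<close>

record 'm manifold =
  mdim :: nat
  charts :: "('m set \<times> ('m \<Rightarrow> nat \<Rightarrow> real)) set"

definition smooth_manifold ::
  "'m::{t2_space, second_countable_topology} manifold \<Rightarrow> bool" where
  "smooth_manifold M \<longleftrightarrow>
     (\<Union>(W, \<phi>)\<in>charts M. W) = UNIV \<and>
     (\<forall>(W, \<phi>)\<in>charts M.
        open W \<and> openin (top_of_set (model_space (mdim M))) (\<phi> ` W) \<and>
        homeomorphism W (\<phi> ` W) \<phi> (the_inv_into W \<phi>)) \<and>
     (\<forall>(W, \<phi>)\<in>charts M. \<forall>(W', \<phi>')\<in>charts M. \<forall>j<mdim M.
        smooth_model (mdim M) (\<phi> ` (W \<inter> W')) (\<lambda>x. \<phi>' (the_inv_into W \<phi> x) j))"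

definition smooth_fun :: "'m manifold \<Rightarrow> 'm set \<Rightarrow> ('m \<Rightarrow> real) \<Rightarrow> bool" where
  "smooth_fun M U f \<longleftrightarrow>
     (\<forall>(W, \<phi>)\<in>charts M. smooth_model (mdim M) (\<phi> ` (U \<inter> W)) (f \<circ> the_inv_into W \<phi>))"

definition C_infinity :: "'m manifold \<Rightarrow> ('m \<Rightarrow> real) set" where
  "C_infinity M = {f. smooth_fun M UNIV f}"

text \<open>The fibres of a vector bundle are subspaces of one real vector space \<open>'e\<close>; this is no
  restriction, since \<open>'e\<close> is arbitrary (e.g. the direct sum of all fibres). The smooth structure is
  given by an atlas of local frames.\<close>

record ('m, 'e) vbundle =
  fibre :: "'m \<Rightarrow> 'e set"
  frames :: "('m set \<times> ('m \<Rightarrow> 'e) list) set"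

definition smooth_combination ::
  "'m manifold \<Rightarrow> 'm set \<Rightarrow> ('m \<Rightarrow> 'e::real_vector) list \<Rightarrow> ('m \<Rightarrow> 'e) \<Rightarrow> bool" where
  "smooth_combination M U bs s \<longleftrightarrow>
     (\<exists>c. (\<forall>i<length bs. smooth_fun M U (c i)) \<and>
          (\<forall>p\<in>U. s p = (\<Sum>i<length bs. c i p *\<^sub>R (bs ! i) p)))"

definition vector_bundle ::
  "'m::topological_space manifold \<Rightarrow> ('m, 'e::real_vector) vbundle \<Rightarrow> bool" where
  "vector_bundle M E \<longleftrightarrow>
     (\<forall>p. subspace (fibre E p)) \<and>
     (\<Union>(W, bs)\<in>frames E. W) = UNIV \<and>
     (\<forall>(W, bs)\<in>frames E. open W \<and>
        (\<forall>p\<in>W. distinct (map (\<lambda>b. b p) bs) \<and> independent (set (map (\<lambda>b. b p) bs)) \<and>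
                span (set (map (\<lambda>b. b p) bs)) = fibre E p)) \<and>
     (\<forall>(W, bs)\<in>frames E. \<forall>(W', bs')\<in>frames E. \<forall>b\<in>set bs'. smooth_combination M (W \<inter> W') bs b)"

definition smooth_section ::
  "'m manifold \<Rightarrow> ('m, 'e::real_vector) vbundle \<Rightarrow> 'm set \<Rightarrow> ('m \<Rightarrow> 'e) \<Rightarrow> bool" where
  "smooth_section M E U s \<longleftrightarrow>
     (\<forall>p\<in>U. s p \<in> fibre E p) \<and> (\<forall>(W, bs)\<in>frames E. smooth_combination M (U \<inter> W) bs s)"

definition sections :: "'m manifold \<Rightarrow> ('m, 'e::real_vector) vbundle \<Rightarrow> ('m \<Rightarrow> 'e) set" where
  "sections M E = {s. smooth_section M E UNIV s}"

text \<open>Morphisms cover the identity of \<open>M\<close>; smoothness is tested on local sections.\<close>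

definition bundle_morphism ::
  "'m::topological_space manifold \<Rightarrow> ('m, 'e::real_vector) vbundle \<Rightarrow> ('m, 'f::real_vector) vbundle
    \<Rightarrow> ('m \<Rightarrow> 'e \<Rightarrow> 'f) \<Rightarrow> bool" where
  "bundle_morphism M E F \<Phi> \<longleftrightarrow>
     (\<forall>p. linear_on (fibre E p) (\<Phi> p) \<and> \<Phi> p ` fibre E p \<subseteq> fibre F p) \<and>
     (\<forall>U s. open U \<longrightarrow> smooth_section M E U s \<longrightarrow> smooth_section M F U (\<lambda>p. \<Phi> p (s p)))"

text \<open>Tangent vectors at \<open>p\<close> are the derivations of \<open>C\<^sup>\<infinity>(M)\<close> at \<open>p\<close>, as functionals normalised to
  vanish on non-smooth arguments. The frames are the coordinate vector fields.\<close>

definition tangent_space :: "'m manifold \<Rightarrow> 'm \<Rightarrow> (('m \<Rightarrow> real) \<Rightarrow> real) set" where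
  "tangent_space M p = {v.
     linear_on (C_infinity M) v \<and>
     (\<forall>f\<in>C_infinity M. \<forall>g\<in>C_infinity M. v (f * g) = v f * g p + f p * v g) \<and>
     (\<forall>f. f \<notin> C_infinity M \<longrightarrow> v f = 0)}"

definition coordinate_field ::
  "'m manifold \<Rightarrow> 'm set \<Rightarrow> ('m \<Rightarrow> nat \<Rightarrow> real) \<Rightarrow> nat \<Rightarrow> 'm \<Rightarrow> ('m \<Rightarrow> real) \<Rightarrow> real" where
  "coordinate_field M W \<phi> i p f =
     (if f \<in> C_infinity M then partial_derivative i (f \<circ> the_inv_into W \<phi>) (\<phi> p) else 0)"

definition tangent_bundle :: "'m manifold \<Rightarrow> ('m, ('m \<Rightarrow> real) \<Rightarrow> real) vbundle" where
  "tangent_bundle M =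
     \<lparr>fibre = tangent_space M,
      frames = {(W, map (coordinate_field M W \<phi>) [0..<mdim M]) | W \<phi>. (W, \<phi>) \<in> charts M}\<rparr>"


section \<open>Graded multilinear maps\<close>

text \<open>A graded vector space is a family \<open>L\<close> of subspaces, indexed by the degree, of a real vector
  space. An \<open>n\<close>-ary multilinear map is a function on lists of length \<open>n\<close>, of which only the values on
  lists of homogeneous elements matter. Argument positions and permutations are 1-based.\<close>

definition sgn_deg :: "int \<Rightarrow> real" where
  "sgn_deg k = (if even k then 1 else -1)"

definition koszul :: "(nat \<Rightarrow> nat) \<Rightarrow> nat list \<Rightarrow> real" where
  "koszul \<sigma> ds =
     (\<Prod>(a, b)\<in>{(a, b). 1 \<le> a \<and> a < b \<and> b \<le> length ds \<and> \<sigma> b < \<sigma> a}.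
        sgn_deg (int (ds ! (a - 1)) * int (ds ! (b - 1))))"

abbreviation cyc :: "nat list \<Rightarrow> nat \<Rightarrow> nat" where
  "cyc \<equiv> cycle_of_list"

context
  fixes L :: "nat \<Rightarrow> 'v::real_vector set"
begin

text \<open>The degree of a homogeneous element. The zero vector gets degree 0, which is harmless as
  multilinear maps vanish on it.\<close>

definition degree_of :: "'v \<Rightarrow> nat" where
  "degree_of v = (LEAST i. v \<in> L i)"

definition homogeneous_tuples :: "nat \<Rightarrow> 'v list set" where
  "homogeneous_tuples n = {vs. length vs = n \<and> set vs \<subseteq> (\<Union>i. L i)}"

definition graded_map :: "nat \<Rightarrow> nat \<Rightarrow> ('v list \<Rightarrow> 'v) \<Rightarrow> bool" where
  "graded_map n k \<mu> \<longleftrightarrow>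
     (\<forall>ds vs. length ds = n \<longrightarrow> length vs = n \<longrightarrow> (\<forall>i<n. vs ! i \<in> L (ds ! i)) \<longrightarrow>
        \<mu> vs \<in> L (sum_list ds + k) \<and>
        (\<forall>i<n. linear_on (L (ds ! i)) (\<lambda>u. \<mu> (vs[i := u]))))"

definition map_eq :: "('v list \<Rightarrow> 'v) \<Rightarrow> nat \<Rightarrow> ('v list \<Rightarrow> 'v) \<Rightarrow> bool"
    (\<open>(_ =\<^bsub>_\<^esub>/ _)\<close> [51, 0, 51] 50) where
  "\<mu> =\<^bsub>n\<^esub> \<nu> \<longleftrightarrow> (\<forall>vs\<in>homogeneous_tuples n. \<mu> vs = \<nu> vs)"

definition perm :: "('v list \<Rightarrow> 'v) \<Rightarrow> (nat \<Rightarrow> nat) \<Rightarrow> 'v list \<Rightarrow> 'v"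
    (\<open>_\<langle>_\<rangle>\<close> [1000, 0] 1000) where
  "\<mu>\<langle>\<sigma>\<rangle> = (\<lambda>vs. koszul \<sigma> (map degree_of vs) *\<^sub>R
             \<mu> (map (\<lambda>i. vs ! (inv \<sigma> i - 1)) [1..<Suc (length vs)]))"

text \<open>Partial composition; the inserted map is given as a triple (arity, degree, map).\<close>

definition pcomp :: "('v list \<Rightarrow> 'v) \<Rightarrow> nat \<Rightarrow> nat \<times> int \<times> ('v list \<Rightarrow> 'v) \<Rightarrow> 'v list \<Rightarrow> 'v"
    (\<open>(_ \<circ>\<^bsub>_\<^esub>/ _)\<close> [76, 0, 76] 75) where
  "\<mu> \<circ>\<^bsub>i\<^esub> \<nu> = (case \<nu> of (k, q, \<nu>') \<Rightarrow> (\<lambda>vs.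
     sgn_deg (q * int (sum_list (map degree_of (take (i - 1) vs)))) *\<^sub>R
     \<mu> (take (i - 1) vs @ \<nu>' (take k (drop (i - 1) vs)) # drop (i - 1 + k) vs)))"

text \<open>\<open>boundary d q \<mu>\<close> is the differential of the map \<open>\<mu>\<close> of degree \<open>q\<close>.\<close>

definition boundary :: "('v \<Rightarrow> 'v) \<Rightarrow> int \<Rightarrow> ('v list \<Rightarrow> 'v) \<Rightarrow> 'v list \<Rightarrow> 'v" where
  "boundary d q \<mu> = (\<lambda>vs. d (\<mu> vs) - sgn_deg q *\<^sub>R
     (\<Sum>i<length vs. sgn_deg (int (sum_list (map degree_of (take i vs)))) *\<^sub>R
        \<mu> (vs[i := d (vs ! i)])))"

definition skew_symmetric :: "nat \<Rightarrow> ('v list \<Rightarrow> 'v) \<Rightarrow> bool" where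
  "skew_symmetric n \<mu> \<longleftrightarrow>
     (\<forall>\<sigma>. \<sigma> permutes {1..n} \<longrightarrow> \<mu>\<langle>\<sigma>\<rangle> =\<^bsub>n\<^esub> of_int (sign \<sigma>) *\<^sub>R \<mu>)"

definition alternating_sum :: "nat \<Rightarrow> ('v list \<Rightarrow> 'v) \<Rightarrow> 'v list \<Rightarrow> 'v" where
  "alternating_sum n \<mu> = (\<Sum>\<sigma> | \<sigma> permutes {1..n}. of_int (sign \<sigma>) *\<^sub>R \<mu>\<langle>\<sigma>\<rangle>)"


section \<open>Leibniz 3-algebras, weak Lie 3-algebras and skew-symmetrization\<close>

definition three_term_complex :: "('v \<Rightarrow> 'v) \<Rightarrow> bool" where
  "three_term_complex d \<longleftrightarrow>
     (\<forall>i. subspace (L i)) \<and> (\<forall>i>2. L i = {0}) \<and>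
     (\<forall>x\<in>L 0. \<forall>y\<in>L 1. \<forall>z\<in>L 2. x + y + z = 0 \<longrightarrow> x = 0 \<and> y = 0 \<and> z = 0) \<and>
     (\<forall>i. linear_on (L i) d) \<and> d ` L 0 \<subseteq> {0} \<and> (\<forall>i. d ` L (Suc i) \<subseteq> L i) \<and>
     (\<forall>i. \<forall>v\<in>L i. d (d v) = 0)"

definition leibniz_3_algebra ::
  "('v \<Rightarrow> 'v) \<Rightarrow> ('v list \<Rightarrow> 'v) \<Rightarrow> ('v list \<Rightarrow> 'v) \<Rightarrow> ('v list \<Rightarrow> 'v) \<Rightarrow> bool" where
  "leibniz_3_algebra d l2 l3 l4 \<longleftrightarrow>
   three_term_complex d \<and> graded_map 2 0 l2 \<and> graded_map 3 1 l3 \<and> graded_map 4 2 l4 \<and>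
   (let B2 = (2, 0, l2); B3 = (3, 1, l3); B4 = (4, 2, l4) in
     boundary d 0 l2 =\<^bsub>2\<^esub> 0 \<and>
     boundary d 1 l3 =\<^bsub>3\<^esub> l2 \<circ>\<^bsub>2\<^esub> B2 - l2 \<circ>\<^bsub>1\<^esub> B2 - (l2 \<circ>\<^bsub>2\<^esub> B2)\<langle>cyc [1,2]\<rangle> \<and>
     boundary d 2 l4 =\<^bsub>4\<^esub>
       l2 \<circ>\<^bsub>1\<^esub> B3 + l2 \<circ>\<^bsub>2\<^esub> B3 - (l2 \<circ>\<^bsub>2\<^esub> B3)\<langle>cyc [1,2]\<rangle> + (l2 \<circ>\<^bsub>2\<^esub> B3)\<langle>cyc [1,2,3]\<rangle>
       - l3 \<circ>\<^bsub>1\<^esub> B2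
       + l3 \<circ>\<^bsub>2\<^esub> B2 - (l3 \<circ>\<^bsub>2\<^esub> B2)\<langle>cyc [1,2]\<rangle>
       - l3 \<circ>\<^bsub>3\<^esub> B2 + (l3 \<circ>\<^bsub>3\<^esub> B2)\<langle>cyc [2,3]\<rangle> - (l3 \<circ>\<^bsub>3\<^esub> B2)\<langle>cyc [1,3,2]\<rangle> \<and>
     0 =\<^bsub>5\<^esub>
       l2 \<circ>\<^bsub>1\<^esub> B4
       - l2 \<circ>\<^bsub>2\<^esub> B4 + (l2 \<circ>\<^bsub>2\<^esub> B4)\<langle>cyc [1,2]\<rangle> - (l2 \<circ>\<^bsub>2\<^esub> B4)\<langle>cyc [1,2,3]\<rangle>
       + (l2 \<circ>\<^bsub>2\<^esub> B4)\<langle>cyc [1,2,3,4]\<rangle>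
       + l3 \<circ>\<^bsub>1\<^esub> B3
       + l3 \<circ>\<^bsub>2\<^esub> B3 - (l3 \<circ>\<^bsub>2\<^esub> B3)\<langle>cyc [1,2]\<rangle> + (l3 \<circ>\<^bsub>2\<^esub> B3)\<langle>cyc [1,2,3]\<rangle>
       + l3 \<circ>\<^bsub>3\<^esub> B3 - (l3 \<circ>\<^bsub>3\<^esub> B3)\<langle>cyc [2,3]\<rangle> + (l3 \<circ>\<^bsub>3\<^esub> B3)\<langle>cyc [1,3,2]\<rangle>
       + (l3 \<circ>\<^bsub>3\<^esub> B3)\<langle>cyc [2,3,4]\<rangle> - (l3 \<circ>\<^bsub>3\<^esub> B3)\<langle>cyc [1,3,4,2]\<rangle>
       + (l3 \<circ>\<^bsub>3\<^esub> B3)\<langle>cyc [1,3] \<circ> cyc [2,4]\<rangle>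
       + l4 \<circ>\<^bsub>1\<^esub> B2
       - l4 \<circ>\<^bsub>2\<^esub> B2 + (l4 \<circ>\<^bsub>2\<^esub> B2)\<langle>cyc [1,2]\<rangle>
       + l4 \<circ>\<^bsub>3\<^esub> B2 - (l4 \<circ>\<^bsub>3\<^esub> B2)\<langle>cyc [2,3]\<rangle> + (l4 \<circ>\<^bsub>3\<^esub> B2)\<langle>cyc [1,3,2]\<rangle>
       - l4 \<circ>\<^bsub>4\<^esub> B2 + (l4 \<circ>\<^bsub>4\<^esub> B2)\<langle>cyc [3,4]\<rangle> - (l4 \<circ>\<^bsub>4\<^esub> B2)\<langle>cyc [2,4,3]\<rangle>
       + (l4 \<circ>\<^bsub>4\<^esub> B2)\<langle>cyc [1,4,3,2]\<rangle>)"

definition leibniz_2_algebra ::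
  "('v \<Rightarrow> 'v) \<Rightarrow> ('v list \<Rightarrow> 'v) \<Rightarrow> ('v list \<Rightarrow> 'v) \<Rightarrow> bool" where
  "leibniz_2_algebra d l2 l3 \<longleftrightarrow> leibniz_3_algebra d l2 l3 0 \<and> L 2 = {0}"

definition lie_3_algebra ::
  "('v \<Rightarrow> 'v) \<Rightarrow> ('v list \<Rightarrow> 'v) \<Rightarrow> ('v list \<Rightarrow> 'v) \<Rightarrow> ('v list \<Rightarrow> 'v) \<Rightarrow> bool" where
  "lie_3_algebra d l2 l3 l4 \<longleftrightarrow>
     leibniz_3_algebra d l2 l3 l4 \<and>
     skew_symmetric 2 l2 \<and> skew_symmetric 3 l3 \<and> skew_symmetric 4 l4"

text \<open>The maps \<open>l21\<close>, \<open>l211\<close>, \<open>l31\<close>, \<open>l32\<close> are \<open>\<lambda>\<^sub>2\<^sub>;\<^sub>1\<close>, \<open>\<lambda>\<^sub>2\<^sub>;\<^sub>1\<^sub>,\<^sub>1\<close>, \<open>\<lambda>\<^sub>3\<^sub>;\<^sub>1\<close>, \<open>\<lambda>\<^sub>3\<^sub>;\<^sub>2\<close>.\<close>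

definition weak_lie_3_algebra ::
  "('v \<Rightarrow> 'v) \<Rightarrow> ('v list \<Rightarrow> 'v) \<Rightarrow> ('v list \<Rightarrow> 'v) \<Rightarrow> ('v list \<Rightarrow> 'v) \<Rightarrow>
   ('v list \<Rightarrow> 'v) \<Rightarrow> ('v list \<Rightarrow> 'v) \<Rightarrow> ('v list \<Rightarrow> 'v) \<Rightarrow> ('v list \<Rightarrow> 'v) \<Rightarrow> bool" where
  "weak_lie_3_algebra d l2 l3 l4 l21 l211 l31 l32 \<longleftrightarrow>
   leibniz_3_algebra d l2 l3 l4 \<and>
   graded_map 2 1 l21 \<and> graded_map 2 2 l211 \<and> graded_map 3 2 l31 \<and> graded_map 3 2 l32 \<and>
   (let B2 = (2, 0, l2); B3 = (3, 1, l3);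
        B21 = (2, 1, l21); B211 = (2, 2, l211); B31 = (3, 2, l31); B32 = (3, 2, l32) in
     boundary d 1 l21 =\<^bsub>2\<^esub> l2 + l2\<langle>cyc [1,2]\<rangle> \<and>
     boundary d 2 l211 =\<^bsub>2\<^esub> l21 - l21\<langle>cyc [1,2]\<rangle> \<and>
     boundary d 2 l31 =\<^bsub>3\<^esub> l3 + l3\<langle>cyc [1,2]\<rangle> + l2 \<circ>\<^bsub>1\<^esub> B21 \<and>
     boundary d 2 l32 =\<^bsub>3\<^esub>
       l3 + l3\<langle>cyc [2,3]\<rangle> - l2 \<circ>\<^bsub>2\<^esub> B21 + l21 \<circ>\<^bsub>1\<^esub> B2 + (l21 \<circ>\<^bsub>2\<^esub> B2)\<langle>cyc [1,2]\<rangle> \<and>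
     l211 + l211\<langle>cyc [1,2]\<rangle> =\<^bsub>2\<^esub> 0 \<and>
     l31 - l31\<langle>cyc [1,2]\<rangle> =\<^bsub>3\<^esub> l2 \<circ>\<^bsub>1\<^esub> B211 \<and>
     l31 - l32\<langle>cyc [1,2]\<rangle> + l31\<langle>cyc [1,3,2]\<rangle> - l32 + l31\<langle>cyc [2,3]\<rangle> - l32\<langle>cyc [1,2,3]\<rangle> =\<^bsub>3\<^esub>
       l21 \<circ>\<^bsub>2\<^esub> B21 + l21 \<circ>\<^bsub>1\<^esub> B21 + (l21 \<circ>\<^bsub>2\<^esub> B21)\<langle>cyc [1,2]\<rangle>
       + (l211 \<circ>\<^bsub>2\<^esub> B2)\<langle>cyc [1,3,2]\<rangle> \<and>
     l32 - l32\<langle>cyc [2,3]\<rangle> =\<^bsub>3\<^esub>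
       - (l2 \<circ>\<^bsub>2\<^esub> B211) + l211 \<circ>\<^bsub>1\<^esub> B2 + (l211 \<circ>\<^bsub>2\<^esub> B2)\<langle>cyc [1,2]\<rangle> \<and>
     l4 + l4\<langle>cyc [1,2]\<rangle> =\<^bsub>4\<^esub>
       l2 \<circ>\<^bsub>1\<^esub> B31 - l31 \<circ>\<^bsub>3\<^esub> B2 + (l2 \<circ>\<^bsub>2\<^esub> B31)\<langle>cyc [1,2,3]\<rangle> + l3 \<circ>\<^bsub>1\<^esub> B21 \<and>
     l4 + l4\<langle>cyc [2,3]\<rangle> =\<^bsub>4\<^esub>
       l2 \<circ>\<^bsub>1\<^esub> B32 - l3 \<circ>\<^bsub>2\<^esub> B21 + l2 \<circ>\<^bsub>2\<^esub> B31 - l31 \<circ>\<^bsub>1\<^esub> B2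
       - (l31 \<circ>\<^bsub>2\<^esub> B2)\<langle>cyc [1,2]\<rangle> - (l31 \<circ>\<^bsub>3\<^esub> B2)\<langle>cyc [1,3,2]\<rangle> \<and>
     l4 + l4\<langle>cyc [3,4]\<rangle> =\<^bsub>4\<^esub>
       l21 \<circ>\<^bsub>1\<^esub> B3 - l32 \<circ>\<^bsub>1\<^esub> B2 + l32 \<circ>\<^bsub>2\<^esub> B2 - (l32 \<circ>\<^bsub>2\<^esub> B2)\<langle>cyc [1,2]\<rangle>
       + l3 \<circ>\<^bsub>3\<^esub> B21 + (l32 \<circ>\<^bsub>3\<^esub> B2)\<langle>cyc [2,3]\<rangle> - (l32 \<circ>\<^bsub>3\<^esub> B2)\<langle>cyc [1,3,2]\<rangle>
       + l2 \<circ>\<^bsub>2\<^esub> B32 - (l2 \<circ>\<^bsub>2\<^esub> B32)\<langle>cyc [1,2]\<rangle> + (l21 \<circ>\<^bsub>2\<^esub> B3)\<langle>cyc [1,2,3]\<rangle>)"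

definition skew_2 :: "('v list \<Rightarrow> 'v) \<Rightarrow> 'v list \<Rightarrow> 'v" where
  "skew_2 l2 = (1/2) *\<^sub>R alternating_sum 2 l2"

definition skew_3 ::
  "('v list \<Rightarrow> 'v) \<Rightarrow> ('v list \<Rightarrow> 'v) \<Rightarrow> ('v list \<Rightarrow> 'v) \<Rightarrow> 'v list \<Rightarrow> 'v" where
  "skew_3 l2 l3 l21 =
     (1/6) *\<^sub>R alternating_sum 3 l3
     - (1/24) *\<^sub>R alternating_sum 3 (l21 \<circ>\<^bsub>1\<^esub> (2, 0, l2) + l21 \<circ>\<^bsub>2\<^esub> (2, 0, l2))"

definition skew_4 ::
  "('v list \<Rightarrow> 'v) \<Rightarrow> ('v list \<Rightarrow> 'v) \<Rightarrow> ('v list \<Rightarrow> 'v) \<Rightarrow> ('v list \<Rightarrow> 'v) \<Rightarrow>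
   ('v list \<Rightarrow> 'v) \<Rightarrow> ('v list \<Rightarrow> 'v) \<Rightarrow> 'v list \<Rightarrow> 'v" where
  "skew_4 l2 l3 l4 l21 l31 l32 =
     (let B2 = (2, 0, l2); B3 = (3, 1, l3) in
       (1/24) *\<^sub>R alternating_sum 4 l4
       + (1/48) *\<^sub>R alternating_sum 4
           (l21 \<circ>\<^bsub>1\<^esub> B3 - l31 \<circ>\<^bsub>1\<^esub> B2 + l32 \<circ>\<^bsub>2\<^esub> B2
            - l21 \<circ>\<^bsub>2\<^esub> B3 - l31 \<circ>\<^bsub>2\<^esub> B2 + l32 \<circ>\<^bsub>3\<^esub> B2))"

end


section \<open>CLWX 2-algebroids\<close>

text \<open>The graded bundle is an internal direct sum: the fibres of \<open>E0\<close> and \<open>E1\<close> are independent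
  subspaces of \<open>'e\<close>, so that inhomogeneous sections are sums. The differential \<open>\<partial>\<close> is defined on the
  whole fibre and vanishes on \<open>E0\<close>.\<close>

definition dg_bundle ::
  "'m::{t2_space, second_countable_topology} manifold \<Rightarrow> ('m, 'e::real_vector) vbundle \<Rightarrow>
   ('m, 'e) vbundle \<Rightarrow> ('m \<Rightarrow> 'e \<Rightarrow> 'e) \<Rightarrow> bool" where
  "dg_bundle M E0 E1 del \<longleftrightarrow>
     vector_bundle M E0 \<and> vector_bundle M E1 \<and> (\<forall>p. fibre E0 p \<inter> fibre E1 p = {0}) \<and>
     (\<forall>p. linear_on (direct_sum (fibre E0 p) (fibre E1 p)) (del p)) \<and>
     (\<forall>p. \<forall>x\<in>fibre E0 p. del p x = 0) \<and> bundle_morphism M E1 E0 del"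

text \<open>Morphism of dg vector bundles to \<open>TM\<close>, the latter concentrated in degree 0.\<close>

definition dg_anchor ::
  "'m::{t2_space, second_countable_topology} manifold \<Rightarrow> ('m, 'e::real_vector) vbundle \<Rightarrow>
   ('m, 'e) vbundle \<Rightarrow> ('m \<Rightarrow> 'e \<Rightarrow> 'e) \<Rightarrow> ('m \<Rightarrow> 'e \<Rightarrow> ('m \<Rightarrow> real) \<Rightarrow> real) \<Rightarrow> bool" where
  "dg_anchor M E0 E1 del rho \<longleftrightarrow>
     (\<forall>p. linear_on (direct_sum (fibre E0 p) (fibre E1 p)) (rho p)) \<and>
     (\<forall>p. \<forall>a\<in>fibre E1 p. rho p a = 0) \<and> bundle_morphism M E0 (tangent_bundle M) rho \<and>
     (\<forall>p. \<forall>a\<in>fibre E1 p. rho p (del p a) = 0)"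

definition total_sections ::
  "'m manifold \<Rightarrow> ('m, 'e::real_vector) vbundle \<Rightarrow> ('m, 'e) vbundle \<Rightarrow> ('m \<Rightarrow> 'e) set" where
  "total_sections M E0 E1 = direct_sum (sections M E0) (sections M E1)"

definition graded_sections ::
  "'m manifold \<Rightarrow> ('m, 'e::real_vector) vbundle \<Rightarrow> ('m, 'e) vbundle \<Rightarrow> nat \<Rightarrow> ('m \<Rightarrow> 'e) set" where
  "graded_sections M E0 E1 i = (if i = 0 then sections M E0 else if i = 1 then sections M E1 else {0})"

definition bundle_diff :: "('m \<Rightarrow> 'e \<Rightarrow> 'e) \<Rightarrow> ('m \<Rightarrow> 'e) \<Rightarrow> 'm \<Rightarrow> 'e" where
  "bundle_diff del e = (\<lambda>p. del p (e p))"

definition anchor_act ::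
  "('m \<Rightarrow> 'e \<Rightarrow> ('m \<Rightarrow> real) \<Rightarrow> real) \<Rightarrow> ('m \<Rightarrow> 'e) \<Rightarrow> ('m \<Rightarrow> real) \<Rightarrow> 'm \<Rightarrow> real" where
  "anchor_act rho e f = (\<lambda>p. rho p (e p) f)"

definition C_infinity_linear_on ::
  "'m manifold \<Rightarrow> ('m \<Rightarrow> 'e::real_vector) set \<Rightarrow> (('m \<Rightarrow> 'e) \<Rightarrow> 'm \<Rightarrow> 'f::real_vector) \<Rightarrow> bool" where
  "C_infinity_linear_on M V \<Phi> \<longleftrightarrow>
     (\<forall>x\<in>V. \<forall>y\<in>V. \<Phi> (x + y) = \<Phi> x + \<Phi> y) \<and>
     (\<forall>g\<in>C_infinity M. \<forall>x\<in>V. \<Phi> (\<lambda>p. g p *\<^sub>R x p) = (\<lambda>p. g p *\<^sub>R \<Phi> x p))"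

text \<open>A symmetric bilinear form on the bundle, given on sections. Non-degeneracy is that of the
  forms on the fibres.\<close>

definition nondegenerate_form ::
  "'m manifold \<Rightarrow> ('m \<Rightarrow> 'e::real_vector) set \<Rightarrow> (('m \<Rightarrow> 'e) \<Rightarrow> ('m \<Rightarrow> 'e) \<Rightarrow> 'm \<Rightarrow> real) \<Rightarrow> bool"
  where
  "nondegenerate_form M V S \<longleftrightarrow>
     (\<forall>x\<in>V. \<forall>y\<in>V. S x y \<in> C_infinity M \<and> S x y = S y x) \<and>
     (\<forall>x\<in>V. C_infinity_linear_on M V (S x)) \<and>
     (\<forall>x\<in>V. \<forall>p. (\<forall>y\<in>V. S x y p = 0) \<longrightarrow> x p = 0)"

text \<open>The operator \<open>D\<close> from functions to sections of \<open>E1\<close>, defined by its characteristic equation;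
  by non-degeneracy of \<open>S\<close> there is exactly one such operator on smooth functions.\<close>

definition is_D_operator ::
  "'m manifold \<Rightarrow> ('m, 'e::real_vector) vbundle \<Rightarrow> ('m, 'e) vbundle \<Rightarrow>
   ('m \<Rightarrow> 'e \<Rightarrow> ('m \<Rightarrow> real) \<Rightarrow> real) \<Rightarrow> (('m \<Rightarrow> 'e) \<Rightarrow> ('m \<Rightarrow> 'e) \<Rightarrow> 'm \<Rightarrow> real) \<Rightarrow>
   (('m \<Rightarrow> real) \<Rightarrow> 'm \<Rightarrow> 'e) \<Rightarrow> bool" where
  "is_D_operator M E0 E1 rho S D \<longleftrightarrow>
     (\<forall>f\<in>C_infinity M. D f \<in> sections M E1 \<and>
        (\<forall>e\<in>total_sections M E0 E1. S e (D f) = anchor_act rho e f))"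

definition clwx_2_algebroid ::
  "'m::{t2_space, second_countable_topology} manifold \<Rightarrow> ('m, 'e::real_vector) vbundle \<Rightarrow>
   ('m, 'e) vbundle \<Rightarrow> ('m \<Rightarrow> 'e \<Rightarrow> 'e) \<Rightarrow> ('m \<Rightarrow> 'e \<Rightarrow> ('m \<Rightarrow> real) \<Rightarrow> real) \<Rightarrow>
   (('m \<Rightarrow> 'e) \<Rightarrow> ('m \<Rightarrow> 'e) \<Rightarrow> 'm \<Rightarrow> 'e) \<Rightarrow>
   (('m \<Rightarrow> 'e) \<Rightarrow> ('m \<Rightarrow> 'e) \<Rightarrow> ('m \<Rightarrow> 'e) \<Rightarrow> 'm \<Rightarrow> 'e) \<Rightarrow>
   (('m \<Rightarrow> 'e) \<Rightarrow> ('m \<Rightarrow> 'e) \<Rightarrow> 'm \<Rightarrow> real) \<Rightarrow> (('m \<Rightarrow> real) \<Rightarrow> 'm \<Rightarrow> 'e) \<Rightarrow> bool" where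
  "clwx_2_algebroid M E0 E1 del rho circ Om S D \<longleftrightarrow>
   (let \<Gamma>0 = sections M E0; \<Gamma>1 = sections M E1; \<Gamma> = total_sections M E0 E1;
        G = graded_sections M E0 E1; d = bundle_diff del in
     smooth_manifold M \<and> dg_bundle M E0 E1 del \<and> dg_anchor M E0 E1 del rho \<and>
     (\<forall>x\<in>\<Gamma>. linear_on \<Gamma> (circ x) \<and> linear_on \<Gamma> (\<lambda>y. circ y x)) \<and>
     graded_map G 2 0 (\<lambda>vs. circ (vs ! 0) (vs ! 1)) \<and>
     (\<forall>x\<in>\<Gamma>0. \<forall>y\<in>\<Gamma>0. circ x y = - circ y x) \<and>
     (\<forall>x\<in>\<Gamma>. \<forall>y\<in>\<Gamma>. C_infinity_linear_on M \<Gamma> (\<lambda>z. Om z x y) \<and>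
        C_infinity_linear_on M \<Gamma> (\<lambda>z. Om x z y) \<and> C_infinity_linear_on M \<Gamma> (Om x y)) \<and>
     graded_map G 3 1 (\<lambda>vs. Om (vs ! 0) (vs ! 1) (vs ! 2)) \<and>
     skew_symmetric G 3 (\<lambda>vs. Om (vs ! 0) (vs ! 1) (vs ! 2)) \<and>
     nondegenerate_form M \<Gamma> S \<and>
     is_D_operator M E0 E1 rho S D \<and>
     \<comment> \<open>the axioms\<close>
     (\<forall>x\<in>\<Gamma>0. \<forall>y\<in>\<Gamma>0. S x y = 0) \<and> (\<forall>x\<in>\<Gamma>1. \<forall>y\<in>\<Gamma>1. S x y = 0) \<and>
     leibniz_2_algebra G d (\<lambda>vs. circ (vs ! 0) (vs ! 1)) (\<lambda>vs. Om (vs ! 0) (vs ! 1) (vs ! 2)) \<and>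
     (\<forall>e\<in>\<Gamma>. circ e e = (1/2) *\<^sub>R D (S e e)) \<and>
     (\<forall>e1\<in>\<Gamma>. \<forall>e2\<in>\<Gamma>. S (d e1) e2 = S e1 (d e2)) \<and>
     (\<forall>e1\<in>\<Gamma>. \<forall>e2\<in>\<Gamma>. \<forall>e3\<in>\<Gamma>.
        anchor_act rho e1 (S e2 e3) = S (circ e1 e2) e3 + S e2 (circ e1 e3)) \<and>
     (\<forall>e1\<in>\<Gamma>. \<forall>e2\<in>\<Gamma>. \<forall>e3\<in>\<Gamma>. \<forall>e4\<in>\<Gamma>. S (Om e1 e2 e3) e4 = - S e3 (Om e1 e2 e4)))"

text \<open>The graded space underlying the complex \<open>\<Gamma>E\<^sub>0 \<leftarrow> \<Gamma>E\<^sub>1 \<leftarrow> C\<^sup>\<infinity>(M)\<close>: a pair \<open>(e, f)\<close> stands for \<open>e + f\<close>.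
  The structure maps of the algebroid are extended by zero.\<close>

definition clwx_space ::
  "'m manifold \<Rightarrow> ('m, 'e::real_vector) vbundle \<Rightarrow> ('m, 'e) vbundle \<Rightarrow> nat \<Rightarrow>
   (('m \<Rightarrow> 'e) \<times> ('m \<Rightarrow> real)) set" where
  "clwx_space M E0 E1 i =
     (if i = 0 then sections M E0 \<times> {0} else if i = 1 then sections M E1 \<times> {0}
      else if i = 2 then {0} \<times> C_infinity M else {0})"

definition clwx_diff ::
  "('m \<Rightarrow> 'e::real_vector \<Rightarrow> 'e) \<Rightarrow> (('m \<Rightarrow> real) \<Rightarrow> 'm \<Rightarrow> 'e) \<Rightarrow>
   ('m \<Rightarrow> 'e) \<times> ('m \<Rightarrow> real) \<Rightarrow> ('m \<Rightarrow> 'e) \<times> ('m \<Rightarrow> real)" where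
  "clwx_diff del D v = (bundle_diff del (fst v) + D (snd v), 0)"

definition ext_circ ::
  "(('m \<Rightarrow> 'e::real_vector) \<Rightarrow> ('m \<Rightarrow> 'e) \<Rightarrow> 'm \<Rightarrow> 'e) \<Rightarrow>
   (('m \<Rightarrow> 'e) \<times> ('m \<Rightarrow> real)) list \<Rightarrow> ('m \<Rightarrow> 'e) \<times> ('m \<Rightarrow> real)" where
  "ext_circ circ = (\<lambda>vs. (circ (fst (vs ! 0)) (fst (vs ! 1)), 0))"

definition ext_Om ::
  "(('m \<Rightarrow> 'e::real_vector) \<Rightarrow> ('m \<Rightarrow> 'e) \<Rightarrow> ('m \<Rightarrow> 'e) \<Rightarrow> 'm \<Rightarrow> 'e) \<Rightarrow>
   (('m \<Rightarrow> 'e) \<times> ('m \<Rightarrow> real)) list \<Rightarrow> ('m \<Rightarrow> 'e) \<times> ('m \<Rightarrow> real)" where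
  "ext_Om Om = (\<lambda>vs. (Om (fst (vs ! 0)) (fst (vs ! 1)) (fst (vs ! 2)), 0))"

definition ext_S ::
  "(('m \<Rightarrow> 'e::real_vector) \<Rightarrow> ('m \<Rightarrow> 'e) \<Rightarrow> 'm \<Rightarrow> real) \<Rightarrow>
   (('m \<Rightarrow> 'e) \<times> ('m \<Rightarrow> real)) list \<Rightarrow> ('m \<Rightarrow> 'e) \<times> ('m \<Rightarrow> real)" where
  "ext_S S = (\<lambda>vs. (0, S (fst (vs ! 0)) (fst (vs ! 1))))"

definition ext_D ::
  "(('m \<Rightarrow> real) \<Rightarrow> 'm \<Rightarrow> 'e::real_vector) \<Rightarrow>
   (('m \<Rightarrow> 'e) \<times> ('m \<Rightarrow> real)) list \<Rightarrow> ('m \<Rightarrow> 'e) \<times> ('m \<Rightarrow> real)" where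
  "ext_D D = (\<lambda>vs. (D (snd (vs ! 0)), 0))"

text \<open>Partial composition, permutation action and equality of graded maps with the graded space as
  an explicit parameter.\<close>

notation pcomp (\<open>pcomp\<close>)

end

theory Submission
  imports Defs
begin

text \<open>All structure maps in question vanish on tuples with two entries of positive degree, so that Koszul
  signs never matter, and for degree reasons every identity has to be checked only on finitely many
  types of homogeneous tuples.

  The one fact about the algebroid that is not a formal consequence of a single axiom is
  \<open>Df \<circ> x = 0\<close>. The Leibniz identities for \<open>(z, a, x)\<close> and \<open>(a, z, x)\<close> add up to it when
  \<open>f = S(z, a)\<close>. Since \<open>f \<mapsto> Df \<circ> x\<close> is a derivation and \<open>g S(z, a) = S(z, g a)\<close>, it follows that
  \<open>S(z, a) (Dg \<circ> x) = 0\<close> for all \<open>z\<close>, \<open>a\<close> and \<open>g\<close>; now take \<open>a = Dg \<circ> x\<close> and use that \<open>S\<close> is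
  non-degenerate. No partition of unity is needed. Consequently \<open>x \<circ> Df = D(\<rho>(x) f)\<close> and
  \<open>\<rho>(x \<circ> y) = [\<rho>(x), \<rho>(y)]\<close>, and all identities become linear relations between normal forms. In
  the last one, on five sections of \<open>E\<^sub>0\<close>, the terms add up to a multiple of the
  Chevalley-Eilenberg differential of \<open>S(\<Omega>(x, y, z), w)\<close>, which vanishes by pairing the coherence
  identity of \<open>\<Omega>\<close> with the fifth section.\<close>

section \<open>Smooth functions and sections\<close>

text \<open>The zero vector is the technical obstacle. It lies in every degree while
  \<open>degree_of\<close> assigns it degree 0, so the signs in \<open>perm\<close>,
  \<open>pcomp\<close> and \<open>boundary\<close> may jump at zero entries. Degrees are therefore
  carried along as a separate list in \<open>homogeneous\<close>; tuples with a zero entry are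
  settled by multilinearity alone, and signs are evaluated only when the entries of positive degree
  are nonzero. The case lists are short because an n-ary identity of a Leibniz 3-algebra has degree
  n - 3 and the complex ends in degree 2: only inputs of total degree at most 5 - n remain. Five
  arguments thus leave nothing but sections of E0.\<close>

lemma C_k_differentiable:
  "C_k n (Suc k) U f \<Longrightarrow> i < n \<Longrightarrow> x \<in> U \<Longrightarrow> (\<lambda>t. f (x(i := t))) differentiable (at (x i))"
  by auto

lemma C_k_Suc_imp: "C_k n (Suc k) U f \<Longrightarrow> C_k n k U f"
  by (induction k arbitrary: f) auto

lemma C_k_subset: "C_k n k U f \<Longrightarrow> V \<subseteq> U \<Longrightarrow> C_k n k V f"
  by (induction k arbitrary: f) (auto intro: continuous_on_subset)

text \<open>For i < n a coordinate line stays inside the model space, so a relatively open set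
  contains a piece of it around x. This allows derivatives along the line to be compared knowing the
  functions on U only.\<close>

lemma eventually_coordinate_line:
  assumes "openin (top_of_set (model_space n)) U" "x \<in> U" "i < n"
  shows "eventually (\<lambda>t. x(i := t) \<in> U) (nhds (x i))"
proof -
  obtain T where T: "open T" "U = model_space n \<inter> T"
    using assms(1) by (auto simp: openin_open)
  have "continuous_on UNIV (\<lambda>t. x(i := t))"
  proof (rule continuous_on_coordinatewise_then_product)
    show "continuous_on UNIV (\<lambda>t. (x(i := t)) j)" for j
      by (cases "j = i") auto
  qed
  then have "open ((\<lambda>t. x(i := t)) -` T)"
    using T(1) by (simp add: open_vimage)
  moreover have "x i \<in> (\<lambda>t. x(i := t)) -` T"
    using T assms(2) by auto
  ultimately have "eventually (\<lambda>t. t \<in> (\<lambda>t. x(i := t)) -` T) (nhds (x i))"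
    by (rule eventually_nhds_in_open)
  then show ?thesis
    by (rule eventually_mono) (use T assms(2,3) in \<open>auto simp: model_space_def\<close>)
qed

text \<open>Sum and product rules for partial derivatives hold only at points of U, while
  \<open>partial_derivative\<close> is a function on the whole type. The inductions for
  \<open>C_k_add\<close> and \<open>C_k_mult\<close> therefore have to replace a function by one
  that agrees with it on U.\<close>

lemma C_k_cong:
  assumes U: "openin (top_of_set (model_space n)) U" and eq: "\<And>x. x \<in> U \<Longrightarrow> f x = g x"
    and f: "C_k n k U f"
  shows "C_k n k U g"
  using eq f
proof (induction k arbitrary: f g)
  case 0
  then show ?case by (simp cong: continuous_on_cong)
next
  case (Suc k)
  have ev: "eventually (\<lambda>t. f (x(i := t)) = g (x(i := t))) (nhds (x i))" if "x \<in> U" "i < n" for x i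
    using eventually_coordinate_line[OF U that] by (rule eventually_mono) (use Suc.prems in auto)
  have "(\<lambda>t. g (x(i := t))) differentiable (at (x i))" if x: "x \<in> U" "i < n" for x i
  proof -
    obtain D where "((\<lambda>t. f (x(i := t))) has_derivative D) (at (x i))"
      using C_k_differentiable[OF Suc.prems(2) x(2,1)] unfolding differentiable_def by blast
    then have "((\<lambda>t. g (x(i := t))) has_derivative D) (at (x i))"
      by (rule has_derivative_transform_eventually)
        (use ev[OF x] Suc.prems(1)[OF x(1)] in \<open>auto simp: eventually_nhds_conv_at\<close>)
    then show ?thesis unfolding differentiable_def by blast
  qed
  moreover have "C_k n k U (partial_derivative i g)" if "i < n" for i
  proof (rule Suc.IH)
    show "C_k n k U (partial_derivative i f)" using Suc.prems that by simp
    show "partial_derivative i f x = partial_derivative i g x" if "x \<in> U" for x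
      unfolding partial_derivative_def by (rule deriv_cong_ev) (use ev that \<open>i < n\<close> in auto)
  qed
  moreover have "continuous_on U g"
    using Suc.prems by (simp cong: continuous_on_cong)
  ultimately show ?case by simp
qed

section \<open>Sums and products of smooth functions\<close>

lemma partial_derivative_add:
  assumes "C_k n (Suc k) U f" "C_k n (Suc k) U g" "i < n" "x \<in> U"
  shows "partial_derivative i (\<lambda>x. f x + g x) x = partial_derivative i f x + partial_derivative i g x"
  unfolding partial_derivative_def
  using C_k_differentiable[OF assms(1,3,4)] C_k_differentiable[OF assms(2,3,4)]
  by (intro deriv_add) (simp_all add: field_differentiable_def real_differentiable_def has_field_derivative_def)

lemma partial_derivative_mult:
  assumes "C_k n (Suc k) U f" "C_k n (Suc k) U g" "i < n" "x \<in> U"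
  shows "partial_derivative i (\<lambda>x. f x * g x) x = f x * partial_derivative i g x + partial_derivative i f x * g x"
  unfolding partial_derivative_def
  using C_k_differentiable[OF assms(1,3,4)] C_k_differentiable[OF assms(2,3,4)]
  by (subst deriv_mult) (simp_all add: field_differentiable_def real_differentiable_def)

lemma C_k_add:
  assumes "openin (top_of_set (model_space n)) U" "C_k n k U f" "C_k n k U g"
  shows "C_k n k U (\<lambda>x. f x + g x)"
  using assms(2,3)
proof (induction k arbitrary: f g)
  case 0
  then show ?case by (simp add: continuous_on_add)
next
  case (Suc k)
  have "C_k n k U (partial_derivative i (\<lambda>x. f x + g x))" if "i < n" for i
  proof (rule C_k_cong[OF assms(1)])
    show "C_k n k U (\<lambda>x. partial_derivative i f x + partial_derivative i g x)"
      using Suc that by simp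
  qed (use partial_derivative_add[OF Suc.prems that] in simp)
  moreover have "continuous_on U (\<lambda>x. f x + g x)"
    using Suc.prems by (intro continuous_on_add) simp_all
  moreover have "(\<lambda>t. f (x(i := t)) + g (x(i := t))) differentiable (at (x i))" if "i < n" "x \<in> U" for i x
    using Suc.prems that by (intro differentiable_add) simp_all
  ultimately show ?case by simp
qed

lemma C_k_mult:
  assumes "openin (top_of_set (model_space n)) U" "C_k n k U f" "C_k n k U g"
  shows "C_k n k U (\<lambda>x. f x * g x)"
  using assms(2,3)
proof (induction k arbitrary: f g)
  case 0
  then show ?case by (simp add: continuous_on_mult)
next
  case (Suc k)
  \<comment> \<open>The product rule multiplies derivatives by f and g themselves, so the induction
    hypothesis is also applied to these at the lower order.\<close>
  note lower = C_k_Suc_imp[OF Suc.prems(1)] C_k_Suc_imp[OF Suc.prems(2)]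
  have "C_k n k U (partial_derivative i (\<lambda>x. f x * g x))" if "i < n" for i
  proof (rule C_k_cong[OF assms(1)])
    show "C_k n k U (\<lambda>x. f x * partial_derivative i g x + partial_derivative i f x * g x)"
      using Suc.prems that by (intro C_k_add[OF assms(1)] Suc.IH lower) simp_all
  qed (use partial_derivative_mult[OF Suc.prems that] in simp)
  moreover have "continuous_on U (\<lambda>x. f x * g x)"
    using Suc.prems by (intro continuous_on_mult) simp_all
  moreover have "(\<lambda>t. f (x(i := t)) * g (x(i := t))) differentiable (at (x i))" if "i < n" "x \<in> U" for i x
    using Suc.prems that by (intro differentiable_mult) simp_all
  ultimately show ?case by simp
qed

lemma C_k_const: "C_k n k U (\<lambda>x. c)"
  by (induction k arbitrary: c) (simp_all add: partial_derivative_def[abs_def])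

lemma openin_chart_image:
  assumes "smooth_manifold M" "(W, \<phi>) \<in> charts M" "open U"
  shows "openin (top_of_set (model_space (mdim M))) (\<phi> ` (U \<inter> W))"
proof -
  have W: "open W" "openin (top_of_set (model_space (mdim M))) (\<phi> ` W)"
    "homeomorphism W (\<phi> ` W) \<phi> (the_inv_into W \<phi>)"
    using assms(1,2) by (auto simp: smooth_manifold_def)
  have "openin (top_of_set (\<phi> ` W)) (\<phi> ` (U \<inter> W))"
    using assms(3) by (intro homeomorphism_imp_open_map[OF W(3)]) (auto simp: openin_open)
  then show ?thesis
    using W(2) by (rule openin_trans)
qed

lemma smooth_fun_add:
  "smooth_manifold M \<Longrightarrow> open U \<Longrightarrow> smooth_fun M U f \<Longrightarrow> smooth_fun M U g \<Longrightarrow>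
    smooth_fun M U (\<lambda>p. f p + g p)"
  using C_k_add[OF openin_chart_image]
  by (fastforce simp: smooth_fun_def smooth_model_def comp_def)

lemma smooth_fun_mult:
  "smooth_manifold M \<Longrightarrow> open U \<Longrightarrow> smooth_fun M U f \<Longrightarrow> smooth_fun M U g \<Longrightarrow>
    smooth_fun M U (\<lambda>p. f p * g p)"
  using C_k_mult[OF openin_chart_image]
  by (fastforce simp: smooth_fun_def smooth_model_def comp_def)

lemma smooth_fun_const: "smooth_fun M U (\<lambda>p. c)"
  by (auto simp: smooth_fun_def smooth_model_def comp_def intro: C_k_const)

lemma smooth_fun_subset: "smooth_fun M U f \<Longrightarrow> V \<subseteq> U \<Longrightarrow> smooth_fun M V f"
  unfolding smooth_fun_def smooth_model_def
  by (blast intro: C_k_subset)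

lemma C_infinity_const: "(\<lambda>p. c) \<in> C_infinity M"
  by (simp add: C_infinity_def smooth_fun_const)

lemma C_infinity_mult:
  "smooth_manifold M \<Longrightarrow> f \<in> C_infinity M \<Longrightarrow> g \<in> C_infinity M \<Longrightarrow> f * g \<in> C_infinity M"
  using smooth_fun_mult[of M UNIV f g] by (simp add: C_infinity_def times_fun_def)

lemma subspace_C_infinity: "smooth_manifold M \<Longrightarrow> subspace (C_infinity M)"
  using smooth_fun_add[of M UNIV] smooth_fun_mult[OF _ open_UNIV smooth_fun_const]
  by (auto simp: subspace_def C_infinity_def zero_fun_def plus_fun_def scaleR_fun_def smooth_fun_const)

text \<open>Multiplying by g multiplies the coefficients in every local frame by g. With this, S(z,
  g a) = g S(z, a) can be used for sections, on which \<open>circ_D_left\<close> rests.\<close>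

lemma sections_smooth_scale:
  assumes M: "smooth_manifold M" and E: "vector_bundle M E"
    and g: "g \<in> C_infinity M" and s: "s \<in> sections M E"
  shows "(\<lambda>p. g p *\<^sub>R s p) \<in> sections M E"
proof -
  have "smooth_combination M W bs (\<lambda>p. g p *\<^sub>R s p)" if W: "(W, bs) \<in> frames E" for W bs
  proof -
    obtain c where c: "\<forall>i<length bs. smooth_fun M W (c i)"
      "\<forall>p\<in>W. s p = (\<Sum>i<length bs. c i p *\<^sub>R (bs ! i) p)"
      using s W by (auto simp: sections_def smooth_section_def smooth_combination_def)
    have "open W" using E W by (auto simp: vector_bundle_def)
    moreover have "smooth_fun M W g"
      using g by (auto simp: C_infinity_def intro: smooth_fun_subset)
    ultimately show ?thesis
      unfolding smooth_combination_def
      using c by (intro exI[of _ "\<lambda>i p. g p * c i p"])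
        (auto simp: scaleR_sum_right intro: smooth_fun_mult[OF M])
  qed
  then show ?thesis
    using s E by (auto simp: sections_def smooth_section_def vector_bundle_def subspace_scale)
qed

section \<open>Graded multilinear maps\<close>

text \<open>Reduces identities in a vector space without a norm to linear arithmetic over the reals.\<close>

lemma eq_by_linear_functionals:
  fixes x y :: "'a::real_vector"
  assumes "\<And>\<phi>::'a \<Rightarrow> real. linear \<phi> \<Longrightarrow> \<phi> x = \<phi> y"
  shows "x = y"
proof (rule ccontr)
  assume "x \<noteq> y"
  then have "independent {x - y}"
    by (simp add: dependent_single)
  then obtain \<phi> :: "'a \<Rightarrow> real" where \<phi>: "linear \<phi>" "\<phi> (x - y) = 1"
    using linear_independent_extend[of "{x - y}" "\<lambda>_. 1"] by auto
  show False
    using assms[OF \<phi>(1)] \<phi> by (simp add: linear_diff)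
qed

section \<open>Linear maps on subspaces and rearrangement of tuples\<close>

lemma linear_on_add: "linear_on V f \<Longrightarrow> x \<in> V \<Longrightarrow> y \<in> V \<Longrightarrow> f (x + y) = f x + f y"
  and linear_on_scale: "linear_on V f \<Longrightarrow> x \<in> V \<Longrightarrow> f (c *\<^sub>R x) = c *\<^sub>R f x"
  by (auto simp: linear_on_def)

lemma linear_on_0: "linear_on V f \<Longrightarrow> 0 \<in> V \<Longrightarrow> f 0 = 0"
  using linear_on_scale[of V f 0 0] by simp

lemma linear_on_cong:
  "linear_on V g \<Longrightarrow> (\<And>x. x \<in> V \<Longrightarrow> f x = g x) \<Longrightarrow> subspace V \<Longrightarrow> linear_on V f"
  by (auto simp: linear_on_def subspace_add subspace_scale)

lemma linear_on_compose_scale: "linear_on V f \<Longrightarrow> linear_on V (\<lambda>x. c *\<^sub>R f x)"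
  by (auto simp: linear_on_def algebra_simps)

lemma linear_on_compose_add: "linear_on V f \<Longrightarrow> linear_on V g \<Longrightarrow> linear_on V (\<lambda>x. f x + g x)"
  by (auto simp: linear_on_def algebra_simps)

lemma linear_on_const_0: "linear_on V (\<lambda>x. 0)"
  by (auto simp: linear_on_def)

lemma linear_on_compose:
  "linear_on V f \<Longrightarrow> f ` V \<subseteq> W \<Longrightarrow> linear_on W g \<Longrightarrow> linear_on V (\<lambda>x. g (f x))"
  by (auto simp: linear_on_def image_subset_iff)

text \<open>The rearrangement inside \<open>perm\<close> without its Koszul sign, polymorphic so
  that it acts on tuples of vectors and on their degree lists alike. The entry in place i moves to
  place \<sigma> i.\<close>

definition permute_list1 :: "(nat \<Rightarrow> nat) \<Rightarrow> 'a list \<Rightarrow> 'a list" where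
  "permute_list1 \<sigma> vs = map (\<lambda>i. vs ! (inv \<sigma> i - 1)) [1..<Suc (length vs)]"

lemma length_permute_list1 [simp]: "length (permute_list1 \<sigma> vs) = length vs"
  by (simp add: permute_list1_def del: upt_Suc)

lemma nth_permute_list1: "i < length vs \<Longrightarrow> permute_list1 \<sigma> vs ! i = vs ! (inv \<sigma> (Suc i) - 1)"
  by (simp add: permute_list1_def del: upt_Suc)

lemma perm_eq: "perm L \<mu> \<sigma> vs = koszul \<sigma> (map (degree_of L) vs) *\<^sub>R \<mu> (permute_list1 \<sigma> vs)"
  by (simp add: perm_def permute_list1_def)

lemma inv_permutes_range:
  assumes "\<sigma> permutes {1..n}" "i < n"
  shows "inv \<sigma> (Suc i) - 1 < n" "Suc (inv \<sigma> (Suc i) - 1) = inv \<sigma> (Suc i)"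
        "\<sigma> (Suc i) - 1 < n" "Suc (\<sigma> (Suc i) - 1) = \<sigma> (Suc i)"
proof -
  have "inv \<sigma> (Suc i) \<in> {1..n}" "\<sigma> (Suc i) \<in> {1..n}"
    using assms permutes_in_image[OF permutes_inv[OF assms(1)]] permutes_in_image[OF assms(1)]
    by auto
  then show "inv \<sigma> (Suc i) - 1 < n" "Suc (inv \<sigma> (Suc i) - 1) = inv \<sigma> (Suc i)"
        "\<sigma> (Suc i) - 1 < n" "Suc (\<sigma> (Suc i) - 1) = \<sigma> (Suc i)"
    by auto
qed

lemma permute_list1_compose:
  assumes "\<sigma> permutes {1..length vs}" "\<tau> permutes {1..length vs}"
  shows "permute_list1 \<tau> (permute_list1 \<sigma> vs) = permute_list1 (\<tau> \<circ> \<sigma>) vs"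
proof (rule nth_equalityI)
  fix i assume i: "i < length (permute_list1 \<tau> (permute_list1 \<sigma> vs))"
  have "inv (\<tau> \<circ> \<sigma>) = inv \<sigma> \<circ> inv \<tau>"
    using assms by (simp add: o_inv_distrib permutes_bij)
  then show "permute_list1 \<tau> (permute_list1 \<sigma> vs) ! i = permute_list1 (\<tau> \<circ> \<sigma>) vs ! i"
    using i assms inv_permutes_range[OF assms(2)] by (simp add: nth_permute_list1)
qed simp

lemma mset_permute_list1:
  assumes "\<sigma> permutes {1..length vs}"
  shows "mset (permute_list1 \<sigma> vs) = mset vs"
proof -
  have eq: "mset vs = image_mset (\<lambda>i. vs ! (i - 1)) (mset_set {1..length vs})"
  proof -
    have "mset vs = mset (map (\<lambda>i. vs ! (i - 1)) [1..<Suc (length vs)])"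
      by (rule arg_cong[where f = mset], rule nth_equalityI) (simp_all del: upt_Suc)
    then show ?thesis
      by (simp add: atLeastLessThanSuc_atLeastAtMost del: upt_Suc)
  qed
  have "mset_set {1..length vs} = image_mset (inv \<sigma>) (mset_set {1..length vs})"
    using permutes_image[OF permutes_inv[OF assms]] permutes_inj_on[OF permutes_inv[OF assms]]
    by (simp add: image_mset_mset_set)
  then have "mset vs = image_mset (\<lambda>i. vs ! (i - 1)) (image_mset (inv \<sigma>) (mset_set {1..length vs}))"
    using eq by simp
  then show ?thesis
    by (simp add: permute_list1_def atLeastLessThanSuc_atLeastAtMost multiset.map_comp comp_def
        del: upt_Suc)
qed

lemma set_permute_list1: "\<sigma> permutes {1..length vs} \<Longrightarrow> set (permute_list1 \<sigma> vs) = set vs"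
  by (metis mset_permute_list1 set_mset_mset)

lemma sum_list_permute_list1:
  fixes ds :: "nat list"
  shows "\<sigma> permutes {1..length ds} \<Longrightarrow> sum_list (permute_list1 \<sigma> ds) = sum_list ds"
  by (metis mset_permute_list1 sum_mset_sum_list)

text \<open>List indices start at 0 and permutations at 1, whence the shifts. The lemma transfers
  linearity from a slot of the permuted tuple to the slot it came from, as
  \<open>graded_map_perm\<close> requires.\<close>

lemma permute_list1_update:
  assumes "\<sigma> permutes {1..length vs}" "i < length vs"
  shows "permute_list1 \<sigma> (vs[i := u]) = (permute_list1 \<sigma> vs)[\<sigma> (Suc i) - 1 := u]"
proof (rule nth_equalityI)
  fix j assume "j < length (permute_list1 \<sigma> (vs[i := u]))"
  then have j: "j < length vs" by simp
  have "inv \<sigma> (Suc j) - 1 = i \<longleftrightarrow> \<sigma> (Suc i) - 1 = j"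
    using inv_permutes_range[OF assms(1)] assms(2) j permutes_inverses[OF assms(1)]
    by (metis diff_Suc_1)
  then show "permute_list1 \<sigma> (vs[i := u]) ! j = (permute_list1 \<sigma> vs)[\<sigma> (Suc i) - 1 := u] ! j"
    using j assms inv_permutes_range(1)[OF assms(1) j] inv_permutes_range(3)[OF assms(1,2)]
    by (auto simp: nth_permute_list1 nth_list_update simp del: One_nat_def)
qed simp

lemma koszul_eq_1:
  assumes "\<And>a b. a < b \<Longrightarrow> b < length ds \<Longrightarrow> even (ds ! a * ds ! b)"
  shows "koszul \<sigma> ds = 1"
  unfolding koszul_def
proof (intro prod.neutral ballI, clarsimp)
  fix a b :: nat assume ab: "Suc 0 \<le> a" "a < b" "b \<le> length ds"
  have "even (ds ! (a - 1) * ds ! (b - 1))"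
    using ab by (intro assms) auto
  then show "sgn_deg (int (ds ! (a - Suc 0)) * int (ds ! (b - Suc 0))) = 1"
    by (auto simp: sgn_deg_def)
qed

section \<open>Homogeneous tuples and graded maps\<close>

locale graded_space =
  fixes L :: "nat \<Rightarrow> 'v::real_vector set"
  assumes subspace: "subspace (L i)"
    and disjoint: "v \<in> L i \<Longrightarrow> v \<in> L j \<Longrightarrow> i \<noteq> j \<Longrightarrow> v = 0"
begin

text \<open>The degrees are given rather than computed with \<open>degree_of\<close>: a zero entry
  may carry any degree here, so the degree list survives the substitution of an arbitrary vector of
  the same degree.\<close>

definition homogeneous :: "nat list \<Rightarrow> 'v list \<Rightarrow> bool" where
  "homogeneous ds vs \<longleftrightarrow> list_all2 (\<lambda>d v. v \<in> L d) ds vs"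

lemma homogeneous_Nil [simp]: "homogeneous [] vs \<longleftrightarrow> vs = []"
  and homogeneous_Cons [simp]:
    "homogeneous (d # ds) (v # vs) \<longleftrightarrow> v \<in> L d \<and> homogeneous ds vs"
  by (simp_all add: homogeneous_def)

lemma homogeneous_length: "homogeneous ds vs \<Longrightarrow> length ds = length vs"
  by (simp add: homogeneous_def list_all2_lengthD)

lemma homogeneous_nth: "homogeneous ds vs \<Longrightarrow> i < length vs \<Longrightarrow> vs ! i \<in> L (ds ! i)"
  by (simp add: homogeneous_def list_all2_conv_all_nth)

lemma homogeneous_iff:
  "homogeneous ds vs \<longleftrightarrow> length ds = length vs \<and> (\<forall>i<length vs. vs ! i \<in> L (ds ! i))"
  by (auto simp add: homogeneous_def list_all2_conv_all_nth)

lemma zero_mem [simp]: "0 \<in> L i"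
  by (simp add: subspace subspace_0)

lemma degree_of_eq: "v \<in> L i \<Longrightarrow> v \<noteq> 0 \<Longrightarrow> degree_of L v = i"
  using disjoint[of v "LEAST i. v \<in> L i" i] LeastI[of "\<lambda>i. v \<in> L i" i]
  by (auto simp: degree_of_def)

lemma mem_degree_of: "v \<in> L i \<Longrightarrow> v \<in> L (degree_of L v)"
  unfolding degree_of_def by (rule LeastI)

lemma degree_of_map_eq:
  assumes "homogeneous ds vs" "0 \<notin> set vs"
  shows "map (degree_of L) vs = ds"
  using assms
  by (auto simp: homogeneous_iff list_eq_iff_nth_eq in_set_conv_nth intro!: degree_of_eq)

lemma homogeneous_degree_of:
  assumes "homogeneous ds vs"
  shows "homogeneous (map (degree_of L) vs) vs"
  using assms by (auto simp: homogeneous_iff intro: mem_degree_of)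

lemma homogeneous_tuples_iff:
  "vs \<in> homogeneous_tuples L n \<longleftrightarrow> length vs = n \<and> homogeneous (map (degree_of L) vs) vs"
proof
  assume "vs \<in> homogeneous_tuples L n"
  then show "length vs = n \<and> homogeneous (map (degree_of L) vs) vs"
    unfolding homogeneous_tuples_def homogeneous_iff
    by (auto dest!: subsetD[OF _ nth_mem] intro: mem_degree_of)
next
  assume "length vs = n \<and> homogeneous (map (degree_of L) vs) vs"
  then show "vs \<in> homogeneous_tuples L n"
    by (auto simp: homogeneous_tuples_def homogeneous_iff in_set_conv_nth) blast
qed

lemma homogeneous_update:
  "homogeneous ds vs \<Longrightarrow> u \<in> L d \<Longrightarrow> homogeneous (ds[i := d]) (vs[i := u])"
  by (simp add: homogeneous_def list_all2_update_cong)

lemma homogeneous_update_same: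
  "homogeneous ds vs \<Longrightarrow> u \<in> L (ds ! i) \<Longrightarrow> homogeneous ds (vs[i := u])"
  using homogeneous_update[of ds vs u "ds ! i" i] by simp

lemma graded_map_mem:
  "graded_map L n k \<mu> \<Longrightarrow> homogeneous ds vs \<Longrightarrow> length vs = n \<Longrightarrow> \<mu> vs \<in> L (sum_list ds + k)"
  unfolding graded_map_def homogeneous_iff by auto

lemma graded_map_linear:
  "graded_map L n k \<mu> \<Longrightarrow> homogeneous ds vs \<Longrightarrow> length vs = n \<Longrightarrow> i < n \<Longrightarrow>
     linear_on (L (ds ! i)) (\<lambda>u. \<mu> (vs[i := u]))"
  unfolding graded_map_def homogeneous_iff by auto

lemma graded_mapI:
  assumes "\<And>ds vs. homogeneous ds vs \<Longrightarrow> length vs = n \<Longrightarrow> \<mu> vs \<in> L (sum_list ds + k)"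
    and "\<And>ds vs i. homogeneous ds vs \<Longrightarrow> length vs = n \<Longrightarrow> i < n \<Longrightarrow>
           linear_on (L (ds ! i)) (\<lambda>u. \<mu> (vs[i := u]))"
  shows "graded_map L n k \<mu>"
  using assms unfolding graded_map_def homogeneous_iff by auto

lemma graded_map_eq_0:
  assumes "graded_map L n k \<mu>" "homogeneous ds vs" "length vs = n" "0 \<in> set vs"
  shows "\<mu> vs = 0"
proof -
  obtain i where "i < length vs" "vs ! i = 0"
    using assms(4) by (auto simp: in_set_conv_nth)
  then show ?thesis
    using linear_on_0[OF graded_map_linear[OF assms(1-3), of i]] assms(3)
    by (metis list_update_id zero_mem)
qed

lemma graded_map_zero: "graded_map L n k 0"
  by (rule graded_mapI) (simp_all add: linear_on_const_0)

lemma graded_map_add: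
  "graded_map L n k \<mu> \<Longrightarrow> graded_map L n k \<nu> \<Longrightarrow> graded_map L n k (\<mu> + \<nu>)"
  by (rule graded_mapI)
    (simp_all add: subspace_add[OF subspace] graded_map_mem linear_on_compose_add graded_map_linear)

lemma graded_map_scale: "graded_map L n k \<mu> \<Longrightarrow> graded_map L n k (c *\<^sub>R \<mu>)"
  by (rule graded_mapI)
    (simp_all add: subspace_scale[OF subspace] graded_map_mem linear_on_compose_scale
      graded_map_linear)

lemma graded_map_uminus: "graded_map L n k \<mu> \<Longrightarrow> graded_map L n k (- \<mu>)"
  using graded_map_scale[of n k \<mu> "-1"] by simp

lemma graded_map_diff:
  "graded_map L n k \<mu> \<Longrightarrow> graded_map L n k \<nu> \<Longrightarrow> graded_map L n k (\<mu> - \<nu>)"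
  using graded_map_add[OF _ graded_map_uminus, of n k \<mu> \<nu>] by simp

lemma graded_map_sum:
  "(\<And>i. i \<in> I \<Longrightarrow> graded_map L n k (\<mu> i)) \<Longrightarrow> graded_map L n k (sum \<mu> I)"
  by (induction I rule: infinite_finite_induct) (auto intro: graded_map_zero graded_map_add)

lemma homogeneous_permute:
  assumes "homogeneous ds vs" "\<sigma> permutes {1..length vs}"
  shows "homogeneous (permute_list1 \<sigma> ds) (permute_list1 \<sigma> vs)"
  using assms inv_permutes_range[OF assms(2)] by (simp add: homogeneous_iff nth_permute_list1)

text \<open>At a zero entry \<open>degree_of\<close> may disagree with \<open>ds\<close> and the two
  signs may differ, but then both sides vanish by multilinearity.\<close>

lemma perm_homogeneous:
  assumes "graded_map L n k \<mu>" "\<sigma> permutes {1..n}" "homogeneous ds vs" "length vs = n"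
  shows "perm L \<mu> \<sigma> vs = koszul \<sigma> ds *\<^sub>R \<mu> (permute_list1 \<sigma> vs)"
proof (cases "0 \<in> set vs")
  case True
  then have "\<mu> (permute_list1 \<sigma> vs) = 0"
    using assms homogeneous_permute[of ds vs \<sigma>] set_permute_list1[of \<sigma> vs]
    by (intro graded_map_eq_0[OF assms(1)]) auto
  then show ?thesis by (simp add: perm_eq)
next
  case False
  then show ?thesis using degree_of_map_eq[OF assms(3)] by (simp add: perm_eq)
qed

lemma graded_map_perm:
  assumes "graded_map L n k \<mu>" "\<sigma> permutes {1..n}"
  shows "graded_map L n k (perm L \<mu> \<sigma>)"
proof (rule graded_mapI)
  fix ds vs assume vs: "homogeneous ds vs" "length vs = n"
  have ds: "length ds = n" using vs homogeneous_length by auto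
  have *: "\<mu> (permute_list1 \<sigma> vs) \<in> L (sum_list ds + k)"
    using graded_map_mem[OF assms(1) homogeneous_permute, of ds vs \<sigma>] vs assms(2) ds
    by (simp add: sum_list_permute_list1)
  then show "perm L \<mu> \<sigma> vs \<in> L (sum_list ds + k)"
    using vs assms by (simp add: perm_homogeneous subspace subspace_scale)
  fix i assume i: "i < n"
  have \<sigma>: "inv \<sigma> (\<sigma> (Suc i)) = Suc i"
    using permutes_inverses[OF assms(2)] by simp
  have "linear_on (L (permute_list1 \<sigma> ds ! (\<sigma> (Suc i) - 1)))
          (\<lambda>u. \<mu> ((permute_list1 \<sigma> vs)[\<sigma> (Suc i) - 1 := u]))"
    using vs ds assms i inv_permutes_range[OF assms(2) i]
    by (intro graded_map_linear[OF assms(1)] homogeneous_permute) auto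
  also have "permute_list1 \<sigma> ds ! (\<sigma> (Suc i) - 1) = ds ! i"
    using i ds inv_permutes_range[OF assms(2) i] \<sigma> by (simp add: nth_permute_list1)
  finally have "linear_on (L (ds ! i)) (\<lambda>u. koszul \<sigma> ds *\<^sub>R \<mu> (permute_list1 \<sigma> (vs[i := u])))"
    using vs i assms(2) by (simp add: linear_on_compose_scale permute_list1_update)
  moreover have "perm L \<mu> \<sigma> (vs[i := u]) = koszul \<sigma> ds *\<^sub>R \<mu> (permute_list1 \<sigma> (vs[i := u]))"
    if "u \<in> L (ds ! i)" for u
    using vs that by (intro perm_homogeneous[OF assms]) (auto intro: homogeneous_update_same)
  ultimately show "linear_on (L (ds ! i)) (\<lambda>u. perm L \<mu> \<sigma> (vs[i := u]))"
    using subspace by (rule linear_on_cong)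
qed

lemma graded_map_alternating_sum:
  "graded_map L n k \<mu> \<Longrightarrow> graded_map L n k (alternating_sum L n \<mu>)"
  unfolding alternating_sum_def by (intro graded_map_sum graded_map_scale graded_map_perm) auto

text \<open>This is \<open>pcomp\<close> without its sign and with positions counted from 0. The
  sign depends on the arguments through \<open>degree_of\<close>, so multilinearity is proved for
  the unsigned map first; \<open>pcomp_homogeneous\<close> then adds a sign that depends on the
  degree list only.\<close>

definition insert_map :: "('v list \<Rightarrow> 'v) \<Rightarrow> nat \<Rightarrow> nat \<Rightarrow> ('v list \<Rightarrow> 'v) \<Rightarrow> 'v list \<Rightarrow> 'v" where
  "insert_map \<mu> i r \<nu> vs = \<mu> (take i vs @ \<nu> (take r (drop i vs)) # drop (i + r) vs)"

lemma homogeneous_append: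
  "homogeneous ds vs \<Longrightarrow> homogeneous ds' vs' \<Longrightarrow> homogeneous (ds @ ds') (vs @ vs')"
  by (simp add: homogeneous_def list_all2_appendI)

lemma homogeneous_take: "homogeneous ds vs \<Longrightarrow> homogeneous (take i ds) (take i vs)"
  by (simp add: homogeneous_def)

lemma homogeneous_drop: "homogeneous ds vs \<Longrightarrow> homogeneous (drop i ds) (drop i vs)"
  by (simp add: homogeneous_def)

lemma graded_map_insert:
  assumes \<mu>: "graded_map L m k \<mu>" and \<nu>: "graded_map L r q \<nu>" and i: "i < m"
    and n: "Suc n = m + r"
  shows "graded_map L n (k + q) (insert_map \<mu> i r \<nu>)"
proof (rule graded_mapI)
  fix ds vs assume vs: "homogeneous ds vs" "length vs = n"
  have ds: "length ds = n" using vs homogeneous_length by auto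
  define q' where "q' = sum_list (take r (drop i ds)) + q"
  have mid: "\<nu> (take r (drop i us)) \<in> L q'" if "homogeneous ds us" "length us = n" for us
    unfolding q'_def using that i n
    by (intro graded_map_mem[OF \<nu>] homogeneous_take homogeneous_drop) auto
  let ?ds = "take i ds @ q' # drop (i + r) ds"
  have hom: "homogeneous ?ds (take i vs @ \<nu> (take r (drop i vs)) # drop (i + r) vs)"
    using vs mid by (intro homogeneous_append) (auto intro: homogeneous_take homogeneous_drop)
  have len: "length (take i vs @ \<nu> (take r (drop i vs)) # drop (i + r) vs) = m"
    using vs i n by auto
  have "ds = take i ds @ take r (drop i ds) @ drop (i + r) ds"
    by (metis add.commute append_take_drop_id drop_drop)
  then have "sum_list ds = sum_list (take i ds) + sum_list (take r (drop i ds)) +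
      sum_list (drop (i + r) ds)"
    by (metis sum_list.append add.assoc)
  then have sum: "sum_list ?ds + k = sum_list ds + (k + q)"
    by (simp add: q'_def)
  show "insert_map \<mu> i r \<nu> vs \<in> L (sum_list ds + (k + q))"
    using graded_map_mem[OF \<mu> hom len] unfolding insert_map_def sum .
  fix j assume j: "j < n"
  \<comment> \<open>The varied argument lies before, inside or behind the block consumed by
    \<open>\<nu>\<close>; inside the block, linearity is that of a composite.\<close>
  consider "j < i" | "i \<le> j" "j < i + r" | "i + r \<le> j" by linarith
  then show "linear_on (L (ds ! j)) (\<lambda>u. insert_map \<mu> i r \<nu> (vs[j := u]))"
  proof cases
    case 1
    then have "linear_on (L (?ds ! j))
        (\<lambda>u. \<mu> ((take i vs @ \<nu> (take r (drop i vs)) # drop (i + r) vs)[j := u]))"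
      using i by (intro graded_map_linear[OF \<mu> hom len]) auto
    moreover have "?ds ! j = ds ! j" using 1 ds i n by (simp add: nth_append)
    ultimately show ?thesis
      using 1 vs i n by (simp add: insert_map_def take_update_swap list_update_append)
  next
    case 2
    have *: "linear_on (L (?ds ! i))
        (\<lambda>u. \<mu> ((take i vs @ \<nu> (take r (drop i vs)) # drop (i + r) vs)[i := u]))"
      using i by (intro graded_map_linear[OF \<mu> hom len]) auto
    have 3: "linear_on (L q') (\<lambda>u. \<mu> (take i vs @ u # drop (i + r) vs))"
    proof -
      have "length (take i vs) = i" "length (take i ds) = i" using vs ds i n by auto
      then show ?thesis using * by (simp add: nth_append list_update_append)
    qed
    have "linear_on (L (take r (drop i ds) ! (j - i))) (\<lambda>u. \<nu> ((take r (drop i vs))[j - i := u]))"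
      using vs 2 i n
      by (intro graded_map_linear[OF \<nu>] homogeneous_take homogeneous_drop) auto
    moreover have "take r (drop i ds) ! (j - i) = ds ! j" using 2 ds j by auto
    ultimately have 4: "linear_on (L (ds ! j)) (\<lambda>u. \<nu> (take r (drop i (vs[j := u]))))"
      using 2 by (simp add: drop_update_swap take_update_swap)
    have "linear_on (L (ds ! j)) (\<lambda>u. \<mu> (take i vs @ \<nu> (take r (drop i (vs[j := u]))) # drop (i + r) vs))"
      using vs by (intro linear_on_compose[OF 4 _ 3]) (auto intro!: mid homogeneous_update_same)
    then show ?thesis
      using 2 by (simp add: insert_map_def)
  next
    case 3
    \<comment> \<open>The block of r arguments shrinks to a single one, so an argument behind it
      sits at \<open>j - r + 1\<close> in the contracted list.\<close>
    have "linear_on (L (?ds ! (j - r + 1)))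
        (\<lambda>u. \<mu> ((take i vs @ \<nu> (take r (drop i vs)) # drop (i + r) vs)[j - r + 1 := u]))"
      using i n j 3 by (intro graded_map_linear[OF \<mu> hom len]) auto
    moreover have "?ds ! (j - r + 1) = ds ! j" using 3 ds i j n
      by (auto simp: nth_append nth_Cons' min_def Suc_diff_le)
    moreover have "(take i vs @ \<nu> (take r (drop i vs)) # drop (i + r) vs)[j - r + 1 := u] =
        take i vs @ \<nu> (take r (drop i vs)) # (drop (i + r) vs)[j - (i + r) := u]" for u
    proof -
      have "j - r + 1 - i = Suc (j - (i + r))" "\<not> j - r + 1 < i" using 3 by auto
      then show ?thesis
        using 3 vs i j n by (simp add: list_update_append min_def)
    qed
    ultimately show ?thesis
      using 3 vs by (simp add: insert_map_def drop_update_swap)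
  qed
qed

lemma pcomp_homogeneous:
  assumes \<mu>: "graded_map L m k \<mu>" and \<nu>: "graded_map L r q \<nu>" and i: "0 < i" "i \<le> m"
    and n: "Suc n = m + r" and vs: "homogeneous ds vs" "length vs = n"
  shows "pcomp L \<mu> i (r, int q, \<nu>) vs =
    sgn_deg (int q * int (sum_list (take (i - 1) ds))) *\<^sub>R insert_map \<mu> (i - 1) r \<nu> vs"
proof (cases "0 \<in> set vs")
  case True
  have "graded_map L n (k + q) (insert_map \<mu> (i - 1) r \<nu>)"
    using i n by (intro graded_map_insert[OF \<mu> \<nu>]) auto
  then have "insert_map \<mu> (i - 1) r \<nu> vs = 0"
    using True vs by (auto intro: graded_map_eq_0)
  then show ?thesis by (simp add: pcomp_def insert_map_def)
next
  case False
  then show ?thesis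
    using degree_of_map_eq[OF vs(1)] by (simp add: pcomp_def insert_map_def flip: take_map)
qed

lemma graded_map_pcomp:
  assumes \<mu>: "graded_map L m k \<mu>" and \<nu>: "graded_map L r q \<nu>" and i: "0 < i" "i \<le> m"
    and n: "Suc n = m + r"
  shows "graded_map L n (k + q) (pcomp L \<mu> i (r, int q, \<nu>))"
proof (rule graded_mapI)
  fix ds vs assume vs: "homogeneous ds vs" "length vs = n"
  have ins: "graded_map L n (k + q) (insert_map \<mu> (i - 1) r \<nu>)"
    using i n by (intro graded_map_insert[OF \<mu> \<nu>]) auto
  show "pcomp L \<mu> i (r, int q, \<nu>) vs \<in> L (sum_list ds + (k + q))"
    using graded_map_mem[OF ins vs]
    by (simp add: pcomp_homogeneous[OF assms vs] subspace_scale subspace)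
  fix j assume j: "j < n"
  have "linear_on (L (ds ! j)) (\<lambda>u. sgn_deg (int q * int (sum_list (take (i - 1) ds))) *\<^sub>R
      insert_map \<mu> (i - 1) r \<nu> (vs[j := u]))"
    by (intro linear_on_compose_scale graded_map_linear[OF ins vs] j)
  moreover have "pcomp L \<mu> i (r, int q, \<nu>) (vs[j := u]) =
      sgn_deg (int q * int (sum_list (take (i - 1) ds))) *\<^sub>R
      insert_map \<mu> (i - 1) r \<nu> (vs[j := u])"
    if "u \<in> L (ds ! j)" for u
    using that vs by (intro pcomp_homogeneous[OF assms]) (auto intro: homogeneous_update_same)
  ultimately show "linear_on (L (ds ! j)) (\<lambda>u. pcomp L \<mu> i (r, int q, \<nu>) (vs[j := u]))"
    using subspace by (rule linear_on_cong)
qed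

definition vanishes_above :: "nat \<Rightarrow> nat \<Rightarrow> ('v list \<Rightarrow> 'v) \<Rightarrow> bool" where
  "vanishes_above n m \<mu> \<longleftrightarrow> (\<forall>ds vs. homogeneous ds vs \<longrightarrow> length vs = n \<longrightarrow>
     0 \<in> set vs \<or> m < sum_list ds \<longrightarrow> \<mu> vs = 0)"

text \<open>The comparison is made for the degree list computed by \<open>degree_of\<close>. Where
  that list is unreliable, at zero entries, both maps vanish.\<close>

lemma map_eqI_bounded:
  assumes "vanishes_above n m \<mu>" "vanishes_above n m \<nu>"
    and "\<And>ds vs. homogeneous ds vs \<Longrightarrow> length vs = n \<Longrightarrow> 0 \<notin> set vs \<Longrightarrow> sum_list ds \<le> m \<Longrightarrow> \<mu> vs = \<nu> vs"
  shows "map_eq L \<mu> n \<nu>"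
  unfolding map_eq_def
proof
  fix vs assume "vs \<in> homogeneous_tuples L n"
  then have vs: "length vs = n" "homogeneous (map (degree_of L) vs) vs"
    by (simp_all add: homogeneous_tuples_iff)
  show "\<mu> vs = \<nu> vs"
  proof (cases "0 \<in> set vs \<or> m < sum_list (map (degree_of L) vs)")
    case True
    then have "\<mu> vs = 0" "\<nu> vs = 0"
      using assms(1,2) vs unfolding vanishes_above_def by blast+
    then show ?thesis by simp
  next
    case False
    then show ?thesis using assms(3) vs by simp
  qed
qed

lemma map_eqD: "map_eq L \<mu> n \<nu> \<Longrightarrow> homogeneous ds vs \<Longrightarrow> length vs = n \<Longrightarrow> \<mu> vs = \<nu> vs"
  unfolding map_eq_def by (simp add: homogeneous_degree_of homogeneous_tuples_iff)

end

section \<open>Degree bounds in a three-term complex\<close>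

locale three_term =
  fixes L :: "nat \<Rightarrow> 'v::real_vector set" and d :: "'v \<Rightarrow> 'v"
  assumes complex: "three_term_complex L d"

text \<open>Independence of the three pieces, applied to v and -v in two of them and 0 in the third,
  shows that any two meet in 0 only; above degree 2 the pieces are zero.\<close>

sublocale three_term \<subseteq> graded_space L
proof
  show sub: "Real_Vector_Spaces.subspace (L i)" for i
    using complex by (simp add: three_term_complex_def)
  have sum: "x = 0 \<and> y = 0 \<and> z = 0" if "x \<in> L 0" "y \<in> L 1" "z \<in> L 2" "x + y + z = 0" for x y z
    using complex that by (auto simp: three_term_complex_def)
  have 0: "0 \<in> L i" for i using sub by (simp add: subspace_0)
  have neg: "- v \<in> L i" if "v \<in> L i" for v i using sub that by (simp add: subspace_neg)
  have "v = 0" if v: "v \<in> L i" "v \<in> L j" "i < j" for v i j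
  proof (cases "j > 2")
    case True
    then show ?thesis using complex v by (auto simp: three_term_complex_def)
  next
    case False
    then consider "i = 0" "j = 1" | "i = 0" "j = 2" | "i = 1" "j = 2" using v by linarith
    then show ?thesis
      using sum[of v "- v" 0] sum[of v 0 "- v"] sum[of 0 v "- v"] v 0 neg by cases auto
  qed
  then show "v = 0" if "v \<in> L i" "v \<in> L j" "i \<noteq> j" for v i j
    using that by (metis linorder_neq_iff)
qed

context three_term
begin

lemma above_2: "v \<in> L i \<Longrightarrow> 2 < i \<Longrightarrow> v = 0"
  using complex by (auto simp: three_term_complex_def)

lemma differential_linear: "linear_on (L i) d"
  and differential_mem: "v \<in> L (Suc i) \<Longrightarrow> d v \<in> L i"
  and differential_0: "v \<in> L 0 \<Longrightarrow> d v = 0"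
  using complex by (auto simp: three_term_complex_def image_subset_iff)

lemma differential_zero [simp]: "d 0 = 0"
  by (simp add: differential_0)

lemma vanishes_graded:
  "graded_map L n k \<mu> \<Longrightarrow> 2 \<le> m + k \<Longrightarrow> vanishes_above n m \<mu>"
  unfolding vanishes_above_def
  by (auto intro: graded_map_eq_0 above_2[OF graded_map_mem])

text \<open>The differential lowers the degree by one, so the bound is one higher than for
  \<open>\<mu>\<close> itself. Each summand either has a zero entry, as \<open>d\<close> kills
  degree 0 and preserves zero, or still lands above degree 2.\<close>

lemma vanishes_boundary:
  assumes \<mu>: "graded_map L n k \<mu>" and m: "3 \<le> m + k"
  shows "vanishes_above n m (boundary L d q \<mu>)"
  unfolding vanishes_above_def
proof (intro allI impI)
  fix ds vs assume vs: "homogeneous ds vs" "length vs = n" and *: "0 \<in> set vs \<or> m < sum_list ds"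
  have ds: "length ds = n" using vs homogeneous_length by auto
  have 1: "\<mu> vs = 0"
    using vanishes_graded[OF \<mu>, of m] m vs * by (auto simp: vanishes_above_def)
  have 2: "\<mu> (vs[i := d (vs ! i)]) = 0" if i: "i < n" for i
  proof (cases "ds ! i")
    case 0
    then have "d (vs ! i) = 0" using vs i homogeneous_nth[of ds vs i] differential_0 by auto
    moreover have "0 \<in> set (vs[i := 0])" using i vs by (simp add: set_update_memI)
    ultimately show ?thesis
      using vs by (auto intro!: graded_map_eq_0[OF \<mu>, of ds] homogeneous_update_same)
  next
    case (Suc j)
    have hom: "homogeneous (ds[i := j]) (vs[i := d (vs ! i)])"
      using vs i Suc homogeneous_nth[of ds vs i] by (auto intro!: homogeneous_update differential_mem)
    show ?thesis
    proof (cases "0 \<in> set vs")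
      case True
      then obtain l where l: "l < n" "vs ! l = 0" using vs by (auto simp: in_set_conv_nth)
      then have "vs[i := d (vs ! i)] ! l = 0" using i vs by (cases "l = i") auto
      then have "0 \<in> set (vs[i := d (vs ! i)])" using l vs by (metis length_list_update nth_mem)
      then show ?thesis using vs by (auto intro!: graded_map_eq_0[OF \<mu> hom])
    next
      case False
      have "sum_list (ds[i := j]) = sum_list ds - 1"
        using i ds Suc by (simp add: sum_list_update)
      moreover have "\<mu> (vs[i := d (vs ! i)]) \<in> L (sum_list (ds[i := j]) + k)"
        using vs by (intro graded_map_mem[OF \<mu> hom]) auto
      ultimately show ?thesis using False * m by (intro above_2) auto
    qed
  qed
  show "boundary L d q \<mu> vs = 0"
    using 1 2 vs by (simp add: boundary_def)
qed

end

section \<open>Maps supported on tuples with at most one positive degree\<close>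

lemma sum_fun_apply: "sum f A x = (\<Sum>i\<in>A. f i x)"
  for f :: "'i \<Rightarrow> 'a \<Rightarrow> 'b::comm_monoid_add"
  by (induction A rule: infinite_finite_induct) auto

definition sparse :: "nat list \<Rightarrow> bool" where
  "sparse ds \<longleftrightarrow> length (filter (\<lambda>d. 0 < d) ds) \<le> 1"

lemma sparse_permute_list1:
  "\<sigma> permutes {1..length ds} \<Longrightarrow> sparse (permute_list1 \<sigma> ds) = sparse ds"
  unfolding sparse_def by (metis mset_filter mset_permute_list1 size_mset)

text \<open>Of any two entries one has degree 0, so every factor of the sign is 1.\<close>

lemma koszul_sparse:
  assumes "sparse ds"
  shows "koszul \<sigma> ds = 1"
proof (rule koszul_eq_1)
  fix a b assume ab: "a < b" "b < length ds"
  show "even (ds ! a * ds ! b)"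
  proof (rule ccontr)
    assume "odd (ds ! a * ds ! b)"
    then have "{a, b} \<subseteq> {i. i < length ds \<and> 0 < ds ! i}"
      using ab by (auto intro: Nat.gr0I)
    then have "card {a, b} \<le> length (filter (\<lambda>d. 0 < d) ds)"
      unfolding length_filter_conv_card by (intro card_mono) auto
    then show False using assms ab by (simp add: sparse_def)
  qed
qed

context graded_space
begin

text \<open>The condition under which \<open>perm\<close> is mere rearrangement: sparse tuples have
  Koszul sign 1, and on all others the value is 0.\<close>

definition sparse_map :: "nat \<Rightarrow> ('v list \<Rightarrow> 'v) \<Rightarrow> bool" where
  "sparse_map n \<mu> \<longleftrightarrow> (\<forall>ds vs. homogeneous ds vs \<longrightarrow> length vs = n \<longrightarrow> \<not> sparse ds \<longrightarrow> \<mu> vs = 0)"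

lemma perm_sparse_map:
  assumes "graded_map L n k \<mu>" "sparse_map n \<mu>" "\<sigma> permutes {1..n}" "homogeneous ds vs" "length vs = n"
  shows "perm L \<mu> \<sigma> vs = \<mu> (permute_list1 \<sigma> vs)"
proof (cases "sparse ds")
  case True
  then show ?thesis using assms by (simp add: perm_homogeneous koszul_sparse)
next
  case False
  have ds: "length ds = n" using assms homogeneous_length by auto
  have "\<mu> (permute_list1 \<sigma> vs) = 0"
    using assms(2) homogeneous_permute[of ds vs \<sigma>] assms(3-) False ds
    by (auto simp: sparse_map_def sparse_permute_list1)
  then show ?thesis by (simp add: perm_eq)
qed

lemma alternating_sum_sparse_map:
  assumes "graded_map L n k \<mu>" "sparse_map n \<mu>" "homogeneous ds vs" "length vs = n"
  shows "alternating_sum L n \<mu> vs =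
    (\<Sum>\<sigma> | \<sigma> permutes {1..n}. of_int (sign \<sigma>) *\<^sub>R \<mu> (permute_list1 \<sigma> vs))"
proof -
  show ?thesis
    unfolding alternating_sum_def sum_fun_apply
    using perm_sparse_map[OF assms(1,2) _ assms(3,4)] by (intro sum.cong) auto
qed

lemma sparse_map_alternating_sum:
  assumes "graded_map L n k \<mu>" "sparse_map n \<mu>"
  shows "sparse_map n (alternating_sum L n \<mu>)"
  unfolding sparse_map_def
proof (intro allI impI)
  fix ds vs assume vs: "homogeneous ds vs" "length vs = n" "\<not> sparse ds"
  have "\<mu> (permute_list1 \<sigma> vs) = 0" if "\<sigma> permutes {1..n}" for \<sigma>
    using assms(2) homogeneous_permute[of ds vs \<sigma>] that vs homogeneous_length[OF vs(1)]
    by (auto simp: sparse_map_def sparse_permute_list1)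
  then show "alternating_sum L n \<mu> vs = 0"
    using alternating_sum_sparse_map[OF assms vs(1,2)] by simp
qed

text \<open>Rearranging by \<tau> first permutes the summands, \<sigma> becoming \<sigma> \<circ>
  \<tau>, and changes each sign by that of \<tau>. Sparseness keeps Koszul signs out of the
  reindexing.\<close>

lemma skew_symmetric_alternating_sum:
  assumes "graded_map L n k \<mu>" "sparse_map n \<mu>"
  shows "skew_symmetric L n (alternating_sum L n \<mu>)"
  unfolding skew_symmetric_def map_eq_def
proof (intro allI impI ballI)
  fix \<tau> vs assume \<tau>: "\<tau> permutes {1..n}" and "vs \<in> homogeneous_tuples L n"
  then obtain ds where vs: "homogeneous ds vs" "length vs = n"
    by (auto simp: homogeneous_tuples_iff)
  have ds: "length ds = n" using vs homogeneous_length by auto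
  let ?f = "\<lambda>\<sigma>. of_int (sign \<sigma>) *\<^sub>R \<mu> (permute_list1 \<sigma> vs)"
  have "perm L (alternating_sum L n \<mu>) \<tau> vs = alternating_sum L n \<mu> (permute_list1 \<tau> vs)"
    using assms \<tau> vs
    by (intro perm_sparse_map[of n k]) (auto intro: graded_map_alternating_sum sparse_map_alternating_sum)
  also have "\<dots> = (\<Sum>\<sigma> | \<sigma> permutes {1..n}.
      of_int (sign \<sigma>) *\<^sub>R \<mu> (permute_list1 \<sigma> (permute_list1 \<tau> vs)))"
    using \<tau> vs by (intro alternating_sum_sparse_map[OF assms homogeneous_permute]) auto
  also have "\<dots> = (\<Sum>\<sigma> | \<sigma> permutes {1..n}. of_int (sign \<tau>) *\<^sub>R ?f (\<sigma> \<circ> \<tau>))"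
  proof (rule sum.cong, goal_cases)
    case (2 \<sigma>)
    then have \<sigma>: "\<sigma> permutes {1..n}" by simp
    have "sign (\<sigma> \<circ> \<tau>) = sign \<sigma> * sign \<tau>"
      using \<sigma> \<tau> by (intro sign_compose) (auto simp: permutation_permutes)
    then have "of_int (sign \<tau>) * of_int (sign (\<sigma> \<circ> \<tau>)) = (of_int (sign \<sigma>) :: real)"
      by (simp add: sign_def)
    then show ?case using \<sigma> \<tau> vs by (simp add: permute_list1_compose)
  qed simp
  also have "\<dots> = of_int (sign \<tau>) *\<^sub>R (\<Sum>\<sigma> | \<sigma> permutes {1..n}. ?f (\<sigma> \<circ> \<tau>))"
    by (simp add: scaleR_sum_right)
  also have "(\<Sum>\<sigma> | \<sigma> permutes {1..n}. ?f (\<sigma> \<circ> \<tau>)) = (\<Sum>\<sigma> | \<sigma> permutes {1..n}. ?f \<sigma>)"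
    by (rule sum_permutations_compose_right[OF \<tau>, symmetric])
  also have "\<dots> = alternating_sum L n \<mu> vs"
    using alternating_sum_sparse_map[OF assms vs] by simp
  finally show "perm L (alternating_sum L n \<mu>) \<tau> vs = (of_int (sign \<tau>) *\<^sub>R alternating_sum L n \<mu>) vs"
    by simp
qed

text \<open>All n! signed summands coincide. In this way the 24 terms of \<open>b4\<close> never
  have to be written out.\<close>

lemma alternating_sum_skew_symmetric:
  assumes "skew_symmetric L n \<mu>" "homogeneous ds vs" "length vs = n"
  shows "alternating_sum L n \<mu> vs = fact n *\<^sub>R \<mu> vs"
proof -
  have "of_int (sign \<sigma>) *\<^sub>R perm L \<mu> \<sigma> vs = \<mu> vs" if "\<sigma> permutes {1..n}" for \<sigma>
  proof -
    have "perm L \<mu> \<sigma> vs = of_int (sign \<sigma>) *\<^sub>R \<mu> vs"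
      using assms that map_eqD[of "perm L \<mu> \<sigma>" n "of_int (sign \<sigma>) *\<^sub>R \<mu>"]
      by (simp add: skew_symmetric_def)
    then show ?thesis by (simp add: sign_def)
  qed
  then have "alternating_sum L n \<mu> vs = (\<Sum>\<sigma> | \<sigma> permutes {1..n}. \<mu> vs)"
    unfolding alternating_sum_def sum_fun_apply by (intro sum.cong) auto
  also have "\<dots> = fact n *\<^sub>R \<mu> vs"
    using card_permutations[of "{1..n}" n] by (simp add: sum_constant_scaleR)
  finally show ?thesis .
qed

text \<open>Transpositions generate the symmetric group, and in the absence of Koszul signs the sign
  rule is multiplicative along such a factorization.\<close>

lemma skew_symmetricI_transpose:
  assumes \<mu>: "graded_map L n k \<mu>" "sparse_map n \<mu>"
    and swap: "\<And>a b ds vs. 1 \<le> a \<Longrightarrow> a < b \<Longrightarrow> b \<le> n \<Longrightarrow> homogeneous ds vs \<Longrightarrow> length vs = n \<Longrightarrow>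
      \<mu> (permute_list1 (Transposition.transpose a b) vs) = - \<mu> vs"
  shows "skew_symmetric L n \<mu>"
  unfolding skew_symmetric_def map_eq_def
proof (intro allI impI ballI)
  fix \<sigma> vs assume \<sigma>: "\<sigma> permutes {1..n}" and "vs \<in> homogeneous_tuples L n"
  then obtain ds where vs: "homogeneous ds vs" "length vs = n"
    by (auto simp: homogeneous_tuples_iff)
  have "\<mu> (permute_list1 \<sigma> vs) = of_int (sign \<sigma>) *\<^sub>R \<mu> vs"
    using \<sigma> finite_atLeastAtMost
  proof (induction rule: permutes_induct)
    case id
    have "permute_list1 id vs = vs"
      by (rule nth_equalityI) (auto simp: nth_permute_list1)
    then show ?case by (simp add: id_def)
  next
    case (swap a b p)
    have ab: "Transposition.transpose a b permutes {1..n}"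
      using swap by (simp add: permutes_swap_id)
    have "\<mu> (permute_list1 (Transposition.transpose a b) (permute_list1 p vs)) = - \<mu> (permute_list1 p vs)"
    proof (cases "a < b")
      case True
      then show ?thesis
        using swap vs by (intro assms(3)[OF _ _ _ homogeneous_permute[OF vs(1)]]) auto
    next
      case False
      then have "\<mu> (permute_list1 (Transposition.transpose b a) (permute_list1 p vs)) = - \<mu> (permute_list1 p vs)"
        using swap vs by (intro assms(3)[OF _ _ _ homogeneous_permute[OF vs(1)]]) auto
      then show ?thesis by (simp add: transpose_commute)
    qed
    then have "\<mu> (permute_list1 (Transposition.transpose a b \<circ> p) vs) = - \<mu> (permute_list1 p vs)"
      using swap ab vs by (simp add: permute_list1_compose)
    moreover have "sign (Transposition.transpose a b \<circ> p) = - sign p"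
      using swap ab by (subst sign_compose) (auto simp: permutation_permutes sign_swap_id)
    ultimately show ?case using swap.IH by (simp only: of_int_minus scaleR_minus_left)
  qed
  then show "perm L \<mu> \<sigma> vs = (of_int (sign \<sigma>) *\<^sub>R \<mu>) vs"
    using perm_sparse_map[OF \<mu> \<sigma> vs] by simp
qed

end

section \<open>Evaluation of the permutations that occur in the identities\<close>

lemma inv_transpose_comp: "bij f \<Longrightarrow> inv (Transposition.transpose a b \<circ> f) = inv f \<circ> Transposition.transpose a b"
  by (simp add: o_inv_distrib)

lemma bij_cycle_of_list [simp]: "bij (cyc cs)"
  using permutation_of_cycle permutation_bijective by blast

lemma inv_cyc [simp]: "inv (cyc (i # j # cs)) = inv (cyc (j # cs)) \<circ> Transposition.transpose i j" "inv (cyc [i]) = id"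
  by (simp_all add: inv_transpose_comp inv_id)

lemma permute_list1_simps:
  "permute_list1 \<sigma> [v1, v2] = map (\<lambda>i. [v1, v2] ! (inv \<sigma> i - 1)) [1, 2]"
  "permute_list1 \<sigma> [v1, v2, v3] = map (\<lambda>i. [v1, v2, v3] ! (inv \<sigma> i - 1)) [1, 2, 3]"
  "permute_list1 \<sigma> [v1, v2, v3, v4] = map (\<lambda>i. [v1, v2, v3, v4] ! (inv \<sigma> i - 1)) [1, 2, 3, 4]"
  "permute_list1 \<sigma> [v1, v2, v3, v4, v5] = map (\<lambda>i. [v1, v2, v3, v4, v5] ! (inv \<sigma> i - 1)) [1, 2, 3, 4, 5]"
  by (simp_all add: permute_list1_def upt_rec numeral_eq_Suc)

text \<open>The table also confirms the convention for cycles: (123) takes the first entry to the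
  second place, the second to the third and the third to the first.\<close>

lemma permute_list1_cyc:
  "permute_list1 (cyc [1,2]) [v1, v2] = [v2, v1]"
  "permute_list1 (cyc [1,2]) [v1, v2, v3] = [v2, v1, v3]"
  "permute_list1 (cyc [2,3]) [v1, v2, v3] = [v1, v3, v2]"
  "permute_list1 (cyc [1,2,3]) [v1, v2, v3] = [v3, v1, v2]"
  "permute_list1 (cyc [1,3,2]) [v1, v2, v3] = [v2, v3, v1]"
  "permute_list1 (cyc [1,2]) [v1, v2, v3, v4] = [v2, v1, v3, v4]"
  "permute_list1 (cyc [2,3]) [v1, v2, v3, v4] = [v1, v3, v2, v4]"
  "permute_list1 (cyc [3,4]) [v1, v2, v3, v4] = [v1, v2, v4, v3]"
  "permute_list1 (cyc [1,2,3]) [v1, v2, v3, v4] = [v3, v1, v2, v4]"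
  "permute_list1 (cyc [1,3,2]) [v1, v2, v3, v4] = [v2, v3, v1, v4]"
  "permute_list1 (cyc [1,2]) [v1, v2, v3, v4, v5] = [v2, v1, v3, v4, v5]"
  "permute_list1 (cyc [2,3]) [v1, v2, v3, v4, v5] = [v1, v3, v2, v4, v5]"
  "permute_list1 (cyc [3,4]) [v1, v2, v3, v4, v5] = [v1, v2, v4, v3, v5]"
  "permute_list1 (cyc [1,2,3]) [v1, v2, v3, v4, v5] = [v3, v1, v2, v4, v5]"
  "permute_list1 (cyc [1,3,2]) [v1, v2, v3, v4, v5] = [v2, v3, v1, v4, v5]"
  "permute_list1 (cyc [2,3,4]) [v1, v2, v3, v4, v5] = [v1, v4, v2, v3, v5]"
  "permute_list1 (cyc [2,4,3]) [v1, v2, v3, v4, v5] = [v1, v3, v4, v2, v5]"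
  "permute_list1 (cyc [1,2,3,4]) [v1, v2, v3, v4, v5] = [v4, v1, v2, v3, v5]"
  "permute_list1 (cyc [1,3,4,2]) [v1, v2, v3, v4, v5] = [v2, v4, v1, v3, v5]"
  "permute_list1 (cyc [1,4,3,2]) [v1, v2, v3, v4, v5] = [v2, v3, v4, v1, v5]"
  "permute_list1 (cyc [1,3] \<circ> cyc [2,4]) [v1, v2, v3, v4, v5] = [v3, v4, v1, v2, v5]"
  by (simp_all add: permute_list1_simps inv_transpose_comp o_inv_distrib Transposition.transpose_def del: cycle_of_list.simps)

lemma sum_permutations_2:
  "(\<Sum>\<sigma> | \<sigma> permutes {1..2::nat}. of_int (sign \<sigma>) *\<^sub>R f (permute_list1 \<sigma> [u, v])) =
     f [u, v] - (f [v, u] :: 'a::real_vector)"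
proof -
  have *: "{1..2} = insert 1 {2::nat}" by auto
  show ?thesis
    unfolding * by (subst sum_over_permutations_insert)
      (simp_all add: permute_list1_simps sign_swap_id inv_id)
qed

lemma sum_permutations_3:
  "(\<Sum>\<sigma> | \<sigma> permutes {1..3::nat}. of_int (sign \<sigma>) *\<^sub>R f (permute_list1 \<sigma> [u, v, w])) =
     f [u, v, w] - f [v, u, w] - f [u, w, v] - f [w, v, u] + f [v, w, u] + (f [w, u, v] :: 'a::real_vector)"
proof -
  have *: "{1..3} = insert 1 (insert 2 {3::nat})" by auto
  show ?thesis
    unfolding * by (subst sum_over_permutations_insert, simp, simp)+
      (simp add: permute_list1_simps sign_swap_id sign_compose permutation_swap_id inv_id inv_transpose_comp
        Transposition.transpose_def)
qed

section \<open>Calculus in a CLWX 2-algebroid\<close>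

lemma linear_on_diff:
  "linear_on V f \<Longrightarrow> subspace V \<Longrightarrow> x \<in> V \<Longrightarrow> y \<in> V \<Longrightarrow> f (x - y) = f x - f y"
  using linear_on_add[of V f x "- y"] linear_on_scale[of V f y "-1"] by (simp add: subspace_neg)

lemma linear_on_neg: "linear_on V f \<Longrightarrow> x \<in> V \<Longrightarrow> f (- x) = - f x"
  using linear_on_scale[of V f x "-1"] by simp

lemmas linear_on_rules = linear_on_add linear_on_scale linear_on_neg

lemma subspace_direct_sum:
  assumes "subspace V" "subspace W"
  shows "subspace (direct_sum V W)"
  unfolding direct_sum_def by (rule subspace_sums[OF assms])

section \<open>The algebroid axioms and the calculus of D, \<rho> and S\<close>

locale clwx =
  fixes M :: "'m::{t2_space, second_countable_topology} manifold"
    and E0 E1 :: "('m, 'e::real_vector) vbundle"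
    and del :: "'m \<Rightarrow> 'e \<Rightarrow> 'e"
    and rho :: "'m \<Rightarrow> 'e \<Rightarrow> ('m \<Rightarrow> real) \<Rightarrow> real"
    and circ :: "('m \<Rightarrow> 'e) \<Rightarrow> ('m \<Rightarrow> 'e) \<Rightarrow> 'm \<Rightarrow> 'e"
    and Om :: "('m \<Rightarrow> 'e) \<Rightarrow> ('m \<Rightarrow> 'e) \<Rightarrow> ('m \<Rightarrow> 'e) \<Rightarrow> 'm \<Rightarrow> 'e"
    and S :: "('m \<Rightarrow> 'e) \<Rightarrow> ('m \<Rightarrow> 'e) \<Rightarrow> 'm \<Rightarrow> real"
    and D :: "('m \<Rightarrow> real) \<Rightarrow> 'm \<Rightarrow> 'e"
  assumes clwx: "clwx_2_algebroid M E0 E1 del rho circ Om S D"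
begin

abbreviation V0 where "V0 \<equiv> sections M E0"
abbreviation V1 where "V1 \<equiv> sections M E1"
abbreviation V where "V \<equiv> total_sections M E0 E1"
abbreviation F where "F \<equiv> C_infinity M"
abbreviation G where "G \<equiv> graded_sections M E0 E1"
abbreviation \<delta> where "\<delta> \<equiv> bundle_diff del"
abbreviation \<rho> where "\<rho> \<equiv> anchor_act rho"
definition smul :: "('m \<Rightarrow> real) \<Rightarrow> ('m \<Rightarrow> 'e) \<Rightarrow> 'm \<Rightarrow> 'e" where
  "smul g x = (\<lambda>p. g p *\<^sub>R x p)"

lemmas axioms = clwx[unfolded clwx_2_algebroid_def Let_def]

lemma manifold: "smooth_manifold M"
  and dg: "dg_bundle M E0 E1 del"
  and anchor: "dg_anchor M E0 E1 del rho"
  and circ_linear: "x \<in> V \<Longrightarrow> linear_on V (circ x)" "x \<in> V \<Longrightarrow> linear_on V (\<lambda>y. circ y x)"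
  and circ_graded: "graded_map G 2 0 (\<lambda>vs. circ (vs ! 0) (vs ! 1))"
  and circ_skew: "x \<in> V0 \<Longrightarrow> y \<in> V0 \<Longrightarrow> circ x y = - circ y x"
  and Om_C_linear: "x \<in> V \<Longrightarrow> y \<in> V \<Longrightarrow> C_infinity_linear_on M V (\<lambda>z. Om z x y)"
    "x \<in> V \<Longrightarrow> y \<in> V \<Longrightarrow> C_infinity_linear_on M V (\<lambda>z. Om x z y)"
    "x \<in> V \<Longrightarrow> y \<in> V \<Longrightarrow> C_infinity_linear_on M V (Om x y)"
  and Om_graded: "graded_map G 3 1 (\<lambda>vs. Om (vs ! 0) (vs ! 1) (vs ! 2))"
  and Om_skew_symmetric: "skew_symmetric G 3 (\<lambda>vs. Om (vs ! 0) (vs ! 1) (vs ! 2))"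
  and form: "nondegenerate_form M V S"
  and D_op: "is_D_operator M E0 E1 rho S D"
  and S_00: "x \<in> V0 \<Longrightarrow> y \<in> V0 \<Longrightarrow> S x y = 0"
  and S_11: "a \<in> V1 \<Longrightarrow> b \<in> V1 \<Longrightarrow> S a b = 0"
  and leibniz: "leibniz_2_algebra G \<delta> (\<lambda>vs. circ (vs ! 0) (vs ! 1)) (\<lambda>vs. Om (vs ! 0) (vs ! 1) (vs ! 2))"
  and circ_square: "e \<in> V \<Longrightarrow> circ e e = (1/2) *\<^sub>R D (S e e)"
  and S_\<delta>: "e1 \<in> V \<Longrightarrow> e2 \<in> V \<Longrightarrow> S (\<delta> e1) e2 = S e1 (\<delta> e2)"
  and \<rho>_S: "e1 \<in> V \<Longrightarrow> e2 \<in> V \<Longrightarrow> e3 \<in> V \<Longrightarrow> \<rho> e1 (S e2 e3) = S (circ e1 e2) e3 + S e2 (circ e1 e3)"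
  and S_Om: "e1 \<in> V \<Longrightarrow> e2 \<in> V \<Longrightarrow> e3 \<in> V \<Longrightarrow> e4 \<in> V \<Longrightarrow> S (Om e1 e2 e3) e4 = - S e3 (Om e1 e2 e4)"
  by (insert axioms, blast+)

sublocale G: three_term G \<delta>
  by standard (use leibniz in \<open>auto simp: leibniz_2_algebra_def leibniz_3_algebra_def\<close>)

lemma G_simps: "G 0 = V0" "G 1 = V1" "G (Suc 0) = V1" "2 \<le> i \<Longrightarrow> G i = {0}"
  by (auto simp: graded_sections_def)

lemma subspaces: "subspace V0" "subspace V1" "subspace F" "subspace V"
  using G.subspace[of 0] G.subspace[of 1] subspace_C_infinity[OF manifold]
  by (auto simp: G_simps total_sections_def intro: subspace_direct_sum)

lemma V01 [simp]: "x \<in> V0 \<Longrightarrow> x \<in> V" "a \<in> V1 \<Longrightarrow> a \<in> V"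
proof -
  have "x = x + 0" "a = 0 + a" "0 \<in> V0" "0 \<in> V1"
    using subspaces by (auto intro: subspace_0)
  then show "x \<in> V0 \<Longrightarrow> x \<in> V" "a \<in> V1 \<Longrightarrow> a \<in> V"
    unfolding total_sections_def direct_sum_def by blast+
qed

lemma V_cases: "x \<in> V \<Longrightarrow> (\<And>u v. u \<in> V0 \<Longrightarrow> v \<in> V1 \<Longrightarrow> x = u + v \<Longrightarrow> thesis) \<Longrightarrow> thesis"
  unfolding total_sections_def direct_sum_def by blast

lemmas closed [simp] =
  subspaces[THEN subspace_0] subspaces[THEN subspace_add] subspaces[THEN subspace_diff]
  subspaces[THEN subspace_neg] subspaces[THEN subspace_scale] subspaces

lemma circ_mem [simp]: "x \<in> V0 \<Longrightarrow> y \<in> V0 \<Longrightarrow> circ x y \<in> V0"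
  "x \<in> V0 \<Longrightarrow> a \<in> V1 \<Longrightarrow> circ x a \<in> V1" "x \<in> V0 \<Longrightarrow> a \<in> V1 \<Longrightarrow> circ a x \<in> V1"
  and circ_11 [simp]: "a \<in> V1 \<Longrightarrow> b \<in> V1 \<Longrightarrow> circ a b = 0"
  using G.graded_map_mem[OF circ_graded, of "[0,0]" "[x,y]"]
    G.graded_map_mem[OF circ_graded, of "[0,1]" "[x,a]"]
    G.graded_map_mem[OF circ_graded, of "[1,0]" "[a,x]"]
    G.graded_map_mem[OF circ_graded, of "[1,1]" "[a,b]"]
  by (simp_all add: G_simps)

lemma Om_mem [simp]: "x \<in> V0 \<Longrightarrow> y \<in> V0 \<Longrightarrow> z \<in> V0 \<Longrightarrow> Om x y z \<in> V1"
  and Om_1 [simp]: "a \<in> V1 \<Longrightarrow> y \<in> V0 \<Longrightarrow> z \<in> V0 \<Longrightarrow> Om a y z = 0"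
    "a \<in> V1 \<Longrightarrow> y \<in> V0 \<Longrightarrow> z \<in> V0 \<Longrightarrow> Om y a z = 0"
    "a \<in> V1 \<Longrightarrow> y \<in> V0 \<Longrightarrow> z \<in> V0 \<Longrightarrow> Om y z a = 0"
  using G.graded_map_mem[OF Om_graded, of "[0,0,0]" "[x,y,z]"]
    G.graded_map_mem[OF Om_graded, of "[1,0,0]" "[a,y,z]"]
    G.graded_map_mem[OF Om_graded, of "[0,1,0]" "[y,a,z]"]
    G.graded_map_mem[OF Om_graded, of "[0,0,1]" "[y,z,a]"]
  by (simp_all add: G_simps)

lemma \<delta>_mem [simp]: "a \<in> V1 \<Longrightarrow> \<delta> a \<in> V0" and \<delta>_0 [simp]: "x \<in> V0 \<Longrightarrow> \<delta> x = 0"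
  using G.differential_mem[of a 0] G.differential_0[of x] by (simp_all add: G_simps)

lemma D_mem [simp]: "f \<in> F \<Longrightarrow> D f \<in> V1"
  and S_D: "f \<in> F \<Longrightarrow> x \<in> V \<Longrightarrow> S x (D f) = \<rho> x f"
  using D_op by (auto simp: is_D_operator_def)

lemma S_mem [simp]: "x \<in> V \<Longrightarrow> y \<in> V \<Longrightarrow> S x y \<in> F"
  and S_sym: "x \<in> V \<Longrightarrow> y \<in> V \<Longrightarrow> S x y = S y x"
  and S_C_linear: "x \<in> V \<Longrightarrow> C_infinity_linear_on M V (S x)"
  and nondegenerate: "x \<in> V \<Longrightarrow> (\<forall>y\<in>V. S x y p = 0) \<Longrightarrow> x p = 0"
  using form by (auto simp: nondegenerate_form_def)

text \<open>Real scalars act as constant functions, which are smooth.\<close>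

lemma C_linear_imp_linear: "C_infinity_linear_on M W \<Phi> \<Longrightarrow> linear_on W \<Phi>"
  unfolding C_infinity_linear_on_def linear_on_def
  using C_infinity_const[of _ M] by (auto simp: scaleR_fun_def)

lemma S_linear: "x \<in> V \<Longrightarrow> linear_on V (S x)" "x \<in> V \<Longrightarrow> linear_on V (\<lambda>y. S y x)"
proof -
  show 1: "linear_on V (S x)" if "x \<in> V" for x
    using that by (intro C_linear_imp_linear S_C_linear)
  show "x \<in> V \<Longrightarrow> linear_on V (\<lambda>y. S y x)"
    by (rule linear_on_cong[OF 1[of x]]) (rule S_sym | simp)+
qed

lemma Om_linear: "x \<in> V \<Longrightarrow> y \<in> V \<Longrightarrow> linear_on V (\<lambda>z. Om z x y)"
  "x \<in> V \<Longrightarrow> y \<in> V \<Longrightarrow> linear_on V (\<lambda>z. Om x z y)" "x \<in> V \<Longrightarrow> y \<in> V \<Longrightarrow> linear_on V (Om x y)"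
  by (rule C_linear_imp_linear, rule Om_C_linear; assumption)+

lemma S_smul: "x \<in> V \<Longrightarrow> y \<in> V \<Longrightarrow> g \<in> F \<Longrightarrow> S x (smul g y) = g * S x y"
proof -
  assume "x \<in> V" "y \<in> V" "g \<in> F"
  then have "S x (\<lambda>p. g p *\<^sub>R y p) = (\<lambda>p. g p *\<^sub>R S x y p)"
    using S_C_linear[of x] unfolding C_infinity_linear_on_def by blast
  then show ?thesis by (simp add: smul_def times_fun_def)
qed

lemma smul_mem [simp]: "g \<in> F \<Longrightarrow> a \<in> V1 \<Longrightarrow> smul g a \<in> V1"
proof -
  assume "g \<in> F" "a \<in> V1"
  moreover have "vector_bundle M E1" using dg unfolding dg_bundle_def by blast
  ultimately show ?thesis unfolding smul_def by (intro sections_smooth_scale manifold)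
qed

lemma \<delta>_linear: "linear_on V1 \<delta>"
  using G.differential_linear[of 1] by (simp add: G_simps)

text \<open>The pairing of \<open>E\<^sub>0\<close> with \<open>E\<^sub>1\<close> has its own name, so that rewriting with the symmetry of \<open>S\<close>
  does not loop.\<close>

definition P :: "('m \<Rightarrow> 'e) \<Rightarrow> ('m \<Rightarrow> 'e) \<Rightarrow> 'm \<Rightarrow> real" where
  "P x a = S x a"

lemma S_01 [simp]: "x \<in> V0 \<Longrightarrow> a \<in> V1 \<Longrightarrow> S x a = P x a"
  and S_10 [simp]: "x \<in> V0 \<Longrightarrow> a \<in> V1 \<Longrightarrow> S a x = P x a"
  using S_sym[of a x] by (simp_all add: P_def)

lemma P_mem [simp]: "x \<in> V0 \<Longrightarrow> a \<in> V1 \<Longrightarrow> P x a \<in> F"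
  using S_mem[of x a] by simp

lemma P_linear_rules [simp]:
  "x \<in> V0 \<Longrightarrow> a \<in> V1 \<Longrightarrow> b \<in> V1 \<Longrightarrow> P x (a + b) = P x a + P x b"
  "x \<in> V0 \<Longrightarrow> a \<in> V1 \<Longrightarrow> b \<in> V1 \<Longrightarrow> P x (a - b) = P x a - P x b"
  "x \<in> V0 \<Longrightarrow> a \<in> V1 \<Longrightarrow> P x (- a) = - P x a"
  "x \<in> V0 \<Longrightarrow> a \<in> V1 \<Longrightarrow> P x (c *\<^sub>R a) = c *\<^sub>R P x a"
  "x \<in> V0 \<Longrightarrow> P x 0 = 0"
  "a \<in> V1 \<Longrightarrow> x \<in> V0 \<Longrightarrow> y \<in> V0 \<Longrightarrow> P (x + y) a = P x a + P y a"
  "a \<in> V1 \<Longrightarrow> x \<in> V0 \<Longrightarrow> y \<in> V0 \<Longrightarrow> P (x - y) a = P x a - P y a"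
  "a \<in> V1 \<Longrightarrow> x \<in> V0 \<Longrightarrow> P (- x) a = - P x a"
  "a \<in> V1 \<Longrightarrow> x \<in> V0 \<Longrightarrow> P (c *\<^sub>R x) a = c *\<^sub>R P x a"
  "a \<in> V1 \<Longrightarrow> P 0 a = 0"
  unfolding P_def
  by (simp_all only: V01 linear_on_rules[OF S_linear(1)] linear_on_rules[OF S_linear(2)]
      linear_on_diff[OF S_linear(1)] linear_on_diff[OF S_linear(2)]
      linear_on_0[OF S_linear(1)] linear_on_0[OF S_linear(2)] closed)

text \<open>By isotropy the E1-part of a test section contributes nothing, so non-degeneracy of S on
  all of E reduces to tests with sections of E0. Linearity of D and the derivation rules below
  follow by this test.\<close>

lemma eq_by_P:
  assumes "a \<in> V1" "b \<in> V1" "\<And>x. x \<in> V0 \<Longrightarrow> P x a = P x b"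
  shows "a = b"
proof
  fix p
  have "S (a - b) y = 0" if y: "y \<in> V" for y
  proof -
    obtain u v where uv: "u \<in> V0" "v \<in> V1" "y = u + v" using y by (rule V_cases)
    have "S (a - b) (u + v) = S (a - b) u + S (a - b) v"
      using uv(1,2) assms(1,2) by (intro linear_on_add[OF S_linear(1)]) simp_all
    moreover have "S (a - b) v = 0"
      using uv(2) assms(1,2) by (intro S_11) simp_all
    ultimately show ?thesis using uv assms by simp
  qed
  then show "a p = b p"
    using nondegenerate[of "a - b" p] assms by simp
qed

lemma eq_0_by_P:
  assumes "x \<in> V0" "\<And>a. a \<in> V1 \<Longrightarrow> P x a = 0"
  shows "x = 0"
proof
  fix p
  have "S x y = 0" if y: "y \<in> V" for y
  proof -
    obtain u v where uv: "u \<in> V0" "v \<in> V1" "y = u + v" using y by (rule V_cases)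
    then show ?thesis
      using linear_on_add[OF S_linear(1), of x u v] assms by (simp add: S_00)
  qed
  then show "x p = 0 p"
    using nondegenerate[of x p] assms by simp
qed

text \<open>Smoothness is inherited from S, because \<rho>(x) f = S(x, Df).\<close>

lemma \<rho>_mem [simp]: "x \<in> V \<Longrightarrow> f \<in> F \<Longrightarrow> \<rho> x f \<in> F"
  using S_mem[of x "D f"] S_D[of f x] by simp

lemma \<rho>_1 [simp]: "a \<in> V1 \<Longrightarrow> f \<in> F \<Longrightarrow> \<rho> a f = 0"
  using S_D[of f a] by (simp add: S_11)

lemma \<rho>_\<delta> [simp]: "a \<in> V1 \<Longrightarrow> f \<in> F \<Longrightarrow> \<rho> (\<delta> a) f = 0"
  using anchor unfolding dg_anchor_def
  by (auto simp: anchor_act_def bundle_diff_def sections_def smooth_section_def)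

lemma \<rho>_tangent: "x \<in> V0 \<Longrightarrow> rho p (x p) \<in> tangent_space M p"
  using anchor
  by (auto simp: dg_anchor_def bundle_morphism_def tangent_bundle_def sections_def
      smooth_section_def image_subset_iff)

lemma \<rho>_linear_0: "x \<in> V0 \<Longrightarrow> linear_on F (\<rho> x)"
  using \<rho>_tangent[of x] by (auto simp: tangent_space_def linear_on_def anchor_act_def fun_eq_iff)

lemma \<rho>_mult: "x \<in> V0 \<Longrightarrow> f \<in> F \<Longrightarrow> g \<in> F \<Longrightarrow> \<rho> x (f * g) = \<rho> x f * g + f * \<rho> x g"
  using \<rho>_tangent[of x] by (auto simp: tangent_space_def anchor_act_def fun_eq_iff)

lemma \<rho>_linear_left: "f \<in> F \<Longrightarrow> linear_on V (\<lambda>x. \<rho> x f)"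
  by (rule linear_on_cong[OF S_linear(2)[of "D f"]]) (simp_all add: S_D)

lemma circ_linear_rules [simp]:
  "x \<in> V \<Longrightarrow> y \<in> V \<Longrightarrow> z \<in> V \<Longrightarrow> circ x (y + z) = circ x y + circ x z"
  "x \<in> V \<Longrightarrow> y \<in> V \<Longrightarrow> z \<in> V \<Longrightarrow> circ x (y - z) = circ x y - circ x z"
  "x \<in> V \<Longrightarrow> y \<in> V \<Longrightarrow> circ x (- y) = - circ x y"
  "x \<in> V \<Longrightarrow> y \<in> V \<Longrightarrow> circ x (c *\<^sub>R y) = c *\<^sub>R circ x y"
  "x \<in> V \<Longrightarrow> circ x 0 = 0"
  "x \<in> V \<Longrightarrow> y \<in> V \<Longrightarrow> z \<in> V \<Longrightarrow> circ (y + z) x = circ y x + circ z x"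
  "x \<in> V \<Longrightarrow> y \<in> V \<Longrightarrow> z \<in> V \<Longrightarrow> circ (y - z) x = circ y x - circ z x"
  "x \<in> V \<Longrightarrow> y \<in> V \<Longrightarrow> circ (- y) x = - circ y x"
  "x \<in> V \<Longrightarrow> y \<in> V \<Longrightarrow> circ (c *\<^sub>R y) x = c *\<^sub>R circ y x"
  "x \<in> V \<Longrightarrow> circ 0 x = 0"
  by (simp_all add: linear_on_rules[OF circ_linear(1)] linear_on_rules[OF circ_linear(2)]
      linear_on_diff[OF circ_linear(1)] linear_on_diff[OF circ_linear(2)]
      linear_on_0[OF circ_linear(1)] linear_on_0[OF circ_linear(2)])

lemma \<rho>_linear: "x \<in> V \<Longrightarrow> linear_on F (\<rho> x)"
  by (erule V_cases)
    (auto simp: linear_on_def linear_on_add[OF \<rho>_linear_left] linear_on_rules[OF \<rho>_linear_0])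

lemma \<rho>_linear_rules [simp]:
  "x \<in> V \<Longrightarrow> f \<in> F \<Longrightarrow> g \<in> F \<Longrightarrow> \<rho> x (f + g) = \<rho> x f + \<rho> x g"
  "x \<in> V \<Longrightarrow> f \<in> F \<Longrightarrow> g \<in> F \<Longrightarrow> \<rho> x (f - g) = \<rho> x f - \<rho> x g"
  "x \<in> V \<Longrightarrow> f \<in> F \<Longrightarrow> \<rho> x (- f) = - \<rho> x f"
  "x \<in> V \<Longrightarrow> f \<in> F \<Longrightarrow> \<rho> x (c *\<^sub>R f) = c *\<^sub>R \<rho> x f"
  "x \<in> V \<Longrightarrow> \<rho> x 0 = 0"
  "x \<in> V \<Longrightarrow> y \<in> V \<Longrightarrow> f \<in> F \<Longrightarrow> \<rho> (x + y) f = \<rho> x f + \<rho> y f"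
  "x \<in> V \<Longrightarrow> y \<in> V \<Longrightarrow> f \<in> F \<Longrightarrow> \<rho> (x - y) f = \<rho> x f - \<rho> y f"
  "x \<in> V \<Longrightarrow> f \<in> F \<Longrightarrow> \<rho> (- x) f = - \<rho> x f"
  "x \<in> V \<Longrightarrow> f \<in> F \<Longrightarrow> \<rho> (c *\<^sub>R x) f = c *\<^sub>R \<rho> x f"
  "f \<in> F \<Longrightarrow> \<rho> 0 f = 0"
  by (simp_all add: linear_on_rules[OF \<rho>_linear] linear_on_rules[OF \<rho>_linear_left]
      linear_on_diff[OF \<rho>_linear] linear_on_diff[OF \<rho>_linear_left]
      linear_on_0[OF \<rho>_linear] linear_on_0[OF \<rho>_linear_left])

lemma P_D [simp]: "f \<in> F \<Longrightarrow> x \<in> V0 \<Longrightarrow> P x (D f) = \<rho> x f"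
  using S_D[of f x] by simp

lemma D_linear: "linear_on F D"
  unfolding linear_on_def by (auto intro!: eq_by_P)

lemma D_\<delta>_linear_rules [simp]:
  "f \<in> F \<Longrightarrow> g \<in> F \<Longrightarrow> D (f + g) = D f + D g"
  "f \<in> F \<Longrightarrow> g \<in> F \<Longrightarrow> D (f - g) = D f - D g"
  "f \<in> F \<Longrightarrow> D (- f) = - D f"
  "f \<in> F \<Longrightarrow> D (c *\<^sub>R f) = c *\<^sub>R D f"
  "D 0 = 0"
  "a \<in> V1 \<Longrightarrow> b \<in> V1 \<Longrightarrow> \<delta> (a + b) = \<delta> a + \<delta> b"
  "a \<in> V1 \<Longrightarrow> b \<in> V1 \<Longrightarrow> \<delta> (a - b) = \<delta> a - \<delta> b"
  "a \<in> V1 \<Longrightarrow> \<delta> (- a) = - \<delta> a"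
  "a \<in> V1 \<Longrightarrow> \<delta> (c *\<^sub>R a) = c *\<^sub>R \<delta> a"
  by (simp_all add: linear_on_rules[OF D_linear] linear_on_rules[OF \<delta>_linear]
      linear_on_diff[OF D_linear] linear_on_diff[OF \<delta>_linear] linear_on_0[OF D_linear])

lemma P_\<delta>: "a \<in> V1 \<Longrightarrow> b \<in> V1 \<Longrightarrow> P (\<delta> a) b = P (\<delta> b) a"
  using S_\<delta>[of a b] by simp

lemma P_smul: "x \<in> V0 \<Longrightarrow> a \<in> V1 \<Longrightarrow> g \<in> F \<Longrightarrow> P x (smul g a) = g * P x a"
  using S_smul[of x a g] by simp

text \<open>Self-adjointness of \<delta> turns the pairing of \<delta>(Df) with a into that of
  \<delta> a with Df, which is \<rho>(\<delta> a) f; the anchor kills the image of \<delta>.\<close>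

lemma \<delta>_D [simp]: "f \<in> F \<Longrightarrow> \<delta> (D f) = 0"
  by (rule eq_0_by_P) (simp_all add: P_\<delta>[of "D f"])

lemma circ_00_self [simp]: "x \<in> V0 \<Longrightarrow> circ x x = 0"
  using circ_square[of x] by (simp add: S_00)

text \<open>Polarization of e \<circ> e = 1/2 D S(e, e) at e = x + a: the squares of x and of a
  vanish, and S(e, e) = 2 P(x, a) by isotropy.\<close>

lemma circ_10:
  assumes "x \<in> V0" "a \<in> V1"
  shows "circ a x = D (P x a) - circ x a"
proof -
  have "S (x + a) (x + a) = S x x + S a x + (S x a + S a a)"
    using assms by (simp only: V01 closed linear_on_add[OF S_linear(1)] linear_on_add[OF S_linear(2)])
  then have "S (x + a) (x + a) = 2 *\<^sub>R P x a"
    using assms by (simp add: S_00 S_11 scaleR_2)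
  then have "circ x a + circ a x = D (P x a)"
    using assms circ_square[of "x + a"] by (simp add: add.commute)
  then show ?thesis by (metis add_diff_cancel_left')
qed

text \<open>Invariance of S, solved so that as a rewrite rule it removes products from the second
  slot of the pairing.\<close>

lemma P_circ:
  assumes "x \<in> V0" "y \<in> V0" "a \<in> V1"
  shows "P y (circ x a) = \<rho> x (P y a) - P (circ x y) a"
  using \<rho>_S[of x y a] assms by simp

text \<open>Tested against sections of E0, the rule becomes the derivation property of \<rho>(x) on
  functions.\<close>

lemma circ_smul:
  assumes "g \<in> F" "x \<in> V0" "a \<in> V1"
  shows "circ x (smul g a) = smul g (circ x a) + smul (\<rho> x g) a"
  using assms by (intro eq_by_P) (simp_all add: P_circ P_smul \<rho>_mult algebra_simps)

lemma D_mult: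
  assumes "g \<in> F" "h \<in> F"
  shows "D (g * h) = smul g (D h) + smul h (D g)"
  using assms C_infinity_mult[OF manifold]
  by (intro eq_by_P) (simp_all add: P_smul \<rho>_mult algebra_simps)

end

lemmas permute_list1_cyc' = permute_list1_cyc[unfolded One_nat_def]

lemmas map_eval = boundary_def pcomp_def perm_eq permute_list1_cyc'
  koszul_sparse sparse_def sgn_deg_def lessThan_Suc

context clwx
begin

section \<open>The Leibniz identities on homogeneous sections\<close>

lemma leibniz_map_2: "map_eq G (boundary G \<delta> 0 (\<lambda>vs. circ (vs ! 0) (vs ! 1))) 2 0"
    and leibniz_map_3: "map_eq G (boundary G \<delta> 1 (\<lambda>vs. Om (vs ! 0) (vs ! 1) (vs ! 2))) 3
      (let C = \<lambda>vs. circ (vs ! 0) (vs ! 1) in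
        pcomp G C 2 (2, 0, C) - pcomp G C 1 (2, 0, C) - perm G (pcomp G C 2 (2, 0, C)) (cyc [1,2]))"
    and leibniz_map_4: "map_eq G (boundary G \<delta> 2 0) 4
      (let l2 = \<lambda>vs. circ (vs ! 0) (vs ! 1); l3 = \<lambda>vs. Om (vs ! 0) (vs ! 1) (vs ! 2);
         B2 = (2, 0, l2); B3 = (3, 1, l3) in
       pcomp G l2 1 B3 + pcomp G l2 2 B3 - perm G (pcomp G l2 2 B3) (cyc [1,2])
       + perm G (pcomp G l2 2 B3) (cyc [1,2,3]) - pcomp G l3 1 B2
       + pcomp G l3 2 B2 - perm G (pcomp G l3 2 B2) (cyc [1,2])
       - pcomp G l3 3 B2 + perm G (pcomp G l3 3 B2) (cyc [2,3]) - perm G (pcomp G l3 3 B2) (cyc [1,3,2]))"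
  unfolding Let_def by (insert leibniz[unfolded leibniz_2_algebra_def leibniz_3_algebra_def Let_def], blast+)

lemma G_degree_of: "x \<in> V0 \<Longrightarrow> degree_of G x = 0" "a \<in> V1 \<Longrightarrow> a \<noteq> 0 \<Longrightarrow> degree_of G a = 1"
  using G.degree_of_eq[of a 1] by (auto simp: G_simps degree_of_def intro!: Least_equality)

lemmas G_eval = map_eval G_degree_of G_simps Let_def

lemma \<delta>_circ [simp]: "x \<in> V0 \<Longrightarrow> a \<in> V1 \<Longrightarrow> \<delta> (circ x a) = circ x (\<delta> a)"
  using G.map_eqD[OF leibniz_map_2, of "[0,1]" "[x,a]"] by (simp add: G_eval)

lemma circ_\<delta>:
  assumes "a \<in> V1" "b \<in> V1"
  shows "circ (\<delta> a) b = circ a (\<delta> b)"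
\<comment> \<open>The sign in \<open>boundary\<close> on (a, b) is read off from
  \<open>degree_of G a\<close>, which is 1 only for nonzero a.\<close>
proof (cases "a = 0")
  case True
  then show ?thesis using assms \<delta>_linear by (simp add: linear_on_0)
next
  case False
  then show ?thesis
    using assms G.map_eqD[OF leibniz_map_2, of "[1,1]" "[a,b]"] by (simp add: G_eval)
qed

lemma leibniz_000:
  "x \<in> V0 \<Longrightarrow> y \<in> V0 \<Longrightarrow> z \<in> V0 \<Longrightarrow>
    circ x (circ y z) - circ (circ x y) z - circ y (circ x z) = \<delta> (Om x y z)"
  using G.map_eqD[OF leibniz_map_3, of "[0,0,0]" "[x,y,z]"]
  by (simp add: G_eval del: cycle_of_list.simps)

lemma leibniz_001:
  "x \<in> V0 \<Longrightarrow> y \<in> V0 \<Longrightarrow> a \<in> V1 \<Longrightarrow>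
    circ x (circ y a) - circ (circ x y) a - circ y (circ x a) = Om x y (\<delta> a)"
  using G.map_eqD[OF leibniz_map_3, of "[0,0,1]" "[x,y,a]"]
  by (simp add: G_eval del: cycle_of_list.simps)

lemma leibniz_010:
  "x \<in> V0 \<Longrightarrow> y \<in> V0 \<Longrightarrow> a \<in> V1 \<Longrightarrow>
    circ x (circ a y) - circ (circ x a) y - circ a (circ x y) = Om x (\<delta> a) y"
  using G.map_eqD[OF leibniz_map_3, of "[0,1,0]" "[x,a,y]"]
  by (simp add: G_eval del: cycle_of_list.simps)

lemma leibniz_100:
  "x \<in> V0 \<Longrightarrow> y \<in> V0 \<Longrightarrow> a \<in> V1 \<Longrightarrow>
    circ a (circ x y) - circ (circ a x) y - circ x (circ a y) = Om (\<delta> a) x y"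
  using G.map_eqD[OF leibniz_map_3, of "[1,0,0]" "[a,x,y]"]
  by (simp add: G_eval del: cycle_of_list.simps)

lemma Om_cocycle:
  "x \<in> V0 \<Longrightarrow> y \<in> V0 \<Longrightarrow> z \<in> V0 \<Longrightarrow> w \<in> V0 \<Longrightarrow>
    circ (Om x y z) w + circ x (Om y z w) - circ y (Om x z w) + circ z (Om x y w)
    - Om (circ x y) z w + Om x (circ y z) w - Om y (circ x z) w
    - Om x y (circ z w) + Om x z (circ y w) - Om y z (circ x w) = 0"
  using G.map_eqD[OF leibniz_map_4, of "[0,0,0,0]" "[x,y,z,w]"]
  by (simp add: G_eval del: cycle_of_list.simps)

lemma Om_skew:
  assumes "x \<in> V0" "y \<in> V0" "z \<in> V0"
  shows "Om y x z = - Om x y z" "Om x z y = - Om x y z"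
proof -
  have "perm G (\<lambda>vs. Om (vs ! 0) (vs ! 1) (vs ! 2)) (cyc [i, Suc i]) [x, y, z] = - Om x y z"
    if "i = 1 \<or> i = 2" for i
  proof -
    have "cyc [i, Suc i] permutes {1..3}"
      using that by (auto intro!: permutes_swap_id)
    then have "map_eq G (perm G (\<lambda>vs. Om (vs ! 0) (vs ! 1) (vs ! 2)) (cyc [i, Suc i])) 3
        (of_int (sign (cyc [i, Suc i])) *\<^sub>R (\<lambda>vs. Om (vs ! 0) (vs ! 1) (vs ! 2)))"
      using Om_skew_symmetric unfolding skew_symmetric_def by blast
    from G.map_eqD[OF this, of "[0,0,0]" "[x,y,z]"] show ?thesis
      using assms by (simp add: G_simps sign_swap_id)
  qed
  from this[of 1] this[of 2] show "Om y x z = - Om x y z" "Om x z y = - Om x y z"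
    using assms by (simp_all add: G_eval numeral_2_eq_2[symmetric] numeral_3_eq_3[symmetric]
        del: cycle_of_list.simps)
qed

text \<open>By \<open>circ_10\<close>, D P(z, a) is z \<circ> a + a \<circ> z. In the sum of the two
  Leibniz identities all iterated products cancel except those of z \<circ> a and a \<circ> z with
  x, and the values of \<Omega> cancel by skew symmetry.\<close>

lemma circ_D_pairing:
  assumes "x \<in> V0" "z \<in> V0" "a \<in> V1"
  shows "circ (D (P z a)) x = 0"
proof -
  have "circ (D (P z a)) x = circ (circ z a) x + circ (circ a z) x"
    using assms by (simp add: circ_10[of z a])
  also have "\<dots> = - (Om z (\<delta> a) x + Om (\<delta> a) z x)"
    using assms by (simp add: leibniz_010[symmetric] leibniz_100[symmetric] algebra_simps)
  also have "\<dots> = 0"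
    using Om_skew(1)[of z "\<delta> a" x] assms by simp
  finally show ?thesis .
qed

lemma circ_D_left [simp]:
  assumes x: "x \<in> V0" and f: "f \<in> F"
  shows "circ (D f) x = 0"
proof
  fix p
  define N where "N g = circ (D g) x" for g
  have N: "N g \<in> V1" "N g = D (\<rho> x g) - circ x (D g)" if "g \<in> F" for g
    using that x by (simp_all add: N_def circ_10)
  \<comment> \<open>The products of \<open>\<rho> x g\<close> with D h and of
    \<open>\<rho> x h\<close> with D g arise twice, from D of the Leibniz rule for
    \<open>\<rho> x\<close> and from \<open>circ_smul\<close>, and cancel.\<close>
  have N_mult: "N (g * h) = smul g (N h) + smul h (N g)" if gh: "g \<in> F" "h \<in> F" for g h
  proof -
    have "N (g * h) = D (\<rho> x g * h + g * \<rho> x h) - circ x (smul g (D h) + smul h (D g))"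
      using gh x C_infinity_mult[OF manifold] by (simp add: N \<rho>_mult D_mult)
    then show ?thesis
      using gh x C_infinity_mult[OF manifold]
      by (simp add: N D_mult circ_smul) (simp add: smul_def fun_eq_iff algebra_simps)
  qed
  have pairing: "N (P z b) = 0" if "z \<in> V0" "b \<in> V1" for z b
    using that x by (simp add: N_def circ_D_pairing)
  \<comment> \<open>Put h = P(z, N f). Then f h is again a pairing, namely of z with f N f, so N
    kills both h and f h, and the derivation rule leaves h N f = 0.\<close>
  have zero: "P z (N f) p *\<^sub>R N f p = 0" if z: "z \<in> V0" for z
  proof -
    let ?h = "P z (N f)"
    have h: "?h \<in> F" "N ?h = 0" using z N(1)[OF f] pairing by auto
    have "N (f * ?h) = N (P z (smul f (N f)))"
      using z f N(1)[OF f] by (simp add: P_smul)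
    moreover have "N (P z (smul f (N f))) = 0"
      using z f N(1)[OF f] by (intro pairing) simp_all
    ultimately have "smul f 0 p + smul ?h (N f) p = 0"
      using N_mult[OF f h(1)] h(2) by (metis plus_fun_apply zero_fun_apply)
    then show ?thesis by (simp add: smul_def)
  qed
  show "circ (D f) x p = 0 p"
  \<comment> \<open>The conclusion is drawn point by point: were N f nonzero at p, all its pairings
    would vanish at p, against the non-degeneracy of the form on the fibre.\<close>
  proof (cases "N f p = 0")
    case False
    then have P0: "P z (N f) p = 0" if "z \<in> V0" for z using zero[OF that] by simp
    have "S (N f) y p = 0" if y: "y \<in> V" for y
    proof -
      obtain u v where uv: "u \<in> V0" "v \<in> V1" "y = u + v" using y by (rule V_cases)
      have "S (N f) (u + v) = S (N f) u + S (N f) v"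
        using uv N f by (intro linear_on_add[OF S_linear(1)]) simp_all
      then show ?thesis using uv N f P0 by (simp add: S_11)
    qed
    then have "N f p = 0" using nondegenerate[of "N f" p] N f by simp
    then show ?thesis by (simp add: N_def)
  qed (simp add: N_def)
qed

lemma circ_D [simp]: "x \<in> V0 \<Longrightarrow> f \<in> F \<Longrightarrow> circ x (D f) = D (\<rho> x f)"
  using circ_10[of x "D f"] by simp

text \<open>Invariance is applied to the section Df. Since x \<circ> Df = D(\<rho>(x) f), its
  pairing with y is the composite of the two anchors in the opposite order.\<close>

lemma \<rho>_circ [simp]:
  assumes "x \<in> V0" "y \<in> V0" "f \<in> F"
  shows "\<rho> (circ x y) f = \<rho> x (\<rho> y f) - \<rho> y (\<rho> x f)"
  using P_circ[of x y "D f"] assms by (simp add: algebra_simps)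

end

section \<open>The complex and its structure maps\<close>

lemma sum_list_ge_2_if_not_sparse:
  fixes ds :: "nat list"
  assumes "\<not> sparse ds"
  shows "2 \<le> sum_list ds"
proof -
  have "length (filter (\<lambda>d. 0 < d) ds) \<le> sum_list ds"
    by (induction ds) auto
  then show ?thesis using assms by (simp add: sparse_def)
qed

context three_term
begin

text \<open>Two entries of positive degree push the value above degree 2 as soon as the map raises
  degrees. Maps of degree 0 require an argument of their own, as in
  \<open>sparse_l2\<close>.\<close>

lemma sparse_map_graded:
  assumes "graded_map L n k \<mu>" "1 \<le> k"
  shows "sparse_map n \<mu>"
  unfolding sparse_map_def
proof (intro allI impI)
  fix ds vs assume vs: "homogeneous ds vs" "length vs = n" "\<not> sparse ds"
  then show "\<mu> vs = 0"
    using graded_map_mem[OF assms(1) vs(1,2)] sum_list_ge_2_if_not_sparse[OF vs(3)] assms(2)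
    by (auto intro: above_2)
qed

end

context graded_space
begin

lemma homogeneous_Nil_right [simp]: "homogeneous ds [] \<longleftrightarrow> ds = []"
  by (simp add: homogeneous_def)

lemma graded_map_2I:
  assumes "\<And>i j u v. u \<in> L i \<Longrightarrow> v \<in> L j \<Longrightarrow> \<mu> [u, v] \<in> L (i + j + k)"
    and "\<And>i j v. v \<in> L j \<Longrightarrow> linear_on (L i) (\<lambda>u. \<mu> [u, v])"
    and "\<And>i j u. u \<in> L i \<Longrightarrow> linear_on (L j) (\<lambda>v. \<mu> [u, v])"
  shows "graded_map L 2 k \<mu>"
proof (rule graded_mapI)
  fix ds vs assume vs: "homogeneous ds vs" "length vs = 2"
  then obtain u v i j where *: "vs = [u, v]" "ds = [i, j]" "u \<in> L i" "v \<in> L j"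
    by (cases ds; cases vs; cases "tl ds"; cases "tl vs") auto
  show "\<mu> vs \<in> L (sum_list ds + k)"
    using assms(1)[of u i v j] * by (simp add: add.assoc)
  fix l :: nat assume "l < 2"
  then have "l = 0 \<or> l = 1" by auto
  then show "linear_on (L (ds ! l)) (\<lambda>u. \<mu> (vs[l := u]))"
    using assms(2,3) * by auto
qed

lemma graded_map_3I:
  assumes "\<And>i j l u v w. u \<in> L i \<Longrightarrow> v \<in> L j \<Longrightarrow> w \<in> L l \<Longrightarrow> \<mu> [u, v, w] \<in> L (i + j + l + k)"
    and "\<And>i j l v w. v \<in> L j \<Longrightarrow> w \<in> L l \<Longrightarrow> linear_on (L i) (\<lambda>u. \<mu> [u, v, w])"
    and "\<And>i j l u w. u \<in> L i \<Longrightarrow> w \<in> L l \<Longrightarrow> linear_on (L j) (\<lambda>v. \<mu> [u, v, w])"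
    and "\<And>i j l u v. u \<in> L i \<Longrightarrow> v \<in> L j \<Longrightarrow> linear_on (L l) (\<lambda>w. \<mu> [u, v, w])"
  shows "graded_map L 3 k \<mu>"
proof (rule graded_mapI)
  fix ds vs assume vs: "homogeneous ds vs" "length vs = 3"
  then obtain u v w i j l where *: "vs = [u, v, w]" "ds = [i, j, l]" "u \<in> L i" "v \<in> L j" "w \<in> L l"
    by (cases ds; cases vs; cases "tl ds"; cases "tl vs"; cases "tl (tl ds)"; cases "tl (tl vs)") auto
  show "\<mu> vs \<in> L (sum_list ds + k)"
    using assms(1)[of u i v j w l] * by (simp add: add.assoc)
  fix r :: nat assume "r < 3"
  then have "r = 0 \<or> r = 1 \<or> r = 2" by auto
  then show "linear_on (L (ds ! r)) (\<lambda>u. \<mu> (vs[r := u]))"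
    using assms(2-4) * by (auto simp: numeral_2_eq_2)
qed

end

context clwx
begin

section \<open>The complex on sections of E0, sections of E1 and functions\<close>

abbreviation L where "L \<equiv> clwx_space M E0 E1"
abbreviation d where "d \<equiv> clwx_diff del D"

lemma L_simps: "L 0 = V0 \<times> {0}" "L 1 = V1 \<times> {0}" "L (Suc 0) = V1 \<times> {0}" "L 2 = {0} \<times> F"
  "L (Suc (Suc 0)) = {0} \<times> F" "3 \<le> i \<Longrightarrow> L i = {0}"
  by (auto simp: clwx_space_def)

lemma L_cases:
  assumes "u \<in> L i"
  obtains (0) x where "i = 0" "u = (x, 0)" "x \<in> V0"
  | (1) a where "i = 1" "u = (a, 0)" "a \<in> V1"
  | (2) f where "i = 2" "u = (0, f)" "f \<in> F"
  | (3) "3 \<le> i" "u = (0, 0)"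
proof -
  consider "i = 0" | "i = 1" | "i = 2" | "3 \<le> i" by linarith
  then show ?thesis
  proof cases
    case 1
    then show ?thesis using assms by (intro that(1)[of "fst u"]) (auto simp: L_simps)
  next
    case 2
    then show ?thesis using assms by (intro that(2)[of "fst u"]) (auto simp: L_simps)
  next
    case 3
    then show ?thesis using assms by (intro that(3)[of "snd u"]) (auto simp: L_simps)
  next
    case 4
    then show ?thesis using assms by (intro that(4)) (auto simp: L_simps zero_prod_def)
  qed
qed

lemma d_simps [simp]: "d (x, f) = (\<delta> x + D f, 0)"
  by (simp add: clwx_diff_def)

lemma \<delta>_zero [simp]: "\<delta> 0 = 0"
  by (rule \<delta>_0) simp

lemma linear_on_pair:
  "linear_on W f \<Longrightarrow> linear_on W g \<Longrightarrow> linear_on W (\<lambda>x. (f x, g x))"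
  by (auto simp: linear_on_def scaleR_prod_def)

lemma linear_on_fst_snd: "linear_on W fst" "linear_on W snd"
  by (auto simp: linear_on_def)

lemma V01_sum:
  assumes "x \<in> V0" "a \<in> V1" "x + a = 0"
  shows "x = 0 \<and> a = 0"
proof -
  have "x = - a" using assms(3) by (simp add: eq_neg_iff_add_eq_0)
  then have "x \<in> G 0" "x \<in> G 1" using assms(1,2) by (simp_all add: G_simps)
  then have "x = 0" using G.disjoint[of x 0 1] by simp
  then show ?thesis using assms(3) by simp
qed

lemma complex_L: "three_term_complex L d"
  unfolding three_term_complex_def
proof (intro conjI allI ballI impI)
  show "Real_Vector_Spaces.subspace (L i)" for i
  proof -
    consider "i = 0" | "i = 1" | "i = 2" | "3 \<le> i" by linarith
    then show ?thesis
      by cases (auto simp: L_simps subspace_Times)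
  qed
  show "L i = {0}" if "2 < i" for i using that by (simp add: L_simps)
  show "linear_on (L i) d" for i
  proof -
    have "d (u + v) = d u + d v \<and> d (c *\<^sub>R u) = c *\<^sub>R d u" if "u \<in> L i" "v \<in> L i" for u v c
    proof -
      consider "i = 0" | "i = 1" | "i = 2" | "3 \<le> i" by linarith
      then show ?thesis
        by cases (use that in \<open>auto simp: L_simps scaleR_prod_def zero_prod_def\<close>)
    qed
    then show ?thesis unfolding linear_on_def by blast
  qed
  show "d ` L 0 \<subseteq> {0}" by (auto simp: L_simps zero_prod_def)
  show "d ` L (Suc i) \<subseteq> L i" for i
  proof (rule image_subsetI)
    fix u assume "u \<in> L (Suc i)"
    then show "d u \<in> L i"
      by (cases rule: L_cases) (auto simp: clwx_space_def zero_prod_def)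
  qed
  show "d (d v) = 0" if "v \<in> L i" for i v
    using that by (cases rule: L_cases) (auto simp: zero_prod_def)
qed (use V01_sum in \<open>auto simp: L_simps zero_prod_def\<close>)

sublocale L: three_term L d
  by standard (rule complex_L)

text \<open>Evaluation rules only ask that an entry has some degree; hiding which one gives a side
  condition that the simplifier can discharge.\<close>

definition homog :: "('m \<Rightarrow> 'e) \<times> ('m \<Rightarrow> real) \<Rightarrow> bool" where
  "homog u \<longleftrightarrow> (\<exists>i. u \<in> L i)"

lemma homogI: "u \<in> L i \<Longrightarrow> homog u"
  by (auto simp: homog_def)

lemma homog_simps [simp]: "x \<in> V0 \<Longrightarrow> homog (x, 0)" "a \<in> V1 \<Longrightarrow> homog (a, 0)" "f \<in> F \<Longrightarrow> homog (0, f)"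
  using homogI[of "(x, 0)" 0] homogI[of "(a, 0)" 1] homogI[of "(0, f)" 2] by (simp_all add: L_simps)

lemma homog_cases:
  assumes "homog u"
  obtains (0) x where "u = (x, 0)" "x \<in> V0"
  | (1) a where "u = (a, 0)" "a \<in> V1"
  | (2) f where "u = (0, f)" "f \<in> F"
proof -
  obtain i where "u \<in> L i" using assms by (auto simp: homog_def)
  then show thesis
  proof (cases rule: L_cases)
    case 3
    then show ?thesis using that(1)[of 0] by simp
  qed (use that in auto)
qed

lemma L_degree_of [simp]: "x \<in> V0 \<Longrightarrow> degree_of L (x, 0) = 0"
  "a \<in> V1 \<Longrightarrow> a \<noteq> 0 \<Longrightarrow> degree_of L (a, 0) = 1"
  "f \<in> F \<Longrightarrow> f \<noteq> 0 \<Longrightarrow> degree_of L (0, f) = 2"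
proof -
  show "x \<in> V0 \<Longrightarrow> degree_of L (x, 0) = 0"
    by (auto simp: degree_of_def L_simps intro!: Least_equality)
qed (auto intro!: L.degree_of_eq simp: L_simps zero_prod_def)

lemma fst_mem [simp]: "homog u \<Longrightarrow> fst u \<in> V" "homog u \<Longrightarrow> snd u \<in> F"
proof -
  show "fst u \<in> V" if "homog u"
    using that by (cases rule: homog_cases) simp_all
  show "snd u \<in> F" if "homog u"
    using that by (cases rule: homog_cases) simp_all
qed

definition l2 where "l2 = ext_circ circ + pcomp L (ext_S S) 2 (1, -1, ext_D D)"
abbreviation s where "s \<equiv> ext_S S"
abbreviation \<Omega> where "\<Omega> \<equiv> ext_Om Om"

lemma S_zero [simp]: "x \<in> V \<Longrightarrow> S x 0 = 0" "x \<in> V \<Longrightarrow> S 0 x = 0"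
  by (simp_all add: linear_on_0[OF S_linear(1)] linear_on_0[OF S_linear(2)])

lemma l2_eq:
  assumes "homog u" "homog v"
  shows "l2 [u, v] = (circ (fst u) (fst v), S (fst u) (D (snd v)))"
proof -
  have "pcomp L s 2 (1, -1, ext_D D) [u, v] = (0, S (fst u) (D (snd v)))"
    using assms(1)
  proof (cases rule: homog_cases)
    \<comment> \<open>The inserted D has degree -1, so \<open>pcomp\<close> produces a sign -1
      behind a nonzero section of E1. Isotropy makes the value S(a, Df) zero, so the sign is
      harmless.\<close>
    case (1 a)
    show ?thesis
      by (rule homog_cases[OF assms(2)]) (use 1 in \<open>simp_all add: pcomp_def ext_S_def ext_D_def S_11\<close>)
  next
    case (2 f)
    show ?thesis
      by (rule homog_cases[OF assms(2)]) (use 2 in \<open>simp_all add: pcomp_def ext_S_def ext_D_def\<close>)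
  qed (simp add: pcomp_def ext_S_def ext_D_def sgn_deg_def)
  then show ?thesis by (simp add: l2_def ext_circ_def)
qed

lemma image_L: "fst ` L i \<subseteq> V" "snd ` L i \<subseteq> F"
  using fst_mem[OF homogI] by auto

lemma image_D: "(\<lambda>u. D (snd u)) ` L i \<subseteq> V"
proof (rule image_subsetI)
  fix u assume "u \<in> L i"
  then have "homog u" by (rule homogI)
  then show "D (snd u) \<in> V" by simp
qed

lemma graded_l2: "graded_map L 2 0 l2"
proof (rule L.graded_map_2I)
  fix i j u v assume u: "u \<in> L i" and v: "v \<in> L j"
  have "l2 [u, v] = (circ (fst u) (fst v), S (fst u) (D (snd v)))"
    using u v by (simp add: l2_eq homogI)
  also have "\<dots> \<in> L (i + j)"
    using u v by (elim L_cases) (simp_all add: L_simps zero_prod_def S_11)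
  finally show "l2 [u, v] \<in> L (i + j + 0)" by simp
next
  fix i j v assume v: "v \<in> L j"
  have "linear_on (L i) (\<lambda>u. (circ (fst u) (fst v), S (fst u) (D (snd v))))"
    using homogI[OF v]
    by (intro linear_on_pair linear_on_compose[OF linear_on_fst_snd(1) _ circ_linear(2)]
        linear_on_compose[OF linear_on_fst_snd(1) _ S_linear(2)]) (simp_all add: image_L)
  then show "linear_on (L i) (\<lambda>u. l2 [u, v])"
    by (rule linear_on_cong) (simp_all add: l2_eq homogI[OF v] homogI L.subspace)
next
  fix i j u assume u: "u \<in> L i"
  have "linear_on (L j) (\<lambda>v. (circ (fst u) (fst v), S (fst u) (D (snd v))))"
    using homogI[OF u]
    by (intro linear_on_pair linear_on_compose[OF linear_on_fst_snd(1) _ circ_linear(1)]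
        linear_on_compose[OF linear_on_compose[OF linear_on_fst_snd(2) image_L(2) D_linear] _ S_linear(1)])
      (simp_all add: image_L image_D)
  then show "linear_on (L j) (\<lambda>v. l2 [u, v])"
    by (rule linear_on_cong) (simp_all add: l2_eq homogI[OF u] homogI L.subspace)
qed

lemma graded_s: "graded_map L 2 1 s"
proof (rule L.graded_map_2I)
  fix i j u v assume u: "u \<in> L i" and v: "v \<in> L j"
  show "s [u, v] \<in> L (i + j + 1)"
    using u v by (elim L_cases) (simp_all add: ext_S_def L_simps zero_prod_def S_11 S_00)
next
  fix i j v assume v: "v \<in> L j"
  show "linear_on (L i) (\<lambda>u. s [u, v])"
    using homogI[OF v] unfolding ext_S_def
    by (intro linear_on_pair linear_on_const_0)
      (simp_all add: linear_on_compose[OF linear_on_fst_snd(1) _ S_linear(2)] image_L)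
next
  fix i j u assume u: "u \<in> L i"
  show "linear_on (L j) (\<lambda>v. s [u, v])"
    using homogI[OF u] unfolding ext_S_def
    by (intro linear_on_pair linear_on_const_0)
      (simp_all add: linear_on_compose[OF linear_on_fst_snd(1) _ S_linear(1)] image_L)
qed

lemma Om_11 [simp]: "a \<in> V1 \<Longrightarrow> b \<in> V1 \<Longrightarrow> x \<in> V0 \<Longrightarrow> Om a b x = 0"
  "a \<in> V1 \<Longrightarrow> b \<in> V1 \<Longrightarrow> x \<in> V0 \<Longrightarrow> Om a x b = 0"
  "a \<in> V1 \<Longrightarrow> b \<in> V1 \<Longrightarrow> x \<in> V0 \<Longrightarrow> Om x a b = 0"
  "a \<in> V1 \<Longrightarrow> b \<in> V1 \<Longrightarrow> c \<in> V1 \<Longrightarrow> Om a b c = 0"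
  using G.graded_map_mem[OF Om_graded, of "[1,1,0]" "[a,b,x]"]
    G.graded_map_mem[OF Om_graded, of "[1,0,1]" "[a,x,b]"]
    G.graded_map_mem[OF Om_graded, of "[0,1,1]" "[x,a,b]"]
    G.graded_map_mem[OF Om_graded, of "[1,1,1]" "[a,b,c]"]
  by (simp_all add: G_simps)

lemma Om_zero [simp]: "x \<in> V \<Longrightarrow> y \<in> V \<Longrightarrow> Om 0 x y = 0" "x \<in> V \<Longrightarrow> y \<in> V \<Longrightarrow> Om x 0 y = 0"
  "x \<in> V \<Longrightarrow> y \<in> V \<Longrightarrow> Om x y 0 = 0"
  by (simp_all add: linear_on_0[OF Om_linear(1)] linear_on_0[OF Om_linear(2)] linear_on_0[OF Om_linear(3)])

lemma graded_\<Omega>: "graded_map L 3 1 \<Omega>"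
proof (rule L.graded_map_3I)
  fix i j l u v w assume "u \<in> L i" "v \<in> L j" "w \<in> L l"
  then show "\<Omega> [u, v, w] \<in> L (i + j + l + 1)"
    by (elim L_cases) (simp_all add: ext_Om_def L_simps zero_prod_def)
next
  fix i j l v w assume vw: "v \<in> L j" "w \<in> L l"
  show "linear_on (L i) (\<lambda>u. \<Omega> [u, v, w])"
    using vw[THEN homogI] unfolding ext_Om_def
    by (intro linear_on_pair linear_on_const_0)
      (simp_all add: linear_on_compose[OF linear_on_fst_snd(1) _ Om_linear(1)] image_L)
next
  fix i j l u w assume uw: "u \<in> L i" "w \<in> L l"
  show "linear_on (L j) (\<lambda>v. \<Omega> [u, v, w])"
    using uw[THEN homogI] unfolding ext_Om_def
    by (intro linear_on_pair linear_on_const_0)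
      (simp_all add: linear_on_compose[OF linear_on_fst_snd(1) _ Om_linear(2)] image_L)
next
  fix i j l u v assume uv: "u \<in> L i" "v \<in> L j"
  show "linear_on (L l) (\<lambda>w. \<Omega> [u, v, w])"
    using uv[THEN homogI] unfolding ext_Om_def
    by (intro linear_on_pair linear_on_const_0)
      (simp_all add: linear_on_compose[OF linear_on_fst_snd(1) _ Om_linear(3)] image_L)
qed

text \<open>Degrees alone would allow \<open>l2\<close> of two sections of E1 to be a function. The
  E-component vanishes since E has nothing in degree 2, and the function component, a pairing of a
  section of E1 with a value of D, vanishes by isotropy.\<close>

lemma sparse_l2: "L.sparse_map 2 l2"
  unfolding L.sparse_map_def
proof (intro allI impI)
  fix ds vs assume vs: "L.homogeneous ds vs" "length vs = 2" "\<not> sparse ds"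
  then obtain u v i j where *: "vs = [u, v]" "ds = [i, j]" "u \<in> L i" "v \<in> L j"
    by (cases ds; cases vs; cases "tl ds"; cases "tl vs") auto
  then have "0 < i" "0 < j" using vs(3) by (auto simp: sparse_def split: if_splits)
  have "l2 [u, v] = (circ (fst u) (fst v), S (fst u) (D (snd v)))"
    using * by (simp add: l2_eq homogI)
  also have "\<dots> = (0, 0)"
    using *(3,4) \<open>0 < i\<close> \<open>0 < j\<close> by (elim L_cases) (simp_all add: S_11)
  finally show "l2 vs = 0" using * by (simp add: zero_prod_def)
qed

end

section \<open>The skew-symmetrized structure maps\<close>

lemma numeral_times_fun: "numeral k * f = numeral k *\<^sub>R f" "f * numeral k = numeral k *\<^sub>R f"
  for f :: "'a \<Rightarrow> real"
proof -
  have "(numeral k :: 'a \<Rightarrow> real) = (\<lambda>_. numeral k)"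
    by (induction k) (simp_all add: numeral.simps one_fun_def plus_fun_def)
  then show "numeral k * f = numeral k *\<^sub>R f" "f * numeral k = numeral k *\<^sub>R f"
    by (simp_all add: fun_eq_iff)
qed

lemmas linear_functional_simps = linear_add linear_diff linear_neg linear_cmul linear_0
  numeral_times_fun

lemma pcomp_zero [simp]: "pcomp L 0 i B = 0"
  by (cases B) (auto simp: pcomp_def fun_eq_iff)

lemma perm_zero [simp]: "perm L 0 \<sigma> = 0"
  by (auto simp: perm_def fun_eq_iff)

lemma alternating_sum_zero [simp]: "alternating_sum L n 0 = 0"
  by (simp add: alternating_sum_def)

context clwx
begin

lemma L_zero [simp]: "(0, 0) \<in> L i"
  using L.zero_mem[of i] by (simp add: zero_prod_def)

lemma graded_C: "graded_map L 2 0 (ext_circ circ)"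
proof (rule L.graded_map_2I)
  fix i j u v assume u: "u \<in> L i" and v: "v \<in> L j"
  show "ext_circ circ [u, v] \<in> L (i + j + 0)"
    using u v by (elim L_cases) (simp_all add: ext_circ_def L_simps zero_prod_def)
next
  fix i j v assume v: "v \<in> L j"
  show "linear_on (L i) (\<lambda>u. ext_circ circ [u, v])"
    using homogI[OF v] unfolding ext_circ_def
    by (intro linear_on_pair linear_on_const_0)
      (simp_all add: linear_on_compose[OF linear_on_fst_snd(1) _ circ_linear(2)] image_L)
next
  fix i j u assume u: "u \<in> L i"
  show "linear_on (L j) (\<lambda>v. ext_circ circ [u, v])"
    using homogI[OF u] unfolding ext_circ_def
    by (intro linear_on_pair linear_on_const_0)
      (simp_all add: linear_on_compose[OF linear_on_fst_snd(1) _ circ_linear(1)] image_L)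
qed

section \<open>Degrees and skew symmetry of the new structure maps\<close>

definition b2 where "b2 = skew_2 L l2"
definition b3 where "b3 = skew_3 L l2 \<Omega> s"
definition b4 where "b4 = skew_4 L l2 \<Omega> 0 s 0 0"

lemma graded_b2: "graded_map L 2 0 b2"
  unfolding b2_def skew_2_def by (intro L.graded_map_scale L.graded_map_alternating_sum graded_l2)

lemma graded_s_l2: "graded_map L 3 1 (pcomp L s 1 (2, 0, l2))" "graded_map L 3 1 (pcomp L s 2 (2, 0, l2))"
  "graded_map L 3 1 (pcomp L s 1 (2, 0, ext_circ circ))"
  using L.graded_map_pcomp[OF graded_s graded_l2, of 1 3] L.graded_map_pcomp[OF graded_s graded_l2, of 2 3]
    L.graded_map_pcomp[OF graded_s graded_C, of 1 3]
  by simp_all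

lemma graded_s_\<Omega>: "graded_map L 4 2 (pcomp L s 1 (3, 1, \<Omega>))" "graded_map L 4 2 (pcomp L s 2 (3, 1, \<Omega>))"
  using L.graded_map_pcomp[OF graded_s graded_\<Omega>, of 1 4] L.graded_map_pcomp[OF graded_s graded_\<Omega>, of 2 4]
  by (simp_all add: numeral_2_eq_2)

lemma b3_eq: "b3 = (1/6) *\<^sub>R alternating_sum L 3 \<Omega>
    - (1/24) *\<^sub>R alternating_sum L 3 (pcomp L s 1 (2, 0, l2) + pcomp L s 2 (2, 0, l2))"
  by (simp add: b3_def skew_3_def)

lemma b4_eq: "b4 = (1/48) *\<^sub>R alternating_sum L 4 (pcomp L s 1 (3, 1, \<Omega>) - pcomp L s 2 (3, 1, \<Omega>))"
  by (simp add: b4_def skew_4_def Let_def)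

lemma graded_b3: "graded_map L 3 1 b3"
  unfolding b3_eq
  by (intro L.graded_map_diff L.graded_map_scale L.graded_map_alternating_sum L.graded_map_add
      graded_\<Omega> graded_s_l2)

lemma graded_b4: "graded_map L 4 2 b4"
  unfolding b4_eq
  by (intro L.graded_map_scale L.graded_map_alternating_sum L.graded_map_diff graded_s_\<Omega>)

lemma skew_symmetric_combination:
  assumes "skew_symmetric L n \<mu>" "skew_symmetric L n \<nu>"
  shows "skew_symmetric L n (a *\<^sub>R \<mu> - b *\<^sub>R \<nu>)"
  unfolding skew_symmetric_def map_eq_def
proof (intro allI impI ballI)
  fix \<sigma> vs assume "\<sigma> permutes {1..n}" "vs \<in> homogeneous_tuples L n"
  then have *: "perm L \<mu> \<sigma> vs = of_int (sign \<sigma>) *\<^sub>R \<mu> vs" "perm L \<nu> \<sigma> vs = of_int (sign \<sigma>) *\<^sub>R \<nu> vs"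
    using assms unfolding skew_symmetric_def map_eq_def by auto
  have "perm L (a *\<^sub>R \<mu> - b *\<^sub>R \<nu>) \<sigma> vs = a *\<^sub>R perm L \<mu> \<sigma> vs - b *\<^sub>R perm L \<nu> \<sigma> vs"
    by (simp add: perm_def scaleR_diff_right mult.commute)
  then show "perm L (a *\<^sub>R \<mu> - b *\<^sub>R \<nu>) \<sigma> vs = (of_int (sign \<sigma>) *\<^sub>R (a *\<^sub>R \<mu> - b *\<^sub>R \<nu>)) vs"
    by (simp add: * scaleR_diff_right mult.commute)
qed

lemma skew_b2: "skew_symmetric L 2 b2"
  using skew_symmetric_combination[OF L.skew_symmetric_alternating_sum[OF graded_l2 sparse_l2]
      L.skew_symmetric_alternating_sum[OF graded_l2 sparse_l2], of "1/2" 0]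
  by (simp add: b2_def skew_2_def)

lemma skew_b3: "skew_symmetric L 3 b3"
  unfolding b3_eq
  by (intro skew_symmetric_combination L.skew_symmetric_alternating_sum[where k = 1] L.sparse_map_graded[where k = 1]
      L.graded_map_add graded_\<Omega> graded_s_l2) simp_all

lemma skew_b4: "skew_symmetric L 4 b4"
proof -
  have "skew_symmetric L 4 (alternating_sum L 4 (pcomp L s 1 (3, 1, \<Omega>) - pcomp L s 2 (3, 1, \<Omega>)))"
    by (intro L.skew_symmetric_alternating_sum[where k = 2] L.sparse_map_graded[where k = 2]
      L.graded_map_diff graded_s_\<Omega>) simp_all
  from skew_symmetric_combination[OF this this, of "1/48" 0] show ?thesis
    by (simp add: b4_eq)
qed

lemma b2_eq:
  assumes "homog u" "homog v"
  shows "b2 [u, v] = (1/2) *\<^sub>R (l2 [u, v] - l2 [v, u])"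
proof -
  obtain i j where "u \<in> L i" "v \<in> L j" using assms by (auto simp: homog_def)
  then have "alternating_sum L 2 l2 [u, v] = l2 [u, v] - l2 [v, u]"
    using L.alternating_sum_sparse_map[OF graded_l2 sparse_l2, of "[i, j]" "[u, v]"]
    by (simp add: sum_permutations_2 del: One_nat_def)
  then show ?thesis by (simp add: b2_def skew_2_def)
qed

lemma alternating_sum_3:
  assumes "graded_map L 3 1 \<mu>" "homog u" "homog v" "homog w"
  shows "alternating_sum L 3 \<mu> [u, v, w] =
    \<mu> [u, v, w] - \<mu> [v, u, w] - \<mu> [u, w, v] - \<mu> [w, v, u] + \<mu> [v, w, u] + \<mu> [w, u, v]"
proof -
  obtain i j l where "u \<in> L i" "v \<in> L j" "w \<in> L l" using assms by (auto simp: homog_def)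
  then show ?thesis
    using L.alternating_sum_sparse_map[OF assms(1) L.sparse_map_graded[OF assms(1)], of "[i, j, l]" "[u, v, w]"]
    by (simp add: sum_permutations_3 del: One_nat_def)
qed

lemma b3_expand:
  assumes "homog u" "homog v" "homog w"
  shows "b3 [u, v, w] = (1/6) *\<^sub>R (\<Omega> [u, v, w] - \<Omega> [v, u, w] - \<Omega> [u, w, v] - \<Omega> [w, v, u] + \<Omega> [v, w, u] + \<Omega> [w, u, v])
   - (1/24) *\<^sub>R ((s [l2 [u, v], w] + s [u, l2 [v, w]]) - (s [l2 [v, u], w] + s [v, l2 [u, w]])
     - (s [l2 [u, w], v] + s [u, l2 [w, v]]) - (s [l2 [w, v], u] + s [w, l2 [v, u]])
     + (s [l2 [v, w], u] + s [v, l2 [w, u]]) + (s [l2 [w, u], v] + s [w, l2 [u, v]]))"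
proof -
  have "pcomp L s 1 (2, 0, l2) [u, v, w] = s [l2 [u, v], w]"
    "pcomp L s 2 (2, 0, l2) [u, v, w] = s [u, l2 [v, w]]" for u v w
    by (simp_all add: pcomp_def sgn_deg_def)
  then show ?thesis
    by (simp only: b3_eq minus_apply plus_fun_apply scaleR_fun_apply alternating_sum_3[OF graded_\<Omega> assms]
        alternating_sum_3[OF L.graded_map_add[OF graded_s_l2(1,2)] assms])
qed

section \<open>Values of the structure maps on homogeneous entries\<close>

lemma l2_simps [simp]:
  "x \<in> V0 \<Longrightarrow> y \<in> V0 \<Longrightarrow> l2 [(x, 0), (y, 0)] = (circ x y, 0)"
  "x \<in> V0 \<Longrightarrow> a \<in> V1 \<Longrightarrow> l2 [(x, 0), (a, 0)] = (circ x a, 0)"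
  "x \<in> V0 \<Longrightarrow> a \<in> V1 \<Longrightarrow> l2 [(a, 0), (x, 0)] = (D (P x a) - circ x a, 0)"
  "a \<in> V1 \<Longrightarrow> b \<in> V1 \<Longrightarrow> l2 [(a, 0), (b, 0)] = (0, 0)"
  "x \<in> V0 \<Longrightarrow> f \<in> F \<Longrightarrow> l2 [(x, 0), (0, f)] = (0, \<rho> x f)"
  "a \<in> V1 \<Longrightarrow> f \<in> F \<Longrightarrow> l2 [(a, 0), (0, f)] = (0, 0)"
  "homog u \<Longrightarrow> f \<in> F \<Longrightarrow> l2 [(0, f), u] = (0, 0)"
  by (simp_all add: l2_eq circ_10 S_11)

lemma s_simps [simp]:
  "x \<in> V0 \<Longrightarrow> y \<in> V0 \<Longrightarrow> s [(x, 0), (y, 0)] = (0, 0)"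
  "x \<in> V0 \<Longrightarrow> a \<in> V1 \<Longrightarrow> s [(x, 0), (a, 0)] = (0, P x a)"
  "x \<in> V0 \<Longrightarrow> a \<in> V1 \<Longrightarrow> s [(a, 0), (x, 0)] = (0, P x a)"
  "a \<in> V1 \<Longrightarrow> b \<in> V1 \<Longrightarrow> s [(a, 0), (b, 0)] = (0, 0)"
  "homog u \<Longrightarrow> f \<in> F \<Longrightarrow> s [(0, f), u] = (0, 0)"
  "homog u \<Longrightarrow> f \<in> F \<Longrightarrow> s [u, (0, f)] = (0, 0)"
  by (simp_all add: ext_S_def S_00 S_11)

lemma \<Omega>_eq [simp]: "\<Omega> [u, v, w] = (Om (fst u) (fst v) (fst w), 0)"
  by (simp add: ext_Om_def)

text \<open>On (x, a) half of the symmetric part D P(x, a) given by \<open>circ_10\<close> is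
  removed. On (x, f) the factor 1/2 survives because \<open>l2\<close> is zero with a function on
  the left.\<close>

lemma b2_simps [simp]:
  "x \<in> V0 \<Longrightarrow> y \<in> V0 \<Longrightarrow> b2 [(x, 0), (y, 0)] = (circ x y, 0)"
  "x \<in> V0 \<Longrightarrow> a \<in> V1 \<Longrightarrow> b2 [(x, 0), (a, 0)] = (circ x a - (1/2) *\<^sub>R D (P x a), 0)"
  "x \<in> V0 \<Longrightarrow> a \<in> V1 \<Longrightarrow> b2 [(a, 0), (x, 0)] = (- (circ x a - (1/2) *\<^sub>R D (P x a)), 0)"
  "a \<in> V1 \<Longrightarrow> b \<in> V1 \<Longrightarrow> b2 [(a, 0), (b, 0)] = (0, 0)"
  "x \<in> V0 \<Longrightarrow> f \<in> F \<Longrightarrow> b2 [(x, 0), (0, f)] = (0, (1/2) *\<^sub>R \<rho> x f)"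
  "x \<in> V0 \<Longrightarrow> f \<in> F \<Longrightarrow> b2 [(0, f), (x, 0)] = (0, - ((1/2) *\<^sub>R \<rho> x f))"
  "a \<in> V1 \<Longrightarrow> f \<in> F \<Longrightarrow> b2 [(a, 0), (0, f)] = (0, 0)"
  "a \<in> V1 \<Longrightarrow> f \<in> F \<Longrightarrow> b2 [(0, f), (a, 0)] = (0, 0)"
  "f \<in> F \<Longrightarrow> g \<in> F \<Longrightarrow> b2 [(0, f), (0, g)] = (0, 0)"
proof -
  show "x \<in> V0 \<Longrightarrow> y \<in> V0 \<Longrightarrow> b2 [(x, 0), (y, 0)] = (circ x y, 0)"
    using circ_skew[of y x] by (simp add: b2_eq scaleR_prod_def)
  show "x \<in> V0 \<Longrightarrow> a \<in> V1 \<Longrightarrow> b2 [(x, 0), (a, 0)] = (circ x a - (1/2) *\<^sub>R D (P x a), 0)"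
    by (simp add: b2_eq scaleR_prod_def)
      (rule eq_by_linear_functionals, simp add: linear_functional_simps)
  show "x \<in> V0 \<Longrightarrow> a \<in> V1 \<Longrightarrow> b2 [(a, 0), (x, 0)] = (- (circ x a - (1/2) *\<^sub>R D (P x a)), 0)"
    by (simp add: b2_eq scaleR_prod_def)
      (rule eq_by_linear_functionals, simp add: linear_functional_simps)
qed (simp_all add: b2_eq scaleR_prod_def)

text \<open>The function-valued part of \<open>b3\<close>, on two sections of E0 and one of E1. The
  coefficients 1/2 and 1/4 are what is left of 1/24 times twelve pairings after
  \<open>P_circ\<close> has removed the products from their second slots.\<close>

definition T where
  "T x y a = - ((1/2) *\<^sub>R P (circ x y) a) - (1/4) *\<^sub>R \<rho> y (P x a) + (1/4) *\<^sub>R \<rho> x (P y a)"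

lemma T_mem [simp]: "x \<in> V0 \<Longrightarrow> y \<in> V0 \<Longrightarrow> a \<in> V1 \<Longrightarrow> T x y a \<in> F"
  by (simp add: T_def)

lemma b3_000 [simp]:
  assumes "x \<in> V0" "y \<in> V0" "z \<in> V0"
  shows "b3 [(x, 0), (y, 0), (z, 0)] = (Om x y z, 0)"
  using assms Om_skew[of x y z] Om_skew(2)[of y x z] Om_skew(1)[of x z y] Om_skew(2)[of z x y]
  by (simp add: b3_expand scaleR_prod_def)
      (rule eq_by_linear_functionals, simp add: linear_functional_simps)

lemma b3_001 [simp]:
  assumes "x \<in> V0" "y \<in> V0" "a \<in> V1"
  shows "b3 [(x, 0), (y, 0), (a, 0)] = (0, T x y a)"
    "b3 [(x, 0), (a, 0), (y, 0)] = (0, - T x y a)"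
    "b3 [(a, 0), (x, 0), (y, 0)] = (0, T x y a)"
  using assms circ_skew[of y x] unfolding T_def
  by (simp_all add: b3_expand scaleR_prod_def P_circ)
      (rule eq_by_linear_functionals, simp add: linear_functional_simps)+

lemma b3_zero [simp]:
  assumes "homog u" "homog v"
  shows "b3 [(0, 0), u, v] = (0, 0)" "b3 [u, (0, 0), v] = (0, 0)" "b3 [u, v, (0, 0)] = (0, 0)"
proof -
  obtain i j where "u \<in> L i" "v \<in> L j" using assms by (auto simp: homog_def)
  then show "b3 [(0, 0), u, v] = (0, 0)" "b3 [u, (0, 0), v] = (0, 0)" "b3 [u, v, (0, 0)] = (0, 0)"
    using L.graded_map_eq_0[OF graded_b3, of "[0,i,j]" "[0,u,v]"]
      L.graded_map_eq_0[OF graded_b3, of "[i,0,j]" "[u,0,v]"]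
      L.graded_map_eq_0[OF graded_b3, of "[i,j,0]" "[u,v,0]"]
    by (simp_all add: zero_prod_def)
qed

text \<open>The four-form S(\<Omega>(x, y, z), w) on E0, which is to be the value of
  \<open>b4\<close>.\<close>

definition Q where "Q x y z w = P w (Om x y z)"

text \<open>The first two swaps are skew symmetry of \<Omega>; the third is axiom (vi) read with the
  symmetry of S.\<close>

lemma Q_skew:
  assumes "x \<in> V0" "y \<in> V0" "z \<in> V0" "w \<in> V0"
  shows "Q y x z w = - Q x y z w" "Q x z y w = - Q x y z w" "Q x y w z = - Q x y z w"
  using assms Om_skew[of x y z] S_Om[of x y z w] by (simp_all add: Q_def)

lemma Q_transpose:
  assumes "x \<in> V0" "y \<in> V0" "z \<in> V0" "w \<in> V0"
  shows "Q z y x w = - Q x y z w" "Q x w z y = - Q x y z w" "Q w y z x = - Q x y z w"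
  using assms Q_skew[of x y z w] Q_skew(1)[of y z x w] Q_skew(2)[of y x z w] Q_skew(2)[of x z w y]
    Q_skew(3)[of x z y w] Q_skew(1)[of y w z x] Q_skew(2)[of y z w x] Q_skew(3)[of y z x w]
  by simp_all

text \<open>In S(x, \<Omega>(y, z, w)) the argument x has moved past three others, which is an odd
  permutation of Q; hence the two ways of inserting \<Omega> differ by a sign.\<close>

lemma s_\<Omega>_0:
  assumes "x \<in> V0" "y \<in> V0" "z \<in> V0" "w \<in> V0"
  shows "pcomp L s 1 (3, 1, \<Omega>) [(x, 0), (y, 0), (z, 0), (w, 0)] = (0, Q x y z w)"
    "pcomp L s 2 (3, 1, \<Omega>) [(x, 0), (y, 0), (z, 0), (w, 0)] = (0, - Q x y z w)"
proof -
  show "pcomp L s 1 (3, 1, \<Omega>) [(x, 0), (y, 0), (z, 0), (w, 0)] = (0, Q x y z w)"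
    using assms by (simp add: pcomp_def sgn_deg_def Q_def)
  have "Q y z w x = - Q x y z w"
    using assms Q_skew(3)[of y z x w] Q_skew(2)[of y x z w] Q_skew(1)[of x y z w]
     by simp
  then show "pcomp L s 2 (3, 1, \<Omega>) [(x, 0), (y, 0), (z, 0), (w, 0)] = (0, - Q x y z w)"
    using assms by (simp add: pcomp_def sgn_deg_def Q_def)
qed

text \<open>The difference is skew even before the alternating sum is taken: it is 2 Q on sections
  of E0 and vanishes for degree reasons on all other tuples, so the six transpositions of Q are all
  that has to be examined.\<close>

lemma skew_s_\<Omega>:
  "skew_symmetric L 4 (pcomp L s 1 (3, 1, \<Omega>) - pcomp L s 2 (3, 1, \<Omega>))" (is "skew_symmetric L 4 ?\<psi>")
proof (rule L.skew_symmetricI_transpose)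
  show gr: "graded_map L 4 2 ?\<psi>"
    by (intro L.graded_map_diff graded_s_\<Omega>)
  then show "L.sparse_map 4 ?\<psi>"
    by (rule L.sparse_map_graded) simp
  fix a b :: nat and ds vs
  assume ab: "1 \<le> a" "a < b" "b \<le> 4" and vs: "L.homogeneous ds vs" "length vs = 4"
  have ds: "length ds = 4" using vs L.homogeneous_length by auto
  have \<tau>: "Transposition.transpose a b permutes {1..length vs}"
    using ab vs by (intro permutes_swap_id) auto
  show "?\<psi> (permute_list1 (Transposition.transpose a b) vs) = - ?\<psi> vs"
  proof (cases "sum_list ds = 0")
    case False
    then have "?\<psi> vs = 0"
      by (intro L.above_2[OF L.graded_map_mem[OF gr vs]]) linarith
    moreover have "?\<psi> (permute_list1 (Transposition.transpose a b) vs) = 0"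
    proof (rule L.above_2[OF L.graded_map_mem[OF gr L.homogeneous_permute[OF vs(1) \<tau>]]])
      show "2 < sum_list (permute_list1 (Transposition.transpose a b) ds) + 2"
      proof -
        have "sum_list (permute_list1 (Transposition.transpose a b) ds) = sum_list ds"
          using \<tau> ds vs(2) by (intro sum_list_permute_list1) simp
        then show ?thesis using False by linarith
      qed
    qed (simp add: vs)
    ultimately show ?thesis by simp
  next
    case True
    obtain v1 v2 v3 v4 where vs': "vs = [v1, v2, v3, v4]"
      using vs(2) by (auto simp: numeral_eq_Suc length_Suc_conv)
    have "vs ! i \<in> L 0" if "i < 4" for i
    proof -
      have "ds ! i = 0" using True that ds by (metis nth_mem sum_list_eq_0_iff)
      then show ?thesis using L.homogeneous_nth[OF vs(1), of i] that vs(2) by simp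
    qed
    from this[of 0] this[of 1] this[of 2] this[of 3] obtain x y z w where
      xyzw: "vs = [(x, 0), (y, 0), (z, 0), (w, 0)]" "x \<in> V0" "y \<in> V0" "z \<in> V0" "w \<in> V0"
      by (auto simp: vs' L_simps)
    consider "a = 1" "b = 2" | "a = 1" "b = 3" | "a = 1" "b = 4" | "a = 2" "b = 3" | "a = 2" "b = 4"
      | "a = 3" "b = 4"
      using ab by linarith
    then show ?thesis
      by cases (simp_all add: xyzw permute_list1_simps s_\<Omega>_0[unfolded One_nat_def]
          Transposition.transpose_def Q_skew[OF xyzw(2-)] Q_transpose[OF xyzw(2-)] del: pcomp_zero)
  qed
qed

lemma b4_0000 [simp]:
  assumes "x \<in> V0" "y \<in> V0" "z \<in> V0" "w \<in> V0"
  shows "b4 [(x, 0), (y, 0), (z, 0), (w, 0)] = (0, Q x y z w)"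
proof -
  \<comment> \<open>The sum has 24 equal terms 2 Q, which exactly cancel the prefactor 1/48.\<close>
  have "alternating_sum L 4 (pcomp L s 1 (3, 1, \<Omega>) - pcomp L s 2 (3, 1, \<Omega>)) [(x, 0), (y, 0), (z, 0), (w, 0)]
     = fact 4 *\<^sub>R (0, Q x y z w + Q x y z w)"
    using assms L.alternating_sum_skew_symmetric[OF skew_s_\<Omega>, of "[0,0,0,0]"]
    by (simp add: L_simps s_\<Omega>_0[unfolded One_nat_def] del: \<Omega>_eq)
  then show ?thesis by (simp add: b4_eq scaleR_prod_def fact_numeral)
      (rule eq_by_linear_functionals, simp add: linear_functional_simps)
qed

lemma b4_zero [simp]:
  assumes "homog u" "homog v" "homog w"
  shows "b4 [(0, 0), u, v, w] = (0, 0)" "b4 [u, (0, 0), v, w] = (0, 0)" "b4 [u, v, (0, 0), w] = (0, 0)"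
   "b4 [u, v, w, (0, 0)] = (0, 0)"
proof -
  obtain i j l where "u \<in> L i" "v \<in> L j" "w \<in> L l" using assms by (auto simp: homog_def)
  then show "b4 [(0, 0), u, v, w] = (0, 0)" "b4 [u, (0, 0), v, w] = (0, 0)" "b4 [u, v, (0, 0), w] = (0, 0)"
    "b4 [u, v, w, (0, 0)] = (0, 0)"
    using L.graded_map_eq_0[OF graded_b4, of "[0,i,j,l]" "[0,u,v,w]"]
      L.graded_map_eq_0[OF graded_b4, of "[i,0,j,l]" "[u,0,v,w]"]
      L.graded_map_eq_0[OF graded_b4, of "[i,j,0,l]" "[u,v,0,w]"]
      L.graded_map_eq_0[OF graded_b4, of "[i,j,l,0]" "[u,v,w,0]"]
    by (simp_all add: zero_prod_def)
qed

end

section \<open>Identities on homogeneous tuples\<close>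

lemmas fun_apply_simps = plus_fun_apply minus_apply uminus_apply zero_fun_apply scaleR_fun_apply

context three_term
begin

lemma vanishes_zero: "vanishes_above n m 0"
  by (simp add: vanishes_above_def)

end

context clwx
begin

lemma L_tuple_2:
  assumes "L.homogeneous ds vs" "length vs = 2"
  obtains i j u v where "vs = [u, v]" "ds = [i, j]"
    "u \<in> L i" "v \<in> L j"
proof -
  have "length ds = 2" using assms L.homogeneous_length by auto
  with assms(2) obtain i j u v where *: "vs = [u, v]" "ds = [i, j]"
    by (auto simp: numeral_eq_Suc length_Suc_conv)
  then show thesis using assms(1) that[OF *] by simp
qed

lemma L_tuple_3:
  assumes "L.homogeneous ds vs" "length vs = 3"
  obtains i j k u v w where "vs = [u, v, w]" "ds = [i, j, k]"
    "u \<in> L i" "v \<in> L j" "w \<in> L k"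
proof -
  have "length ds = 3" using assms L.homogeneous_length by auto
  with assms(2) obtain i j k u v w where *: "vs = [u, v, w]" "ds = [i, j, k]"
    by (auto simp: numeral_eq_Suc length_Suc_conv)
  then show thesis using assms(1) that[OF *] by simp
qed

lemma L_tuple_4:
  assumes "L.homogeneous ds vs" "length vs = 4"
  obtains i j k l u v w t where "vs = [u, v, w, t]" "ds = [i, j, k, l]"
    "u \<in> L i" "v \<in> L j" "w \<in> L k" "t \<in> L l"
proof -
  have "length ds = 4" using assms L.homogeneous_length by auto
  with assms(2) obtain i j k l u v w t where *: "vs = [u, v, w, t]" "ds = [i, j, k, l]"
    by (auto simp: numeral_eq_Suc length_Suc_conv)
  then show thesis using assms(1) that[OF *] by simp
qed

lemma L_tuple_5:
  assumes "L.homogeneous ds vs" "length vs = 5"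
  obtains i j k l m u v w t r where "vs = [u, v, w, t, r]" "ds = [i, j, k, l, m]"
    "u \<in> L i" "v \<in> L j" "w \<in> L k" "t \<in> L l" "r \<in> L m"
proof -
  have "length ds = 5" using assms L.homogeneous_length by auto
  with assms(2) obtain i j k l m u v w t r where *: "vs = [u, v, w, t, r]" "ds = [i, j, k, l, m]"
    by (auto simp: numeral_eq_Suc length_Suc_conv)
  then show thesis using assms(1) that[OF *] by simp
qed

text \<open>The entries of positive degree may be assumed to be non-zero: only then does \<^const>\<open>degree_of\<close> return
  their degree.\<close>

lemma map_eq_2I:
  assumes "L.vanishes_above 2 3 A" "L.vanishes_above 2 3 B"
    and "\<And>x y. x \<in> V0 \<Longrightarrow> y \<in> V0 \<Longrightarrow> A [(x, 0), (y, 0)] = B [(x, 0), (y, 0)]"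
    and "\<And>x a. x \<in> V0 \<Longrightarrow> a \<in> V1 \<Longrightarrow> a \<noteq> 0 \<Longrightarrow> A [(x, 0), (a, 0)] = B [(x, 0), (a, 0)]"
    and "\<And>x a. x \<in> V0 \<Longrightarrow> a \<in> V1 \<Longrightarrow> a \<noteq> 0 \<Longrightarrow> A [(a, 0), (x, 0)] = B [(a, 0), (x, 0)]"
    and "\<And>a b. a \<in> V1 \<Longrightarrow> b \<in> V1 \<Longrightarrow> a \<noteq> 0 \<Longrightarrow> b \<noteq> 0 \<Longrightarrow> A [(a, 0), (b, 0)] = B [(a, 0), (b, 0)]"
    and "\<And>x f. x \<in> V0 \<Longrightarrow> f \<in> F \<Longrightarrow> f \<noteq> 0 \<Longrightarrow> A [(x, 0), (0, f)] = B [(x, 0), (0, f)]"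
    and "\<And>x f. x \<in> V0 \<Longrightarrow> f \<in> F \<Longrightarrow> f \<noteq> 0 \<Longrightarrow> A [(0, f), (x, 0)] = B [(0, f), (x, 0)]"
    and "\<And>a f. a \<in> V1 \<Longrightarrow> a \<noteq> 0 \<Longrightarrow> f \<in> F \<Longrightarrow> f \<noteq> 0 \<Longrightarrow> A [(a, 0), (0, f)] = B [(a, 0), (0, f)]"
    and "\<And>a f. a \<in> V1 \<Longrightarrow> a \<noteq> 0 \<Longrightarrow> f \<in> F \<Longrightarrow> f \<noteq> 0 \<Longrightarrow> A [(0, f), (a, 0)] = B [(0, f), (a, 0)]"
  shows "map_eq L A 2 B"
proof (rule L.map_eqI_bounded[OF assms(1,2)])
  fix ds vs assume vs: "L.homogeneous ds vs" "length vs = 2" "0 \<notin> set vs" "sum_list ds \<le> 3"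
  from vs(1,2) obtain i j u v where *: "vs = [u, v]" "ds = [i, j]" "u \<in> L i" "v \<in> L j"
    by (rule L_tuple_2)
  from *(3,4) vs(3,4) show "A vs = B vs" unfolding *(1,2)
    by (elim L_cases) (simp_all add: zero_prod_def assms(3-))
qed

lemma map_eq_3I:
  assumes "L.vanishes_above 3 2 A" "L.vanishes_above 3 2 B"
    and "\<And>x y z. x \<in> V0 \<Longrightarrow> y \<in> V0 \<Longrightarrow> z \<in> V0 \<Longrightarrow> A [(x, 0), (y, 0), (z, 0)] = B [(x, 0), (y, 0), (z, 0)]"
    and "\<And>x y a. x \<in> V0 \<Longrightarrow> y \<in> V0 \<Longrightarrow> a \<in> V1 \<Longrightarrow> a \<noteq> 0 \<Longrightarrow> A [(x, 0), (y, 0), (a, 0)] = B [(x, 0), (y, 0), (a, 0)]"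
    and "\<And>x y a. x \<in> V0 \<Longrightarrow> y \<in> V0 \<Longrightarrow> a \<in> V1 \<Longrightarrow> a \<noteq> 0 \<Longrightarrow> A [(x, 0), (a, 0), (y, 0)] = B [(x, 0), (a, 0), (y, 0)]"
    and "\<And>x y a. x \<in> V0 \<Longrightarrow> y \<in> V0 \<Longrightarrow> a \<in> V1 \<Longrightarrow> a \<noteq> 0 \<Longrightarrow> A [(a, 0), (x, 0), (y, 0)] = B [(a, 0), (x, 0), (y, 0)]"
    and "\<And>x a b. x \<in> V0 \<Longrightarrow> a \<in> V1 \<Longrightarrow> a \<noteq> 0 \<Longrightarrow> b \<in> V1 \<Longrightarrow> b \<noteq> 0 \<Longrightarrow> A [(x, 0), (a, 0), (b, 0)] = B [(x, 0), (a, 0), (b, 0)]"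
    and "\<And>x a b. x \<in> V0 \<Longrightarrow> a \<in> V1 \<Longrightarrow> a \<noteq> 0 \<Longrightarrow> b \<in> V1 \<Longrightarrow> b \<noteq> 0 \<Longrightarrow> A [(a, 0), (x, 0), (b, 0)] = B [(a, 0), (x, 0), (b, 0)]"
    and "\<And>x a b. x \<in> V0 \<Longrightarrow> a \<in> V1 \<Longrightarrow> a \<noteq> 0 \<Longrightarrow> b \<in> V1 \<Longrightarrow> b \<noteq> 0 \<Longrightarrow> A [(a, 0), (b, 0), (x, 0)] = B [(a, 0), (b, 0), (x, 0)]"
    and "\<And>x y f. x \<in> V0 \<Longrightarrow> y \<in> V0 \<Longrightarrow> f \<in> F \<Longrightarrow> f \<noteq> 0 \<Longrightarrow> A [(x, 0), (y, 0), (0, f)] = B [(x, 0), (y, 0), (0, f)]"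
    and "\<And>x y f. x \<in> V0 \<Longrightarrow> y \<in> V0 \<Longrightarrow> f \<in> F \<Longrightarrow> f \<noteq> 0 \<Longrightarrow> A [(x, 0), (0, f), (y, 0)] = B [(x, 0), (0, f), (y, 0)]"
    and "\<And>x y f. x \<in> V0 \<Longrightarrow> y \<in> V0 \<Longrightarrow> f \<in> F \<Longrightarrow> f \<noteq> 0 \<Longrightarrow> A [(0, f), (x, 0), (y, 0)] = B [(0, f), (x, 0), (y, 0)]"
  shows "map_eq L A 3 B"
proof (rule L.map_eqI_bounded[OF assms(1,2)])
  fix ds vs assume vs: "L.homogeneous ds vs" "length vs = 3" "0 \<notin> set vs" "sum_list ds \<le> 2"
  from vs(1,2) obtain i j k u v w where *: "vs = [u, v, w]" "ds = [i, j, k]" "u \<in> L i" "v \<in> L j" "w \<in> L k"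
    by (rule L_tuple_3)
  from *(3-5) vs(3,4) show "A vs = B vs" unfolding *(1,2)
    by (elim L_cases) (simp_all add: zero_prod_def assms(3-))
qed

lemma map_eq_4I:
  assumes "L.vanishes_above 4 1 A" "L.vanishes_above 4 1 B"
    and "\<And>x y z w. x \<in> V0 \<Longrightarrow> y \<in> V0 \<Longrightarrow> z \<in> V0 \<Longrightarrow> w \<in> V0 \<Longrightarrow>
      A [(x, 0), (y, 0), (z, 0), (w, 0)] = B [(x, 0), (y, 0), (z, 0), (w, 0)]"
    and "\<And>x y z a. x \<in> V0 \<Longrightarrow> y \<in> V0 \<Longrightarrow> z \<in> V0 \<Longrightarrow> a \<in> V1 \<Longrightarrow> a \<noteq> 0 \<Longrightarrow>
      A [(x, 0), (y, 0), (z, 0), (a, 0)] = B [(x, 0), (y, 0), (z, 0), (a, 0)]"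
    and "\<And>x y z a. x \<in> V0 \<Longrightarrow> y \<in> V0 \<Longrightarrow> z \<in> V0 \<Longrightarrow> a \<in> V1 \<Longrightarrow> a \<noteq> 0 \<Longrightarrow>
      A [(x, 0), (y, 0), (a, 0), (z, 0)] = B [(x, 0), (y, 0), (a, 0), (z, 0)]"
    and "\<And>x y z a. x \<in> V0 \<Longrightarrow> y \<in> V0 \<Longrightarrow> z \<in> V0 \<Longrightarrow> a \<in> V1 \<Longrightarrow> a \<noteq> 0 \<Longrightarrow>
      A [(x, 0), (a, 0), (y, 0), (z, 0)] = B [(x, 0), (a, 0), (y, 0), (z, 0)]"
    and "\<And>x y z a. x \<in> V0 \<Longrightarrow> y \<in> V0 \<Longrightarrow> z \<in> V0 \<Longrightarrow> a \<in> V1 \<Longrightarrow> a \<noteq> 0 \<Longrightarrow>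
      A [(a, 0), (x, 0), (y, 0), (z, 0)] = B [(a, 0), (x, 0), (y, 0), (z, 0)]"
  shows "map_eq L A 4 B"
proof (rule L.map_eqI_bounded[OF assms(1,2)])
  fix ds vs assume vs: "L.homogeneous ds vs" "length vs = 4" "0 \<notin> set vs" "sum_list ds \<le> 1"
  from vs(1,2) obtain i j k l u v w t where *: "vs = [u, v, w, t]" "ds = [i, j, k, l]"
    "u \<in> L i" "v \<in> L j" "w \<in> L k" "t \<in> L l"
    by (rule L_tuple_4)
  from *(3-6) vs(3,4) show "A vs = B vs" unfolding *(1,2)
    by (elim L_cases) (simp_all add: zero_prod_def assms(3-))
qed

lemma map_eq_5I:
  assumes "L.vanishes_above 5 0 A" "L.vanishes_above 5 0 B"
    and "\<And>x1 x2 x3 x4 x5. x1 \<in> V0 \<Longrightarrow> x2 \<in> V0 \<Longrightarrow> x3 \<in> V0 \<Longrightarrow> x4 \<in> V0 \<Longrightarrow> x5 \<in> V0 \<Longrightarrow>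
      A [(x1, 0), (x2, 0), (x3, 0), (x4, 0), (x5, 0)] = B [(x1, 0), (x2, 0), (x3, 0), (x4, 0), (x5, 0)]"
  shows "map_eq L A 5 B"
proof (rule L.map_eqI_bounded[OF assms(1,2)])
  fix ds vs assume vs: "L.homogeneous ds vs" "length vs = 5" "0 \<notin> set vs" "sum_list ds \<le> 0"
  from vs(1,2) obtain i j k l m u v w t r where *: "vs = [u, v, w, t, r]" "ds = [i, j, k, l, m]"
    "u \<in> L i" "v \<in> L j" "w \<in> L k" "t \<in> L l" "r \<in> L m"
    by (rule L_tuple_5)
  then have "u \<in> L 0" "v \<in> L 0" "w \<in> L 0" "t \<in> L 0" "r \<in> L 0" using vs(4) by auto
  then show "A vs = B vs" unfolding *(1) using assms(3) by (auto simp: L_simps)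
qed

lemmas d_eval = map_eval fun_apply_simps

lemma cyc_permutes:
  "cyc [1,2] permutes {1..3}" "cyc [1,2,3] permutes {1..3}" "cyc [2,3] permutes {1..3}" "cyc [1,3,2] permutes {1..3}"
  "cyc [1,2] permutes {1..4}" "cyc [1,2,3] permutes {1..4}" "cyc [2,3] permutes {1..4}" "cyc [1,3,2] permutes {1..4}"
  "cyc [3,4] permutes {1..4}"
  "cyc [1,2] permutes {1..2}"
  "cyc [1,2] permutes {1..5}" "cyc [1,2,3] permutes {1..5}" "cyc [1,2,3,4] permutes {1..5}"
  "cyc [2,3] permutes {1..5}" "cyc [1,3,2] permutes {1..5}"
  "cyc [2,3,4] permutes {1..5}" "cyc [1,3,4,2] permutes {1..5}" "cyc [1,3] \<circ> cyc [2,4] permutes {1..5}"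
  "cyc [3,4] permutes {1..5}" "cyc [2,4,3] permutes {1..5}" "cyc [1,4,3,2] permutes {1..5}"
  by (auto intro!: permutes_subset[OF cycle_permutes] permutes_compose simp del: cycle_of_list.simps)

text \<open>The Leibniz identity with one section of E1 is oriented so as to eliminate \<Omega> with
  an argument \<delta> a. Skew symmetry of \<Omega> brings all three positions to the same right
  side up to sign.\<close>

lemma Om_\<delta>:
  assumes "x \<in> V0" "y \<in> V0" "a \<in> V1"
  shows "Om x y (\<delta> a) = circ x (circ y a) - circ (circ x y) a - circ y (circ x a)"
    "Om x (\<delta> a) y = - (circ x (circ y a) - circ (circ x y) a - circ y (circ x a))"
    "Om (\<delta> a) x y = circ x (circ y a) - circ (circ x y) a - circ y (circ x a)"
proof -
  show 1: "Om x y (\<delta> a) = circ x (circ y a) - circ (circ x y) a - circ y (circ x a)"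
    using leibniz_001[of x y a] assms by simp
  show 2: "Om x (\<delta> a) y = - (circ x (circ y a) - circ (circ x y) a - circ y (circ x a))"
    using Om_skew(2)[of x y "\<delta> a"] assms unfolding 1 by simp
  show "Om (\<delta> a) x y = circ x (circ y a) - circ (circ x y) a - circ y (circ x a)"
    using Om_skew(1)[of x "\<delta> a" y] assms unfolding 2 by simp
qed

end

context graded_space
begin

text \<open>The triples in the definitions carry literal degrees, which do not match
  \<open>int q\<close>; stating the degrees through equations makes the rule applicable.\<close>

lemma graded_map_pcomp_deg:
  assumes "graded_map L m k \<mu>" "graded_map L r q \<nu>" "0 < i" "i \<le> m" "Suc n = m + r" "k' = k + q" "q' = int q"
  shows "graded_map L n k' (pcomp L \<mu> i (r, q', \<nu>))"
  using graded_map_pcomp[OF assms(1-5)] assms(6,7) by simp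

lemmas graded_map_pcomp_num =
  graded_map_pcomp_deg[where q = 0 and q' = 0] graded_map_pcomp_deg[where q = 1 and q' = 1]
  graded_map_pcomp_deg[where q = 2 and q' = 2]

end

context clwx
begin

lemma Om_skew_sum [simp]:
  "x \<in> V0 \<Longrightarrow> y \<in> V0 \<Longrightarrow> z \<in> V0 \<Longrightarrow> Om x y z + Om y x z = 0"
  "x \<in> V0 \<Longrightarrow> y \<in> V0 \<Longrightarrow> z \<in> V0 \<Longrightarrow> Om x y z + Om x z y = 0"
  by (simp_all add: Om_skew(1)[of x y z] Om_skew(2)[of x y z])

lemma pair_zero: "(0 :: ('m \<Rightarrow> 'e) \<times> ('m \<Rightarrow> real)) = (0, 0)"
  by (simp add: zero_prod_def)

lemma circ_skew_sum [simp]: "x \<in> V0 \<Longrightarrow> y \<in> V0 \<Longrightarrow> circ x y + circ y x = 0"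
  using circ_skew[of y x] by simp

text \<open>These rules define the normal form: sections of E1 stand in the second slot of the
  product, the second slot of the pairing contains no product, and \<Omega> has no argument \<delta>
  a. The remaining freedom is skew symmetry of products and of \<Omega>, which is supplied case by
  case.\<close>

lemmas ev = d_eval P_\<delta> Om_\<delta> P_circ circ_10 pair_zero scaleR_prod_def uminus_prod_def

lemma graded_pcomp_zero: "graded_map L n k (pcomp L 0 i B)"
  by (simp add: L.graded_map_zero)

lemmas grades = graded_pcomp_zero L.graded_map_zero graded_l2 graded_s graded_\<Omega> graded_b2 graded_b3 graded_b4
lemmas gradedI = L.graded_map_diff L.graded_map_add L.graded_map_uminus L.graded_map_perm cyc_permutes
  L.graded_map_pcomp_num
lemmas zero_maps = pcomp_zero perm_zero add_0_left add_0_right diff_zero diff_self minus_zero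

text \<open>The product a \<circ> \<delta> b equals \<delta> a \<circ> b by compatibility with
  \<delta>, and \<open>circ_10\<close> relates it to \<delta> b \<circ> a. This settles the case of
  two sections of E1.\<close>

lemma circ_\<delta>_skew: "a \<in> V1 \<Longrightarrow> b \<in> V1 \<Longrightarrow> circ (\<delta> b) a = D (P (\<delta> a) b) - circ (\<delta> a) b"
  using circ_\<delta>[of a b] circ_10[of "\<delta> b" a] P_\<delta>[of a b] by simp

section \<open>Identities of the weak Lie 3-algebra\<close>

lemma boundary_l2: "map_eq L (boundary L d 0 l2) 2 0"
proof (rule map_eq_2I, goal_cases)
  case 1
  show ?case by (rule L.vanishes_boundary[OF graded_l2]) simp
next
  case 2
  show ?case by (rule L.vanishes_zero)
next
  case (5 x a)
  then show ?case using circ_skew[of "\<delta> a" x] by (simp add: ev)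
next
  case (6 a b)
  then show ?case using circ_\<delta>_skew[of a b] by (simp add: ev)
qed (simp_all add: ev)

text \<open>Without functions among the arguments this is the Leibniz identity of the algebroid. On
  (x, y, f) it says that \<rho>(x \<circ> y) is the commutator of \<rho>(x) and \<rho>(y).\<close>

lemma boundary_l3: "map_eq L (boundary L d 1 \<Omega>) 3
   (pcomp L l2 2 (2, 0, l2) - pcomp L l2 1 (2, 0, l2) - perm L (pcomp L l2 2 (2, 0, l2)) (cyc [1,2]))"
proof (rule map_eq_3I, goal_cases)
  case 1
  show ?case by (rule L.vanishes_boundary[OF graded_\<Omega>]) simp
next
  case 2
  show ?case
    by (rule L.vanishes_graded[where k = 0]) ((rule grades gradedI | simp del: One_nat_def cycle_of_list.simps)+)
qed (simp_all add: ev leibniz_000 del: cycle_of_list.simps)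

text \<open>Each type of pair is one property of S: (x, a) is the polarized axiom (iii), (a, b) is
  the self-adjointness (iv), and (x, f) is the definition of D.\<close>

lemma boundary_l21: "map_eq L (boundary L d 1 s) 2 (l2 + perm L l2 (cyc [1,2]))"
proof (rule map_eq_2I, goal_cases)
  case 1
  show ?case by (rule L.vanishes_boundary[OF graded_s]) simp
next
  case 2
  show ?case
    by (rule L.vanishes_graded[where k = 0]) ((rule grades gradedI | simp del: One_nat_def cycle_of_list.simps)+)
qed (simp_all add: ev del: cycle_of_list.simps)

lemma boundary_l211: "map_eq L (boundary L d 2 0) 2 (s - perm L s (cyc [1,2]))"
proof (rule map_eq_2I, goal_cases)
  case 1
  show ?case by (rule L.vanishes_boundary[OF L.graded_map_zero[where k = 0]]) simp
next
  case 2
  show ?case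
    by (rule L.vanishes_graded[where k = 1]) ((rule grades gradedI | simp del: One_nat_def cycle_of_list.simps)+)
qed (simp_all add: ev del: cycle_of_list.simps)

text \<open>A function in the first slot of \<open>l2\<close> gives zero, so the term with S drops
  out and skew symmetry of \<Omega> remains.\<close>

lemma boundary_l31: "map_eq L (boundary L d 2 0) 3 (\<Omega> + perm L \<Omega> (cyc [1,2]) + pcomp L l2 1 (2, 1, s))"
proof (rule map_eq_3I, goal_cases)
  case 1
  show ?case by (rule L.vanishes_boundary[OF L.graded_map_zero[where k = 1]]) simp
next
  case 2
  show ?case
    by (rule L.vanishes_graded[where k = 1]) ((rule grades gradedI | simp del: One_nat_def cycle_of_list.simps)+)
qed (simp_all add: ev del: cycle_of_list.simps)

text \<open>Besides skew symmetry of \<Omega> this is the invariance axiom (v): S inserted into the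
  second slot of \<open>l2\<close> is \<rho>(x) S(y, z).\<close>

lemma boundary_l32: "map_eq L (boundary L d 2 0) 3 (\<Omega> + perm L \<Omega> (cyc [2,3]) - pcomp L l2 2 (2, 1, s)
    + pcomp L s 1 (2, 0, l2) + perm L (pcomp L s 2 (2, 0, l2)) (cyc [1,2]))"
proof (rule map_eq_3I, goal_cases)
  case 1
  show ?case by (rule L.vanishes_boundary[OF L.graded_map_zero[where k = 1]]) simp
next
  case 2
  show ?case
    by (rule L.vanishes_graded[where k = 1]) ((rule grades gradedI | simp del: One_nat_def cycle_of_list.simps)+)
next
  case (6 x y a)
  then show ?case using circ_skew[of y x] by (simp add: ev del: cycle_of_list.simps)
qed (simp_all add: ev del: cycle_of_list.simps)

text \<open>On four sections of E0 this is the coherence identity of \<Omega>. With one section of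
  E1 each term contains \<Omega> with an argument in E1 or a product of two sections of E1, and is
  zero.\<close>

lemma boundary_l4: "map_eq L (boundary L d 2 0) 4 (pcomp L l2 1 (3, 1, \<Omega>) + pcomp L l2 2 (3, 1, \<Omega>)
   - perm L (pcomp L l2 2 (3, 1, \<Omega>)) (cyc [1,2]) + perm L (pcomp L l2 2 (3, 1, \<Omega>)) (cyc [1,2,3])
   - pcomp L \<Omega> 1 (2, 0, l2) + pcomp L \<Omega> 2 (2, 0, l2) - perm L (pcomp L \<Omega> 2 (2, 0, l2)) (cyc [1,2])
   - pcomp L \<Omega> 3 (2, 0, l2) + perm L (pcomp L \<Omega> 3 (2, 0, l2)) (cyc [2,3])
   - perm L (pcomp L \<Omega> 3 (2, 0, l2)) (cyc [1,3,2]))"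
proof (rule map_eq_4I, goal_cases)
  case 1
  show ?case
    by (rule L.vanishes_boundary[OF L.graded_map_zero[where k = 2]]) simp
next
  case 2
  show ?case
    by (rule L.vanishes_graded[where k = 1]) ((rule grades gradedI | simp del: One_nat_def cycle_of_list.simps)+)
next
  case (3 x y z w)
  then show ?case
    using Om_cocycle[of x y z w] by (simp add: ev del: cycle_of_list.simps)
qed (simp_all add: ev del: cycle_of_list.simps)

lemma pentagon_l2: "map_eq L (0) 5 (pcomp L l2 1 (4, 2, 0)
   - pcomp L l2 2 (4, 2, 0) + perm L (pcomp L l2 2 (4, 2, 0)) (cyc [1,2]) - perm L (pcomp L l2 2 (4, 2, 0)) (cyc [1,2,3])
   + perm L (pcomp L l2 2 (4, 2, 0)) (cyc [1,2,3,4])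
   + pcomp L \<Omega> 1 (3, 1, \<Omega>)
   + pcomp L \<Omega> 2 (3, 1, \<Omega>) - perm L (pcomp L \<Omega> 2 (3, 1, \<Omega>)) (cyc [1,2]) + perm L (pcomp L \<Omega> 2 (3, 1, \<Omega>)) (cyc [1,2,3])
   + pcomp L \<Omega> 3 (3, 1, \<Omega>) - perm L (pcomp L \<Omega> 3 (3, 1, \<Omega>)) (cyc [2,3]) + perm L (pcomp L \<Omega> 3 (3, 1, \<Omega>)) (cyc [1,3,2])
   + perm L (pcomp L \<Omega> 3 (3, 1, \<Omega>)) (cyc [2,3,4]) - perm L (pcomp L \<Omega> 3 (3, 1, \<Omega>)) (cyc [1,3,4,2])
   + perm L (pcomp L \<Omega> 3 (3, 1, \<Omega>)) (cyc [1,3] \<circ> cyc [2,4])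
   + pcomp L 0 1 (2, 0, l2)
   - pcomp L 0 2 (2, 0, l2) + perm L (pcomp L 0 2 (2, 0, l2)) (cyc [1,2])
   + pcomp L 0 3 (2, 0, l2) - perm L (pcomp L 0 3 (2, 0, l2)) (cyc [2,3]) + perm L (pcomp L 0 3 (2, 0, l2)) (cyc [1,3,2])
   - pcomp L 0 4 (2, 0, l2) + perm L (pcomp L 0 4 (2, 0, l2)) (cyc [3,4]) - perm L (pcomp L 0 4 (2, 0, l2)) (cyc [2,4,3])
   + perm L (pcomp L 0 4 (2, 0, l2)) (cyc [1,4,3,2]))"
proof (rule map_eq_5I, goal_cases)
  case 1
  show ?case
    by (rule L.vanishes_zero)
next
  case 2
  show ?case
    by (rule L.vanishes_graded[where k = 2]) ((rule grades gradedI | simp del: One_nat_def cycle_of_list.simps)+)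
qed (simp_all add: ev del: cycle_of_list.simps)

lemma symmetry_l31: "map_eq L (0) 3 (pcomp L l2 1 (2, 2, 0))"
proof (rule map_eq_3I, goal_cases)
  case 1
  show ?case
    by (rule L.vanishes_zero)
next
  case 2
  show ?case
    by (rule L.vanishes_graded[where k = 2]) ((rule grades gradedI | simp del: One_nat_def cycle_of_list.simps)+)
qed (simp_all add: ev del: cycle_of_list.simps)

lemma hexagon_l21: "map_eq L (0) 3 (pcomp L s 2 (2, 1, s) + pcomp L s 1 (2, 1, s) + perm L (pcomp L s 2 (2, 1, s)) (cyc [1,2]))"
proof (rule map_eq_3I, goal_cases)
  case 1
  show ?case
    by (rule L.vanishes_zero)
next
  case 2
  show ?case
    by (rule L.vanishes_graded[where k = 2]) ((rule grades gradedI | simp del: One_nat_def cycle_of_list.simps)+)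
qed (simp_all add: ev del: cycle_of_list.simps)

lemma symmetry_l32: "map_eq L (0) 3 (- pcomp L l2 2 (2, 2, 0))"
proof (rule map_eq_3I, goal_cases)
  case 1
  show ?case
    by (rule L.vanishes_zero)
next
  case 2
  show ?case
    by (rule L.vanishes_graded[where k = 2]) ((rule grades gradedI | simp del: One_nat_def cycle_of_list.simps)+)
qed (simp_all add: ev del: cycle_of_list.simps)

lemma symmetry_l4_12: "map_eq L (0) 4 (pcomp L l2 1 (3, 2, 0) + perm L (pcomp L l2 2 (3, 2, 0)) (cyc [1,2,3]) + pcomp L \<Omega> 1 (2, 1, s))"
proof (rule map_eq_4I, goal_cases)
  case 1
  show ?case
    by (rule L.vanishes_zero)
next
  case 2
  show ?case
    by (rule L.vanishes_graded[where k = 2]) ((rule grades gradedI | simp del: One_nat_def cycle_of_list.simps)+)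
qed (simp_all add: ev del: cycle_of_list.simps)

lemma symmetry_l4_23: "map_eq L (0) 4 (pcomp L l2 1 (3, 2, 0) - pcomp L \<Omega> 2 (2, 1, s) + pcomp L l2 2 (3, 2, 0))"
proof (rule map_eq_4I, goal_cases)
  case 1
  show ?case
    by (rule L.vanishes_zero)
next
  case 2
  show ?case
    by (rule L.vanishes_graded[where k = 2]) ((rule grades gradedI | simp del: One_nat_def cycle_of_list.simps)+)
qed (simp_all add: ev del: cycle_of_list.simps)

text \<open>The two terms that survive on E0 are axiom (vi): S(\<Omega>(x, y, z), w) + S(z,
  \<Omega>(x, y, w)) = 0.\<close>

lemma symmetry_l4_34: "map_eq L (0) 4 (pcomp L s 1 (3, 1, \<Omega>) + pcomp L \<Omega> 3 (2, 1, s) + pcomp L l2 2 (3, 2, 0) - perm L (pcomp L l2 2 (3, 2, 0)) (cyc [1,2]) + perm L (pcomp L s 2 (3, 1, \<Omega>)) (cyc [1,2,3]))"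
proof (rule map_eq_4I, goal_cases)
  case 1
  show ?case
    by (rule L.vanishes_zero)
next
  case 2
  show ?case
    by (rule L.vanishes_graded[where k = 2]) ((rule grades gradedI | simp del: One_nat_def cycle_of_list.simps)+)
next
  case (3 x y z w)
  then show ?case
    using Q_skew(3)[of x y z w] by (simp add: ev Q_def del: cycle_of_list.simps)
qed (simp_all add: ev del: cycle_of_list.simps)

section \<open>Identities of the skew-symmetrization\<close>

lemma b3_degree_2 [simp]:
  "x \<in> V0 \<Longrightarrow> a \<in> V1 \<Longrightarrow> b \<in> V1 \<Longrightarrow> b3 [(x, 0), (a, 0), (b, 0)] = (0, 0)"
  "x \<in> V0 \<Longrightarrow> a \<in> V1 \<Longrightarrow> b \<in> V1 \<Longrightarrow> b3 [(a, 0), (x, 0), (b, 0)] = (0, 0)"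
  "x \<in> V0 \<Longrightarrow> a \<in> V1 \<Longrightarrow> b \<in> V1 \<Longrightarrow> b3 [(a, 0), (b, 0), (x, 0)] = (0, 0)"
  "x \<in> V0 \<Longrightarrow> y \<in> V0 \<Longrightarrow> f \<in> F \<Longrightarrow> b3 [(x, 0), (y, 0), (0, f)] = (0, 0)"
  "x \<in> V0 \<Longrightarrow> y \<in> V0 \<Longrightarrow> f \<in> F \<Longrightarrow> b3 [(x, 0), (0, f), (y, 0)] = (0, 0)"
  "x \<in> V0 \<Longrightarrow> y \<in> V0 \<Longrightarrow> f \<in> F \<Longrightarrow> b3 [(0, f), (x, 0), (y, 0)] = (0, 0)"
  using L.above_2[OF L.graded_map_mem[OF graded_b3, of "[0,1,1]"]] L.above_2[OF L.graded_map_mem[OF graded_b3, of "[1,0,1]"]]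
    L.above_2[OF L.graded_map_mem[OF graded_b3, of "[1,1,0]"]] L.above_2[OF L.graded_map_mem[OF graded_b3, of "[0,0,2]"]]
    L.above_2[OF L.graded_map_mem[OF graded_b3, of "[0,2,0]"]] L.above_2[OF L.graded_map_mem[OF graded_b3, of "[2,0,0]"]]
  by (simp_all add: L_simps pair_zero)

lemma b4_degree_1 [simp]:
  "x \<in> V0 \<Longrightarrow> y \<in> V0 \<Longrightarrow> z \<in> V0 \<Longrightarrow> a \<in> V1 \<Longrightarrow> b4 [(x, 0), (y, 0), (z, 0), (a, 0)] = (0, 0)"
  "x \<in> V0 \<Longrightarrow> y \<in> V0 \<Longrightarrow> z \<in> V0 \<Longrightarrow> a \<in> V1 \<Longrightarrow> b4 [(x, 0), (y, 0), (a, 0), (z, 0)] = (0, 0)"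
  "x \<in> V0 \<Longrightarrow> y \<in> V0 \<Longrightarrow> z \<in> V0 \<Longrightarrow> a \<in> V1 \<Longrightarrow> b4 [(x, 0), (a, 0), (y, 0), (z, 0)] = (0, 0)"
  "x \<in> V0 \<Longrightarrow> y \<in> V0 \<Longrightarrow> z \<in> V0 \<Longrightarrow> a \<in> V1 \<Longrightarrow> b4 [(a, 0), (x, 0), (y, 0), (z, 0)] = (0, 0)"
  using L.above_2[OF L.graded_map_mem[OF graded_b4, of "[0,0,0,1]"]] L.above_2[OF L.graded_map_mem[OF graded_b4, of "[0,0,1,0]"]]
    L.above_2[OF L.graded_map_mem[OF graded_b4, of "[0,1,0,0]"]] L.above_2[OF L.graded_map_mem[OF graded_b4, of "[1,0,0,0]"]]
  by (simp_all add: L_simps pair_zero)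

lemma Q_mem [simp]: "x \<in> V0 \<Longrightarrow> y \<in> V0 \<Longrightarrow> z \<in> V0 \<Longrightarrow> w \<in> V0 \<Longrightarrow> Q x y z w \<in> F"
  by (simp add: Q_def)

text \<open>Compatibility and self-adjointness of \<delta> turn the left side into the pairing of
  \<delta> b with x \<circ> a, to which invariance applies. The right side contains an instance of
  the same pattern with a and b exchanged, so the rule is used at chosen instances.\<close>

lemma P_circ_\<delta>:
  assumes "x \<in> V0" "a \<in> V1" "b \<in> V1"
  shows "P (circ x (\<delta> a)) b = \<rho> x (P (\<delta> a) b) - P (circ x (\<delta> b)) a"
proof -
  have "P (circ x (\<delta> a)) b = P (\<delta> (circ x a)) b" using assms by simp
  moreover have "P (\<delta> (circ x a)) b = P (\<delta> b) (circ x a)" using assms by (intro P_\<delta>) simp_all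
  moreover have "P (\<delta> b) (circ x a) = \<rho> x (P (\<delta> b) a) - P (circ x (\<delta> b)) a"
    using assms by (intro P_circ) simp_all
  moreover have "P (\<delta> b) a = P (\<delta> a) b" using assms by (intro P_\<delta>)
  ultimately show ?thesis by simp
qed

text \<open>Self-adjointness of \<delta> replaces \<Omega> by \<delta> \<Omega>, the failure of the
  Leibniz identity on E0.\<close>

lemma P_\<delta>_Om:
  assumes "x \<in> V0" "y \<in> V0" "z \<in> V0" "a \<in> V1"
  shows "P (\<delta> a) (Om x y z) = P (circ x (circ y z)) a - P (circ (circ x y) z) a - P (circ y (circ x z)) a"
proof -
  have "P (\<delta> a) (Om x y z) = P (\<delta> (Om x y z)) a" using assms by (intro P_\<delta>) simp_all
  then show ?thesis using assms by (simp add: leibniz_000[symmetric])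
qed

lemma boundary_b2: "map_eq L (boundary L d 0 b2) 2 (0)"
proof (rule map_eq_2I, goal_cases)
  case 1
  show ?case
    by (rule L.vanishes_boundary, (rule grades)+) simp
next
  case 2
  show ?case
    by (rule L.vanishes_zero)
next
  case (5 x a)
  then show ?case using circ_skew[of "\<delta> a" x] by (simp add: ev)
next
  case (6 a b)
  then show ?case using circ_\<delta>_skew[of a b]
    by (simp add: ev) (rule eq_by_linear_functionals, simp add: linear_functional_simps)
next
  case (7 x f)
  \<comment> \<open>Both D of 1/2 \<rho>(x) f and the product of x with Df are 1/2 D(\<rho>(x) f);
    for the second, x \<circ> Df = D(\<rho>(x) f) loses half of itself in \<open>b2\<close>.\<close>
  then show ?case by (simp add: ev) (rule eq_by_linear_functionals, simp add: linear_functional_simps)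
next
  case (8 x f)
  then show ?case by (simp add: ev) (rule eq_by_linear_functionals, simp add: linear_functional_simps)
qed (simp_all add: ev del: cycle_of_list.simps)

lemma boundary_b3: "map_eq L (boundary L d 1 b3) 3 (pcomp L b2 2 (2, 0, b2) - pcomp L b2 1 (2, 0, b2) - perm L (pcomp L b2 2 (2, 0, b2)) (cyc [1,2]))"
proof (rule map_eq_3I, goal_cases)
  case 1
  show ?case
    by (rule L.vanishes_boundary, (rule grades)+) simp
next
  case 2
  show ?case
    by (rule L.vanishes_graded[where k = 0]) ((rule grades gradedI | simp del: One_nat_def cycle_of_list.simps)+)
next
  case (3 x y z)
  then show ?case by (simp add: ev leibniz_000 del: cycle_of_list.simps)
\<comment> \<open>On (x, y, a) the boundary of \<open>b3\<close> is D T(x, y, a) + \<Omega>(x, y,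
  \<delta> a): the second term gives the Leibniz identity, the first compensates the D-terms in
  \<open>b2\<close>.\<close>
next
  case (4 x y a)
  then show ?case using circ_skew[of y x]
    by (simp add: ev T_def del: cycle_of_list.simps)
      (rule eq_by_linear_functionals, simp add: linear_functional_simps)
next
  case (5 x y a)
  then show ?case using circ_skew[of y x]
    by (simp add: ev T_def del: cycle_of_list.simps)
      (rule eq_by_linear_functionals, simp add: linear_functional_simps)
next
  case (6 x y a)
  then show ?case using circ_skew[of y x]
    by (simp add: ev T_def del: cycle_of_list.simps)
      (rule eq_by_linear_functionals, simp add: linear_functional_simps)
next
  case (7 x a b)
  then show ?case using P_circ_\<delta>[of x a b]
    by (simp add: ev T_def del: cycle_of_list.simps)
      (rule eq_by_linear_functionals, simp add: linear_functional_simps)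
next
  case (8 x a b)
  then show ?case using circ_skew[of "\<delta> a" x] P_circ_\<delta>[of x a b]
    by (simp add: ev T_def del: cycle_of_list.simps)
      (rule eq_by_linear_functionals, simp add: linear_functional_simps)
next
  case (9 x a b)
  then show ?case using circ_skew[of "\<delta> a" x] circ_skew[of "\<delta> b" x] P_circ_\<delta>[of x a b]
    by (simp add: ev T_def del: cycle_of_list.simps)
      (rule eq_by_linear_functionals, simp add: linear_functional_simps)
next
  \<comment> \<open>Both sides are -1/4 times the commutator of \<rho>(x) and \<rho>(y) applied to
    f; in T(x, y, Df) the product contributes -1/2 and the anchor terms 1/4.\<close>
  case (10 x y f)
  then show ?case
    by (simp add: ev T_def del: cycle_of_list.simps)
next
  case (11 x y f)
  then show ?case
    by (simp add: ev T_def del: cycle_of_list.simps)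
next
  case (12 x y f)
  then show ?case
    by (simp add: ev T_def del: cycle_of_list.simps)
qed

lemma Q_move:
  assumes "x \<in> V0" "y \<in> V0" "z \<in> V0" "w \<in> V0"
  shows "Q x y w z = - Q x y z w" "Q x z w y = Q x y z w" "Q y z w x = - Q x y z w"
  using assms Q_skew(3)[of x y z w] Q_skew(3)[of x z y w] Q_skew(2)[of x y z w]
    Q_skew(3)[of y z x w] Q_skew(2)[of y x z w] Q_skew(1)[of x y z w] by simp_all

lemma boundary_b4: "map_eq L (boundary L d 2 b4) 4 (pcomp L b2 1 (3, 1, b3) + pcomp L b2 2 (3, 1, b3)
   - perm L (pcomp L b2 2 (3, 1, b3)) (cyc [1,2]) + perm L (pcomp L b2 2 (3, 1, b3)) (cyc [1,2,3])
   - pcomp L b3 1 (2, 0, b2) + pcomp L b3 2 (2, 0, b2) - perm L (pcomp L b3 2 (2, 0, b2)) (cyc [1,2])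
   - pcomp L b3 3 (2, 0, b2) + perm L (pcomp L b3 3 (2, 0, b2)) (cyc [2,3])
   - perm L (pcomp L b3 3 (2, 0, b2)) (cyc [1,3,2]))"
proof (rule map_eq_4I, goal_cases)
  case 1
  show ?case
    by (rule L.vanishes_boundary, (rule grades)+) simp
next
  case 2
  show ?case
    by (rule L.vanishes_graded[where k = 1]) ((rule grades gradedI | simp del: One_nat_def cycle_of_list.simps)+)
next
  case (3 x y z w)
  note V = 3
  have Q: "P w (Om x y z) = Q x y z w" "P x (Om y z w) = - Q x y z w" "P y (Om x z w) = Q x y z w"
    "P z (Om x y w) = - Q x y z w"
    using V Q_move[of x y z w] by (simp_all add: Q_def)
  \<comment> \<open>The right side is the evaluated sum of compositions. Its four pairings together
    give 2 D Q, and the coherence identity, with \<open>circ_10\<close> applied to its first term,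
    shows that the rest is -D Q.\<close>
  have "D (Q x y z w) =
      (1/2) *\<^sub>R D (P w (Om x y z)) - circ w (Om x y z)
      + (circ x (Om y z w) - (1/2) *\<^sub>R D (P x (Om y z w)))
      - (circ y (Om x z w) - (1/2) *\<^sub>R D (P y (Om x z w)))
      + (circ z (Om x y w) - (1/2) *\<^sub>R D (P z (Om x y w)))
      - Om (circ x y) z w + Om x (circ y z) w - Om y (circ x z) w
      - Om x y (circ z w) + Om x z (circ y w) - Om y z (circ x w)" (is "?l = ?r")
  proof (rule eq_by_linear_functionals)
    fix \<phi> :: "('m \<Rightarrow> 'e) \<Rightarrow> real" assume \<phi>: "linear \<phi>"
    show "\<phi> ?l = \<phi> ?r"
      using arg_cong[OF Om_cocycle[OF V], of \<phi>] V
      by (simp add: Q circ_10 \<phi> linear_functional_simps)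
  qed
  moreover have "Q 0 y z w = 0" using V by (simp add: Q_def)
  ultimately show ?case
    using V by (simp add: ev del: cycle_of_list.simps)
next
  \<comment> \<open>The left side is, up to sign, the pairing of \<delta> a with \<Omega>(x, y, z),
    hence the failure of the Leibniz identity on E0 paired with a. The instances of skew symmetry
    choose one order for each nested product.\<close>
  case (4 x y z a)
  then show ?case
    using P_\<delta>_Om[of x y z a] circ_skew[of y x] circ_skew[of z x] circ_skew[of z y]
      circ_skew[of z "circ x y"] circ_skew[of y "circ x z"] circ_skew[of x "circ y z"]
    by (simp add: ev T_def Q_def del: cycle_of_list.simps)
      (rule eq_by_linear_functionals, simp add: linear_functional_simps)
next
  case (5 x y z a)
  then show ?case
    using P_\<delta>_Om[of x y z a] circ_skew[of y x] circ_skew[of z x] circ_skew[of z y]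
      circ_skew[of z "circ x y"] circ_skew[of y "circ x z"] circ_skew[of x "circ y z"]
    by (simp add: ev T_def Q_def del: cycle_of_list.simps)
      (rule eq_by_linear_functionals, simp add: linear_functional_simps)
next
  case (6 x y z a)
  then show ?case
    using P_\<delta>_Om[of x y z a] circ_skew[of y x] circ_skew[of z x] circ_skew[of z y]
      circ_skew[of z "circ x y"] circ_skew[of y "circ x z"] circ_skew[of x "circ y z"]
    by (simp add: ev T_def Q_def del: cycle_of_list.simps)
      (rule eq_by_linear_functionals, simp add: linear_functional_simps)
next
  case (7 x y z a)
  then show ?case
    using P_\<delta>_Om[of x y z a] circ_skew[of y x] circ_skew[of z x] circ_skew[of z y]
      circ_skew[of z "circ x y"] circ_skew[of y "circ x z"] circ_skew[of x "circ y z"]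
    by (simp add: ev T_def Q_def del: cycle_of_list.simps)
      (rule eq_by_linear_functionals, simp add: linear_functional_simps)
qed

text \<open>The multiple is 3/2 up to sign. Every term with a product gets 1 from \<open>b2\<close>
  inside \<open>b4\<close> and 1/2 from \<open>b3\<close> inside \<open>b3\<close>; every anchor
  term gets 1/2 from \<open>b4\<close> inside \<open>b2\<close> and four times 1/4 from
  \<open>b3\<close> inside \<open>b3\<close>.\<close>

lemma pentagon_b: "map_eq L (0) 5 (pcomp L b2 1 (4, 2, b4)
   - pcomp L b2 2 (4, 2, b4) + perm L (pcomp L b2 2 (4, 2, b4)) (cyc [1,2]) - perm L (pcomp L b2 2 (4, 2, b4)) (cyc [1,2,3])
   + perm L (pcomp L b2 2 (4, 2, b4)) (cyc [1,2,3,4])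
   + pcomp L b3 1 (3, 1, b3)
   + pcomp L b3 2 (3, 1, b3) - perm L (pcomp L b3 2 (3, 1, b3)) (cyc [1,2]) + perm L (pcomp L b3 2 (3, 1, b3)) (cyc [1,2,3])
   + pcomp L b3 3 (3, 1, b3) - perm L (pcomp L b3 3 (3, 1, b3)) (cyc [2,3]) + perm L (pcomp L b3 3 (3, 1, b3)) (cyc [1,3,2])
   + perm L (pcomp L b3 3 (3, 1, b3)) (cyc [2,3,4]) - perm L (pcomp L b3 3 (3, 1, b3)) (cyc [1,3,4,2])
   + perm L (pcomp L b3 3 (3, 1, b3)) (cyc [1,3] \<circ> cyc [2,4])
   + pcomp L b4 1 (2, 0, b2)
   - pcomp L b4 2 (2, 0, b2) + perm L (pcomp L b4 2 (2, 0, b2)) (cyc [1,2])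
   + pcomp L b4 3 (2, 0, b2) - perm L (pcomp L b4 3 (2, 0, b2)) (cyc [2,3]) + perm L (pcomp L b4 3 (2, 0, b2)) (cyc [1,3,2])
   - pcomp L b4 4 (2, 0, b2) + perm L (pcomp L b4 4 (2, 0, b2)) (cyc [3,4]) - perm L (pcomp L b4 4 (2, 0, b2)) (cyc [2,4,3])
   + perm L (pcomp L b4 4 (2, 0, b2)) (cyc [1,4,3,2]))"
proof (rule map_eq_5I, goal_cases)
  case 1
  show ?case
    by (rule L.vanishes_zero)
next
  case 2
  show ?case
    by (rule L.vanishes_graded[where k = 2]) ((rule grades gradedI | simp del: One_nat_def cycle_of_list.simps)+)
next
  case (3 x1 x2 x3 x4 x5)
  note V = 3
  have T_Q: "T x y (Om u v w) = - ((1/2) *\<^sub>R Q u v w (circ x y)) - (1/4) *\<^sub>R \<rho> y (Q u v w x) + (1/4) *\<^sub>R \<rho> x (Q u v w y)"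
    for x y u v w by (simp add: T_def Q_def)
  note moves = Q_move[OF V(1) V(2) V(3) V(4)] Q_move[OF V(1) V(2) V(3) V(5)] Q_move[OF V(1) V(2) V(4) V(5)] Q_move[OF V(1) V(3) V(4) V(5)] Q_move[OF V(2) V(3) V(4) V(5)]
  \<comment> \<open>A product is moved to the last slot of Q, where \<open>T_Q\<close> also puts
    it.\<close>
  have Q_circ: "Q (circ x y) u v w = - Q u v w (circ x y)" "Q u (circ x y) v w = Q u v w (circ x y)"
    "Q u v (circ x y) w = - Q u v w (circ x y)"
    if "x \<in> V0" "y \<in> V0" "u \<in> V0" "v \<in> V0" "w \<in> V0" for x y u v w
    using that Q_move[of "circ x y" u v w] Q_move[of u "circ x y" v w] Q_move[of u v "circ x y" w] by simp_all
  have "P x5 (circ (Om x1 x2 x3) x4 + circ x1 (Om x2 x3 x4) - circ x2 (Om x1 x3 x4) + circ x3 (Om x1 x2 x4)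
    - Om (circ x1 x2) x3 x4 + Om x1 (circ x2 x3) x4 - Om x2 (circ x1 x3) x4
    - Om x1 x2 (circ x3 x4) + Om x1 x3 (circ x2 x4) - Om x2 x3 (circ x1 x4)) = 0"
    using Om_cocycle[OF V(1-4)] V(5) by simp
  \<comment> \<open>There are five anchor terms and ten products. The anchor term of x5 comes from
    \<open>circ_10\<close>; the other four, and the products with x5, come from
    \<open>P_circ\<close>.\<close>
  then have "\<rho> x5 (Q x1 x2 x3 x4) - (\<rho> x4 (Q x1 x2 x3 x5) - Q x1 x2 x3 (circ x4 x5))
      + (\<rho> x1 (Q x2 x3 x4 x5) - Q x2 x3 x4 (circ x1 x5)) - (\<rho> x2 (Q x1 x3 x4 x5) - Q x1 x3 x4 (circ x2 x5))
      + (\<rho> x3 (Q x1 x2 x4 x5) - Q x1 x2 x4 (circ x3 x5))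
      - Q (circ x1 x2) x3 x4 x5 + Q x1 (circ x2 x3) x4 x5 - Q x2 (circ x1 x3) x4 x5
      - Q x1 x2 (circ x3 x4) x5 + Q x1 x3 (circ x2 x4) x5 - Q x2 x3 (circ x1 x4) x5 = 0"
    using V by (simp add: circ_10 P_circ Q_def)
  \<comment> \<open>Solving for the anchor term of x5 gives a rewrite rule that eliminates it from
    the goal.\<close>
  then have E: "\<rho> x5 (Q x1 x2 x3 x4) = (\<rho> x4 (Q x1 x2 x3 x5) - Q x1 x2 x3 (circ x4 x5))
      - (\<rho> x1 (Q x2 x3 x4 x5) - Q x2 x3 x4 (circ x1 x5)) + (\<rho> x2 (Q x1 x3 x4 x5) - Q x1 x3 x4 (circ x2 x5))
      - (\<rho> x3 (Q x1 x2 x4 x5) - Q x1 x2 x4 (circ x3 x5))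
      + Q (circ x1 x2) x3 x4 x5 - Q x1 (circ x2 x3) x4 x5 + Q x2 (circ x1 x3) x4 x5
      + Q x1 x2 (circ x3 x4) x5 - Q x1 x3 (circ x2 x4) x5 + Q x2 x3 (circ x1 x4) x5"
    by (simp add: algebra_simps)
  show ?case
    using V by (simp add: ev T_Q Q_circ moves E del: cycle_of_list.simps)
      (rule eq_by_linear_functionals, simp add: linear_functional_simps)
qed

section \<open>Explicit formulas for the skew-symmetrized maps\<close>

lemma b2_formula: "map_eq L b2 2
  ((1/2) *\<^sub>R (ext_circ circ - perm L (ext_circ circ) (cyc [1,2]) - pcomp L s 1 (1, -1, ext_D D)
     + pcomp L s 2 (1, -1, ext_D D)))"
  unfolding map_eq_def
proof
  fix vs assume "vs \<in> homogeneous_tuples L 2"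
  then obtain ds where "L.homogeneous ds vs" "length vs = 2"
    by (auto simp: L.homogeneous_tuples_iff)
  then obtain i j u v where vs: "vs = [u, v]" "u \<in> L i" "v \<in> L j"
    by (rule L_tuple_2)
  then have uv: "homog u" "homog v" by (auto intro: homogI)
  have C: "perm L (ext_circ circ) (cyc [1,2]) [u, v] = ext_circ circ [v, u]"
  proof -
    \<comment> \<open>On homogeneous pairs the product is the first component of \<open>l2\<close>,
      so the vanishing of \<open>l2\<close> carries over.\<close>
    have "L.sparse_map 2 (ext_circ circ)"
      using sparse_l2 unfolding L.sparse_map_def
    proof (intro allI impI)
      fix ds vs assume *: "\<forall>ds vs. L.homogeneous ds vs \<longrightarrow> length vs = 2 \<longrightarrow> \<not> sparse ds \<longrightarrow> l2 vs = 0"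
        and vs: "L.homogeneous ds vs" "length vs = 2" "\<not> sparse ds"
      from vs(1,2) obtain i j u v where uv: "vs = [u, v]" "u \<in> L i" "v \<in> L j"
        by (rule L_tuple_2)
      have "l2 [u, v] = 0" using * vs uv(1) by blast
      then show "ext_circ circ vs = 0"
        using uv by (simp add: l2_eq homogI ext_circ_def zero_prod_def)
    qed
    then show ?thesis
      using L.perm_sparse_map[OF graded_C _ cyc_permutes(10), of "[i, j]" "[u, v]"] vs
      by (simp add: permute_list1_cyc' del: cycle_of_list.simps)
  qed
  have s1: "pcomp L s 1 (1, -1, ext_D D) [u, v] = (0, S (D (snd u)) (fst v))"
    by (simp add: pcomp_def ext_S_def ext_D_def sgn_deg_def)
  have s2: "pcomp L s 2 (1, -1, ext_D D) [u, v] = l2 [u, v] - ext_circ circ [u, v]"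
    by (simp add: l2_def)
  have "S (D (snd u)) (fst v) = S (fst v) (D (snd u))"
    using uv by (intro S_sym) simp_all
  then have "l2 [v, u] = ext_circ circ [v, u] + (0, S (D (snd u)) (fst v))"
    using uv by (simp add: l2_eq ext_circ_def)
  then show "b2 vs = ((1/2) *\<^sub>R (ext_circ circ - perm L (ext_circ circ) (cyc [1,2]) - pcomp L s 1 (1, -1, ext_D D)
     + pcomp L s 2 (1, -1, ext_D D))) vs"
    using uv
    by (simp only: vs(1) b2_eq scaleR_fun_apply fun_apply_simps C s1 s2) simp
qed

lemma s_circ_eval:
  "pcomp L s 1 (2, 0, ext_circ circ) [u, v, w] = (0, S (circ (fst u) (fst v)) (fst w))"
  by (simp add: pcomp_def sgn_deg_def ext_circ_def ext_S_def)

text \<open>S(u, v \<circ> w) = S(v \<circ> w, u) arises from S(u \<circ> v, w) by an even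
  permutation, so the two halves of the correction agree and 1/24 doubles to 1/12. In the first term
  the six equal summands cancel 1/6.\<close>

lemma b3_formula: "map_eq L b3 3 (\<Omega> - (1/12) *\<^sub>R alternating_sum L 3 (pcomp L s 1 (2, 0, ext_circ circ)))"
proof (rule map_eq_3I, goal_cases)
  case 1
  show ?case by (rule L.vanishes_graded[OF graded_b3]) simp
next
  case 2
  show ?case
    by (rule L.vanishes_graded[where k = 1])
      (intro L.graded_map_diff graded_\<Omega> L.graded_map_scale L.graded_map_alternating_sum graded_s_l2, simp)
next
  case (4 x y a)
  then show ?case using circ_skew[of y x]
    by (simp add: fun_apply_simps alternating_sum_3[OF graded_s_l2(3), unfolded One_nat_def] s_circ_eval[unfolded One_nat_def] T_def P_circ circ_10 scaleR_prod_def)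
      (rule eq_by_linear_functionals, simp add: linear_functional_simps)
next
  case (5 x y a)
  then show ?case using circ_skew[of y x]
    by (simp add: fun_apply_simps alternating_sum_3[OF graded_s_l2(3), unfolded One_nat_def] s_circ_eval[unfolded One_nat_def] T_def P_circ circ_10 scaleR_prod_def)
      (rule eq_by_linear_functionals, simp add: linear_functional_simps)
next
  case (6 x y a)
  then show ?case using circ_skew[of y x]
    by (simp add: fun_apply_simps alternating_sum_3[OF graded_s_l2(3), unfolded One_nat_def] s_circ_eval[unfolded One_nat_def] T_def P_circ circ_10 scaleR_prod_def)
      (rule eq_by_linear_functionals, simp add: linear_functional_simps)
qed (simp_all add: fun_apply_simps alternating_sum_3[OF graded_s_l2(3), unfolded One_nat_def] s_circ_eval[unfolded One_nat_def] circ_10 scaleR_prod_def S_00 S_11 pair_zero)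

lemma b4_formula: "map_eq L b4 4 (pcomp L s 1 (3, 1, \<Omega>))"
proof (rule map_eq_4I, goal_cases)
  case 1
  show ?case by (rule L.vanishes_graded[OF graded_b4]) simp
next
  case 2
  show ?case by (rule L.vanishes_graded[OF graded_s_\<Omega>(1)]) simp
qed (simp_all add: ev Q_def del: cycle_of_list.simps)

text \<open>Most of the identities above are stated with the compositions of zero maps already
  removed; \<open>zero_maps\<close> brings the definition and \<open>pentagon_l2\<close> to the same
  shape.\<close>

lemma weak_lie_3_algebra_l: "weak_lie_3_algebra L d l2 \<Omega> 0 s 0 0 0"
  unfolding weak_lie_3_algebra_def leibniz_3_algebra_def Let_def zero_maps
proof (intro conjI)
  show "map_eq L (0 :: _ \<Rightarrow> ('m \<Rightarrow> 'e) \<times> ('m \<Rightarrow> real)) 2 0"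
    by (simp add: map_eq_def)
qed (use complex_L graded_l2 graded_s graded_\<Omega> L.graded_map_zero boundary_l2 boundary_l3 boundary_l4
      pentagon_l2[unfolded zero_maps] boundary_l21 boundary_l211 boundary_l31 boundary_l32 symmetry_l31 hexagon_l21 symmetry_l32 symmetry_l4_12 symmetry_l4_23 symmetry_l4_34
    in \<open>simp_all only:\<close>)

lemma lie_3_algebra_b: "lie_3_algebra L d b2 b3 b4"
  unfolding lie_3_algebra_def leibniz_3_algebra_def Let_def
  by (intro conjI complex_L graded_b2 graded_b3 graded_b4 boundary_b2 boundary_b3 boundary_b4 pentagon_b
      skew_b2 skew_b3 skew_b4)

end

theorem corollary5p5:
  fixes M :: "'m::{t2_space, second_countable_topology} manifold"
    and E0 E1 :: "('m, 'e::real_vector) vbundle"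
    and del :: "'m \<Rightarrow> 'e \<Rightarrow> 'e"
    and rho :: "'m \<Rightarrow> 'e \<Rightarrow> ('m \<Rightarrow> real) \<Rightarrow> real"
    and circ :: "('m \<Rightarrow> 'e) \<Rightarrow> ('m \<Rightarrow> 'e) \<Rightarrow> 'm \<Rightarrow> 'e"
    and Om :: "('m \<Rightarrow> 'e) \<Rightarrow> ('m \<Rightarrow> 'e) \<Rightarrow> ('m \<Rightarrow> 'e) \<Rightarrow> 'm \<Rightarrow> 'e"
    and S :: "('m \<Rightarrow> 'e) \<Rightarrow> ('m \<Rightarrow> 'e) \<Rightarrow> 'm \<Rightarrow> real"
    and D :: "('m \<Rightarrow> real) \<Rightarrow> 'm \<Rightarrow> 'e"
  assumes "clwx_2_algebroid M E0 E1 del rho circ Om S D"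
  shows
    "let L = clwx_space M E0 E1; d = clwx_diff del D;
         C = ext_circ circ; \<Omega> = ext_Om Om; s = ext_S S; \<D> = (1, -1, ext_D D);
         l2 = C + pcomp L s 2 \<D>; l3 = \<Omega>; l21 = s;
         l2_bar = skew_2 L l2; l3_bar = skew_3 L l2 l3 l21; l4_bar = skew_4 L l2 l3 0 l21 0 0
     in weak_lie_3_algebra L d l2 l3 0 l21 0 0 0 \<and>
        lie_3_algebra L d l2_bar l3_bar l4_bar \<and>
        map_eq L l2_bar 2
          ((1/2) *\<^sub>R (C - perm L C (cyc [1,2]) - pcomp L s 1 \<D> + pcomp L s 2 \<D>)) \<and>
        map_eq L l3_bar 3 (\<Omega> - (1/12) *\<^sub>R alternating_sum L 3 (pcomp L s 1 (2, 0, C))) \<and>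
        map_eq L l4_bar 4 (pcomp L s 1 (3, 1, \<Omega>))"
proof -
  interpret clwx M E0 E1 del rho circ Om S D
    using assms by unfold_locales
  show ?thesis
    using weak_lie_3_algebra_l lie_3_algebra_b b2_formula b3_formula b4_formula
    unfolding Let_def b2_def b3_def b4_def l2_def by blast
qed

end
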